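(* For any $p\in[0,1]$ there is an unbiased shift $T\ge0$ embedding $\delta_0$ (the unit mass at $0$) and such that $\mathbb{P}_0\{T=0\}=p$.
   Context: Let $\Omega$ be the set of continuous functions $\omega:\mathbb{R}\to\mathbb{R}$ with the Kolmogorov product $\sigma$-algebra, let $B=(B_t)_{t\in\mathbb{R}}$ be the identity (coordinate process) on $\Omega$, and let $\mathbb{P}_0$ be the law of a two-sided standard Brownian motion with $B_0=0$. A random time is a measurable function $T$ of $B$ with values in $\mathbb{R}$ (times that may be infinite on a $\mathbb{P}_0$-null set are understood up to that null set). $T$ is an unbiased shift if, under $\mathbb{P}_0$, $(B_{T+t}-B_T)_{t\in\mathbb{R}}$ is a two-sided standard Brownian motion independent of $B_T$. $T$ embeds a probability measure $\nu$ on $\mathbb{R}$ if $B_T$ has distribution $\nu$ under $\mathbb{P}_0$. *)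

theory Defs
  imports "HOL-Probability.Probability"
begin

text \<open>
  The space of continuous paths on the whole real line. Since its carrier is not a measurable set
  of the product space, the \<open>\<sigma>\<close>-algebra is the trace of the Kolmogorov product \<open>\<sigma>\<close>-algebra, which is
  the one generated by the coordinate maps.
\<close>

definition path_space :: "(real \<Rightarrow> real) measure" where
  "path_space = restrict_space (\<Pi>\<^sub>M t\<in>UNIV. borel) {\<omega>. continuous_on UNIV \<omega>}"

text \<open>
  The second argument of \<^const>\<open>normal_density\<close> is the standard deviation. The value at time 0 is
  only prescribed almost surely because, on \<^const>\<open>path_space\<close>, paths may start anywhere.
\<close>

definition two_sided_BM :: "'a measure \<Rightarrow> (real \<Rightarrow> 'a \<Rightarrow> real) \<Rightarrow> bool" where
  "two_sided_BM M X \<longleftrightarrow>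
     prob_space M \<and>
     (\<forall>t. X t \<in> borel_measurable M) \<and>
     (\<forall>\<omega>\<in>space M. continuous_on UNIV (\<lambda>t. X t \<omega>)) \<and>
     (AE \<omega> in M. X 0 \<omega> = 0) \<and>
     (\<forall>s t. s < t \<longrightarrow>
        distributed M lborel (\<lambda>\<omega>. X t \<omega> - X s \<omega>) (\<lambda>x. ennreal (normal_density 0 (sqrt (t - s)) x))) \<and>
     (\<forall>n (\<tau> :: nat \<Rightarrow> real). (\<forall>i<n. \<tau> i < \<tau> (Suc i)) \<longrightarrow>
        prob_space.indep_vars M (\<lambda>_. borel) (\<lambda>i \<omega>. X (\<tau> (Suc i)) \<omega> - X (\<tau> i) \<omega>) {..<n})"

text \<open>
  \<open>P\<close> is the law \<open>\<P>\<^sub>0\<close> of two-sided standard Brownian motion: under \<open>P\<close> the coordinate process is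
  such a Brownian motion. The finite-dimensional distributions determine \<open>P\<close> uniquely.
\<close>

definition two_sided_BM_law :: "(real \<Rightarrow> real) measure \<Rightarrow> bool" where
  "two_sided_BM_law P \<longleftrightarrow> sets P = sets path_space \<and> two_sided_BM P (\<lambda>t \<omega>. \<omega> t)"

definition random_time :: "((real \<Rightarrow> real) \<Rightarrow> real) \<Rightarrow> bool" where
  "random_time T \<longleftrightarrow> T \<in> borel_measurable path_space"

definition shifted_path :: "((real \<Rightarrow> real) \<Rightarrow> real) \<Rightarrow> (real \<Rightarrow> real) \<Rightarrow> (real \<Rightarrow> real)" where
  "shifted_path T \<omega> = (\<lambda>t. \<omega> (T \<omega> + t) - \<omega> (T \<omega>))"

text \<open>
  Independence of the shifted path from the value at \<open>T\<close> is stated through the generated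
  \<open>\<sigma>\<close>-algebras, as \<^const>\<open>prob_space.indep_var\<close> only relates random variables of the same type.
\<close>

definition unbiased_shift ::
    "(real \<Rightarrow> real) measure \<Rightarrow> ((real \<Rightarrow> real) \<Rightarrow> real) \<Rightarrow> bool" where
  "unbiased_shift P T \<longleftrightarrow>
     random_time T \<and>
     two_sided_BM P (\<lambda>t \<omega>. shifted_path T \<omega> t) \<and>
     prob_space.indep_set P
       {shifted_path T -` A \<inter> space P | A. A \<in> sets path_space}
       {(\<lambda>\<omega>. \<omega> (T \<omega>)) -` C \<inter> space P | C. C \<in> sets borel}"

definition embeds ::
    "(real \<Rightarrow> real) measure \<Rightarrow> ((real \<Rightarrow> real) \<Rightarrow> real) \<Rightarrow> real measure \<Rightarrow> bool" where
  "embeds P T \<nu> \<longleftrightarrow> distr P borel (\<lambda>\<omega>. \<omega> (T \<omega>)) = \<nu>"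

end

theory Submission
  imports Defs
begin

text \<open>
  With \<open>L\<close> the local time of \<open>B\<close> at \<open>0\<close> and \<open>\<tau>\<close> the time at which it exceeds \<open>1\<close>, the shift \<open>S\<close> of
  \<open>B\<close> by \<open>\<tau>\<close> preserves \<open>\<P>\<^sub>0\<close> and \<open>B\<^sub>\<tau> = 0\<close>. Given an event \<open>A\<close> of probability \<open>p\<close>, one does not move on
  \<open>A\<close> and iterates \<open>S\<close> until the first return to the complement of \<open>A\<close> otherwise: first return maps
  preserve the measure, and \<open>T = 0\<close> exactly on \<open>A\<close> since \<open>\<tau> > 0\<close>.

  The local time is the \<open>L\<^sup>2\<close> limit of the occupation integrals \<open>\<integral>\<^sub>0\<^sup>u g\<^sub>e(B\<^sub>v) dv\<close>, where \<open>g\<^sub>e\<close> is the centred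
  Gaussian density of variance \<open>e\<close>; the two-point function of \<open>B\<close> gives explicit rates. That \<open>S\<close>
  preserves \<open>\<P>\<^sub>0\<close> is a mass transport argument: \<open>\<P>\<^sub>0\<close> is invariant under reversing a path at a fixed
  time \<open>u\<close>, which exchanges the roles of \<open>0\<close> and \<open>u\<close> in \<open>E \<integral> f(\<theta>\<^sub>u B) h(L\<^sub>u) g\<^sub>e(B\<^sub>u) du\<close>. As \<open>e\<close> tends to \<open>0\<close> the
  integral becomes \<open>\<integral> f(\<theta>\<^bsub>\<tau>(r)\<^esub> B) h(r) dr\<close>, and its mirror image \<open>f(B) \<integral> h(r) dr\<close>; finally \<open>h\<close> is
  concentrated at \<open>r = 1\<close>.
\<close>

section \<open>Centred Gaussian densities\<close>

text \<open>Since the path vanishes at \<open>T\<close> almost surely, independence of this value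
  from the shifted path is automatic: all its events have probability 0 or 1. The work lies in
  producing a measure preserving shift by a positive time. The obstacle to the reversal argument is
  that reversing at \<open>u\<close> turns the occupation of 0 into that of the level reached at
  time \<open>u\<close>. The weight makes this level of order \<open>sqrt e\<close>, but a kernel of
  variance \<open>d\<close> has Lipschitz constant of order \<open>1 / d\<close>, so with
  \<open>d = e\<close> the error explodes. Hence two scales: inside the local time the variance is
  frozen at \<open>d\<close> while \<open>e\<close> tends to 0, and exchanging \<open>d\<close> for
  \<open>e\<close> there is paid for by an estimate uniform in time. That estimate reduces to
  finitely many times because occupation integrals increase in time. Gaussian kernels are convenient
  because products and convolutions stay Gaussian, which gives all two-point functions in closed
  form. The local time is handled at rational times, which determine its right-continuous
  inverse.\<close>

definition gauss :: "real \<Rightarrow> real \<Rightarrow> real" where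
  "gauss e x = exp (- x\<^sup>2 / (2 * e)) / sqrt (2 * pi * e)"

lemma normal_density_eq_gauss: "0 < e \<Longrightarrow> normal_density 0 (sqrt e) x = gauss e x"
  by (simp add: normal_density_def gauss_def)

lemma gauss_pos: "0 < e \<Longrightarrow> 0 < gauss e x"
  by (simp add: gauss_def)

lemma gauss_nonneg [simp]: "0 \<le> e \<Longrightarrow> 0 \<le> gauss e x"
  by (simp add: gauss_def)

lemma gauss_zero: "gauss e 0 = 1 / sqrt (2 * pi * e)"
  by (simp add: gauss_def)

lemma gauss_le_zero: "0 < e \<Longrightarrow> gauss e x \<le> gauss e 0"
  by (simp add: gauss_def divide_right_mono)

lemma gauss_zero_antimono: "0 < a \<Longrightarrow> a \<le> b \<Longrightarrow> gauss b 0 \<le> gauss a 0"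
  by (simp add: gauss_zero frac_le)

lemma gauss_minus [simp]: "gauss e (- x) = gauss e x"
  by (simp add: gauss_def)

lemma continuous_on_gauss [continuous_intros]:
  "continuous_on A f \<Longrightarrow> continuous_on A (\<lambda>x. gauss e (f x))"
proof -
  assume "continuous_on A f"
  then have "continuous_on A (\<lambda>x. exp (- (f x)\<^sup>2 * inverse (2 * e)) * inverse (sqrt (2 * pi * e)))"
    by (intro continuous_intros)
  then show ?thesis by (simp only: gauss_def divide_inverse)
qed

lemma borel_measurable_gauss [measurable]: "gauss e \<in> borel_measurable borel"
  unfolding gauss_def by measurable

text \<open>Half of the exponent absorbs the factor \<open>\<bar>x\<bar>\<close>: with
  \<open>y\<close> a quarter of the squared ratio \<open>x / sqrt e\<close>, the bound
  \<open>2 * sqrt y \<le> 1 + y \<le> exp y\<close> leaves one factor \<open>exp (- y)\<close>,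
  which is the Gaussian of doubled variance. The gain \<open>sqrt e\<close> says that the weight
  \<open>gauss e\<close> lives near 0.\<close>

lemma abs_mult_gauss_le:
  assumes "0 < e"
  shows "\<bar>x\<bar> * gauss e x \<le> 2 * sqrt e * gauss (2 * e) x"
proof -
  define y where "y = x\<^sup>2 / (4 * e)"
  have y0: "0 \<le> y" using assms by (simp add: y_def)
  have "0 \<le> (1 - sqrt y)\<^sup>2" by simp
  then have a: "2 * sqrt y \<le> exp y"
    using exp_ge_add_one_self[of y] y0 by (simp add: power2_diff del: exp_ge_add_one_self)
  have sx: "\<bar>x\<bar> = 2 * sqrt e * sqrt y"
    using assms by (simp add: y_def real_sqrt_divide real_sqrt_mult)
  have e1: "gauss e x = exp (- y) * exp (- y) / sqrt (2 * pi * e)"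
    unfolding gauss_def y_def mult_exp_exp using assms by (simp add: field_simps)
  have e2: "gauss (2 * e) x = exp (- y) / sqrt (2 * pi * (2 * e))"
    unfolding gauss_def y_def using assms by (simp add: field_simps)
  have e3: "sqrt (2 * pi * (2 * e)) = sqrt 2 * sqrt (2 * pi * e)"
    by (simp add: real_sqrt_mult)
  have "sqrt y * exp (- y) \<le> 1 / 2"
    using a by (simp add: exp_minus field_simps)
  also have "\<dots> \<le> 1 / sqrt 2"
    using sqrt2_less_2 by (intro divide_left_mono) auto
  finally have "(sqrt y * exp (- y)) * (2 * sqrt e * exp (- y) / sqrt (2 * pi * e))
      \<le> (1 / sqrt 2) * (2 * sqrt e * exp (- y) / sqrt (2 * pi * e))"
    using assms by (intro mult_right_mono) auto
  then show ?thesis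
    unfolding sx e1 e2 e3 by (simp add: mult_ac)
qed

text \<open>The derivative is \<open>- z / e * gauss e z\<close>, to which
  \<open>abs_mult_gauss_le\<close> applies. The constant is of order \<open>1 / e\<close>.\<close>

lemma gauss_lipschitz:
  assumes "0 < e"
  shows "\<bar>gauss e x - gauss e y\<bar> \<le> (2 / sqrt e * gauss (2 * e) 0) * \<bar>x - y\<bar>"
proof -
  have "(gauss e has_real_derivative (- z / e * gauss e z)) (at z within UNIV)" for z
    unfolding gauss_def using assms
    by (auto intro!: derivative_eq_intros simp: field_simps)
  moreover have "norm (- z / e * gauss e z) \<le> 2 / sqrt e * gauss (2 * e) 0" for z
  proof -
    have "norm (- z / e * gauss e z) = (\<bar>z\<bar> * gauss e z) / e"
      using assms by (simp add: abs_mult)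
    also have "\<dots> \<le> (2 * sqrt e * gauss (2 * e) 0) / e"
      using abs_mult_gauss_le[OF assms, of z] gauss_le_zero[of "2 * e" z] assms
      by (intro divide_right_mono) (auto elim!: order_trans)
    also have "\<dots> = 2 / sqrt e * gauss (2 * e) 0"
      using assms by (simp add: field_simps)
    finally show ?thesis .
  qed
  ultimately show ?thesis
    using field_differentiable_bound[of UNIV "gauss e" "\<lambda>z. - z / e * gauss e z" "2 / sqrt e * gauss (2 * e) 0" x y]
    by (auto simp: convex_UNIV)
qed

text \<open>Exponents add, so inverse variances add. The constant left over is again a Gaussian
  density at 0, which keeps the two-point function in closed form.\<close>

lemma gauss_mult:
  assumes "0 < a" "0 < b"
  shows "gauss a x * gauss b x = gauss (a + b) 0 * gauss (a * b / (a + b)) x"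
proof -
  have "- x\<^sup>2 / (2 * a) + - x\<^sup>2 / (2 * b) = - x\<^sup>2 / (2 * (a * b / (a + b)))"
    using assms by (simp add: field_simps)
  moreover have "sqrt (2 * pi * a) * sqrt (2 * pi * b)
      = sqrt (2 * pi * (a + b)) * sqrt (2 * pi * (a * b / (a + b)))"
    using assms by (simp add: real_sqrt_mult[symmetric])
  ultimately show ?thesis
    by (simp add: gauss_def mult_exp_exp)
qed

lemma nn_integral_gauss_conv:
  assumes "0 < a" "0 < b"
  shows "(\<integral>\<^sup>+y. ennreal (gauss a (x - y) * gauss b y) \<partial>lborel) = ennreal (gauss (a + b) x)"
proof -
  have "(\<integral>\<^sup>+y. ennreal (normal_density 0 (sqrt a) (x - y) * normal_density 0 (sqrt b) y) \<partial>lborel)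
      = ennreal (normal_density 0 (sqrt (a + b)) x)"
    using fun_cong[OF conv_normal_density_zero_mean[of "sqrt a" "sqrt b"], of x] assms by simp
  then show ?thesis
    using assms by (simp only: normal_density_eq_gauss add_pos_pos)
qed

lemma nn_integral_gauss_mult:
  assumes "0 < a" "0 < b"
  shows "(\<integral>\<^sup>+y. ennreal (gauss a y * gauss b y) \<partial>lborel) = ennreal (gauss (a + b) 0)"
  using nn_integral_gauss_conv[OF assms, of 0] by (simp only: diff_0 gauss_minus)

lemma nn_integral_gauss_conv':
  assumes "0 < a" "0 < b"
  shows "(\<integral>\<^sup>+y. ennreal (gauss a (x + y) * gauss b y) \<partial>lborel) = ennreal (gauss (a + b) x)"
proof -
  have "gauss a (x + y) = gauss a (- x - y)" for y
    using gauss_minus[of a "x + y"] by simp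
  then show ?thesis
    using nn_integral_gauss_conv[OF assms, of "- x"] by simp
qed

text \<open>The integrand is a multiple of the inverse square root of \<open>u + c\<close>. All time
  integrals of one- and two-point functions of the unweighted occupation integrals reduce to this
  one; the offset \<open>c\<close> carries the regularisation.\<close>

lemma has_integral_gauss_zero:
  assumes "a \<le> b" "0 < a + c"
  shows "((\<lambda>u. gauss (u + c) 0) has_integral sqrt (2 / pi) * (sqrt (b + c) - sqrt (a + c))) {a..b}"
proof -
  have "((\<lambda>u. gauss (u + c) 0) has_integral
      (sqrt (2 / pi) * sqrt (b + c) - sqrt (2 / pi) * sqrt (a + c))) {a..b}"
  proof (rule fundamental_theorem_of_calculus[OF assms(1)])
    fix x assume x: "x \<in> {a..b}"
    then have pos: "0 < x + c" using assms by simp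
    have "((\<lambda>u. sqrt (2 / pi) * sqrt (u + c)) has_real_derivative
        sqrt (2 / pi) * (inverse (sqrt (x + c)) / 2)) (at x within {a..b})"
      using pos by (auto intro!: derivative_eq_intros)
    moreover have "sqrt (2 / pi) * (inverse (sqrt (x + c)) / 2) = gauss (x + c) 0"
    proof -
      define X where "X = sqrt pi * sqrt (x + c)"
      have "sqrt (2 / pi) * (inverse (sqrt (x + c)) / 2) = (sqrt 2 / 2) * (1 / X)"
        by (simp add: X_def real_sqrt_divide inverse_eq_divide)
      also have "sqrt 2 / 2 = 1 / sqrt (2 :: real)"
        by (simp add: real_div_sqrt field_simps)
      also have "1 / sqrt 2 * (1 / X) = gauss (x + c) 0"
        by (simp add: X_def gauss_zero real_sqrt_mult)
      finally show ?thesis .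
    qed
    ultimately show "((\<lambda>u. sqrt (2 / pi) * sqrt (u + c)) has_vector_derivative gauss (x + c) 0) (at x within {a..b})"
      by (simp add: has_real_derivative_iff_has_vector_derivative)
  qed
  then show ?thesis by (simp only: right_diff_distrib)
qed

section \<open>The law of Brownian motion on path space\<close>

lemma space_path_space: "space path_space = {\<omega>. continuous_on UNIV \<omega>}"
  by (simp add: path_space_def space_restrict_space space_PiM)

lemma measurable_path_space_eval [measurable]: "(\<lambda>\<omega>. \<omega> t) \<in> borel_measurable path_space"
  unfolding path_space_def by (rule measurable_restrict_space1) simp

lemma measurable_path_spaceI:
  assumes "\<And>t. (\<lambda>x. f x t) \<in> borel_measurable M"
    and "\<And>x. x \<in> space M \<Longrightarrow> continuous_on UNIV (f x)"
  shows "f \<in> M \<rightarrow>\<^sub>M path_space"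
  unfolding path_space_def
proof (rule measurable_restrict_space2)
  show "f \<in> space M \<rightarrow> {\<omega>. continuous_on UNIV \<omega>}"
    using assms(2) by auto
  have "(\<lambda>x. \<lambda>t\<in>UNIV. f x t) \<in> M \<rightarrow>\<^sub>M (\<Pi>\<^sub>M t\<in>UNIV. borel)"
    using assms(1) by (intro measurable_restrict) auto
  then show "f \<in> M \<rightarrow>\<^sub>M (\<Pi>\<^sub>M t\<in>UNIV. borel)"
    by (simp add: restrict_UNIV)
qed

text \<open>Rounding the time down to a grid of width \<open>1 / real (Suc n)\<close> leaves
  countably many values of \<open>u\<close>, hence a measurable function; by continuity in
  \<open>u\<close> these functions converge pointwise.\<close>

lemma borel_measurable_caratheodory:
  fixes f :: "real \<Rightarrow> 'a \<Rightarrow> real"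
  assumes meas: "\<And>u. f u \<in> borel_measurable M"
    and cont: "\<And>\<omega>. \<omega> \<in> space M \<Longrightarrow> continuous_on UNIV (\<lambda>u. f u \<omega>)"
  shows "(\<lambda>(u, \<omega>). f u \<omega>) \<in> borel_measurable (borel \<Otimes>\<^sub>M M)"
proof (rule borel_measurable_LIMSEQ_real)
  let ?r = "\<lambda>n u. real_of_int \<lfloor>u * real (Suc n)\<rfloor> / real (Suc n)"
  have lim: "(\<lambda>n. ?r n u) \<longlonglongrightarrow> u" for u :: real
  proof (rule tendsto_sandwich)
    show "\<forall>\<^sub>F n in sequentially. u - inverse (real (Suc n)) \<le> ?r n u"
    proof (intro always_eventually allI)
      fix n
      have "u * real (Suc n) - 1 \<le> real_of_int \<lfloor>u * real (Suc n)\<rfloor>" by linarith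
      then have "(u * real (Suc n) - 1) / real (Suc n) \<le> ?r n u"
        by (intro divide_right_mono) auto
      then show "u - inverse (real (Suc n)) \<le> ?r n u"
        by (simp add: diff_divide_distrib inverse_eq_divide del: of_nat_Suc)
    qed
    show "\<forall>\<^sub>F n in sequentially. ?r n u \<le> u"
      by (intro always_eventually allI) (simp add: pos_divide_le_eq del: of_nat_Suc)
    show "(\<lambda>n. u - inverse (real (Suc n))) \<longlonglongrightarrow> u"
      using tendsto_diff[OF tendsto_const[of u] LIMSEQ_inverse_real_of_nat] by simp
  qed simp
  show "(\<lambda>i. case x of (u, \<omega>) \<Rightarrow> f (?r i u) \<omega>) \<longlonglongrightarrow> (case x of (u, \<omega>) \<Rightarrow> f u \<omega>)"
    if "x \<in> space (borel \<Otimes>\<^sub>M M)" for x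
  proof (cases x)
    case (Pair u \<omega>)
    then have "\<omega> \<in> space M" using that by (simp add: space_pair_measure)
    then have "isCont (\<lambda>u. f u \<omega>) u"
      using cont by (simp add: continuous_on_eq_continuous_at)
    then show ?thesis
      using isCont_tendsto_compose[OF _ lim[of u]] Pair by simp
  qed
  show "(\<lambda>(u, \<omega>). f (?r i u) \<omega>) \<in> borel_measurable (borel \<Otimes>\<^sub>M M)" for i
  proof -
    have "(\<lambda>x. (\<lambda>k x. f (real_of_int k / real (Suc i)) (snd x)) \<lfloor>fst x * real (Suc i)\<rfloor> x)
        \<in> borel_measurable (borel \<Otimes>\<^sub>M M)"
      by (rule measurable_compose_countable) (use meas in measurable)
    then show ?thesis by (simp add: case_prod_beta')
  qed
qed

text \<open>The sets \<open>S J c\<close> are a generating pi-system: constraints at a common time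
  merge by taking the larger threshold, and the empty \<open>J\<close> gives the whole
  space.\<close>

lemma path_space_eqI:
  assumes sets: "sets M = sets path_space" "sets N = sets path_space"
    and prob: "prob_space M" "prob_space N"
    and eq: "\<And>J c. finite J \<Longrightarrow> measure M {\<omega> \<in> space path_space. \<forall>j\<in>J. c j < \<omega> j}
      = measure N {\<omega> \<in> space path_space. \<forall>j\<in>J. c j < \<omega> j}"
  shows "M = N"
proof -
  interpret M: prob_space M by fact
  interpret N: prob_space N by fact
  define S where "S J c = {\<omega> \<in> space path_space. \<forall>j\<in>J. c j < \<omega> j}"
    for J :: "real set" and c :: "real \<Rightarrow> real"
  define E where "E = {S J c | J c. finite J}"
  let ?\<Omega> = "space path_space"
  have E: "E \<subseteq> Pow ?\<Omega>" by (auto simp: E_def S_def)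
  have S_sets: "S J c \<in> sets path_space" if "finite J" for J c
    unfolding S_def using that by measurable
  have gen: "sets path_space = sigma_sets ?\<Omega> E"
  proof (rule antisym)
    show "sigma_sets ?\<Omega> E \<subseteq> sets path_space"
      by (rule sets.sigma_sets_subset) (auto simp: E_def S_sets)
    have "(\<lambda>\<omega>. \<omega>) \<in> sigma ?\<Omega> E \<rightarrow>\<^sub>M path_space"
    proof (rule measurable_path_spaceI)
      fix t :: real
      show "(\<lambda>\<omega>. \<omega> t) \<in> borel_measurable (sigma ?\<Omega> E)"
        unfolding borel_measurable_iff_greater
      proof
        fix a
        have "{w \<in> space (sigma ?\<Omega> E). a < w t} = S {t} (\<lambda>_. a)"
          using E by (simp add: space_measure_of S_def)
        then show "{w \<in> space (sigma ?\<Omega> E). a < w t} \<in> sets (sigma ?\<Omega> E)"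
          using E by (auto simp: sets_measure_of E_def)
      qed
    qed (use E in \<open>auto simp: space_measure_of space_path_space\<close>)
    then have "(\<lambda>\<omega>. \<omega>) -` A \<inter> ?\<Omega> \<in> sigma_sets ?\<Omega> E" if "A \<in> sets path_space" for A
      using measurable_sets[of "\<lambda>\<omega>. \<omega>" "sigma ?\<Omega> E" path_space A] that E
      by (simp add: space_measure_of sets_measure_of)
    then show "sets path_space \<subseteq> sigma_sets ?\<Omega> E"
      using sets.sets_into_space[of _ path_space] by (auto simp: Int_absorb2)
  qed
  show ?thesis
  proof (rule measure_eqI_generator_eq[OF _ E])
    show "Int_stable E"
    proof (rule Int_stableI)
      fix a b assume "a \<in> E" "b \<in> E"
      then obtain J c K d where *: "a = S J c" "b = S K d" "finite J" "finite K"
        by (auto simp: E_def)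
      have "a \<inter> b = S (J \<union> K) (\<lambda>j. if j \<in> J then if j \<in> K then max (c j) (d j) else c j else d j)"
        unfolding * S_def by auto
      then show "a \<inter> b \<in> E" unfolding E_def using * by blast
    qed
    show "emeasure M X = emeasure N X" if "X \<in> E" for X
      using that eq by (auto simp: E_def S_def M.emeasure_eq_measure N.emeasure_eq_measure)
    have "S {} (\<lambda>_. 0) = ?\<Omega>" by (simp add: S_def)
    then have "?\<Omega> \<in> E" unfolding E_def by (metis (mono_tags, lifting) finite.emptyI mem_Collect_eq)
    then show "range (\<lambda>_::nat. ?\<Omega>) \<subseteq> E" by auto
  qed (use sets gen in auto)
qed

lemma distr_increments_BM:
  assumes BM: "two_sided_BM M X" and \<tau>: "\<forall>i<n. \<tau> i < \<tau> (Suc i)" and n: "0 < n"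
  shows "distr M (\<Pi>\<^sub>M i\<in>{..<n}. borel) (\<lambda>\<omega>. \<lambda>i\<in>{..<n}. X (\<tau> (Suc i)) \<omega> - X (\<tau> i) \<omega>)
    = (\<Pi>\<^sub>M i\<in>{..<n}. density lborel (\<lambda>x. ennreal (normal_density 0 (sqrt (\<tau> (Suc i) - \<tau> i)) x)))"
proof -
  interpret prob_space M using BM by (simp add: two_sided_BM_def)
  have X[measurable]: "X t \<in> borel_measurable M" for t
    using BM by (simp add: two_sided_BM_def)
  have "indep_vars (\<lambda>_. borel) (\<lambda>i \<omega>. X (\<tau> (Suc i)) \<omega> - X (\<tau> i) \<omega>) {..<n}"
    using BM \<tau> by (simp add: two_sided_BM_def)
  then have "distr M (\<Pi>\<^sub>M i\<in>{..<n}. borel) (\<lambda>\<omega>. \<lambda>i\<in>{..<n}. X (\<tau> (Suc i)) \<omega> - X (\<tau> i) \<omega>)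
      = (\<Pi>\<^sub>M i\<in>{..<n}. distr M borel (\<lambda>\<omega>. X (\<tau> (Suc i)) \<omega> - X (\<tau> i) \<omega>))"
    using n by (subst (asm) indep_vars_iff_distr_eq_PiM) auto
  also have "\<dots> = (\<Pi>\<^sub>M i\<in>{..<n}. density lborel (\<lambda>x. ennreal (normal_density 0 (sqrt (\<tau> (Suc i) - \<tau> i)) x)))"
  proof (intro PiM_cong refl)
    fix i assume "i \<in> {..<n}"
    then have "distributed M lborel (\<lambda>\<omega>. X (\<tau> (Suc i)) \<omega> - X (\<tau> i) \<omega>)
        (\<lambda>x. ennreal (normal_density 0 (sqrt (\<tau> (Suc i) - \<tau> i)) x))"
      using BM \<tau> by (simp add: two_sided_BM_def)
    then show "distr M borel (\<lambda>\<omega>. X (\<tau> (Suc i)) \<omega> - X (\<tau> i) \<omega>)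
        = density lborel (\<lambda>x. ennreal (normal_density 0 (sqrt (\<tau> (Suc i) - \<tau> i)) x))"
      by (simp add: distributed_def cong: distr_cong)
  qed
  finally show ?thesis .
qed

text \<open>Finitely many values of the process are sums of consecutive increments anchored at time
  0, and the joint law of the increments is a fixed product of Gaussians.\<close>

lemma two_sided_BM_unique:
  assumes BM: "two_sided_BM M X" "two_sided_BM N Y"
  shows "distr M path_space (\<lambda>\<omega> t. X t \<omega>) = distr N path_space (\<lambda>\<omega> t. Y t \<omega>)"
proof (rule path_space_eqI)
  have path: "(\<lambda>\<omega> t. Z t \<omega>) \<in> K \<rightarrow>\<^sub>M path_space" if "two_sided_BM K Z" for K :: "'c measure" and Z
    using that by (intro measurable_path_spaceI) (auto simp: two_sided_BM_def)
  show "prob_space (distr M path_space (\<lambda>\<omega> t. X t \<omega>))" "prob_space (distr N path_space (\<lambda>\<omega> t. Y t \<omega>))"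
    using BM path by (auto intro!: prob_space.prob_space_distr simp: two_sided_BM_def)
  fix J :: "real set" and c :: "real \<Rightarrow> real" assume J: "finite J"
  \<comment> \<open>Time 0 is inserted as the anchor, time 1 to guarantee at least one increment, as
    \<open>distr_increments_BM\<close> requires.\<close>
  define L where "L = sorted_list_of_set (insert 0 (insert 1 J))"
  define n where "n = length L - 1"
  have setL: "set L = insert 0 (insert 1 J)" and L: "sorted_wrt (<) L"
    unfolding L_def using J by (simp_all only: set_sorted_list_of_set finite_insert strict_sorted_list_of_set)
  have "length L = card (insert 0 (insert 1 J))"
    unfolding L_def by (rule length_sorted_list_of_set)
  also have "\<dots> \<ge> card {0, 1 :: real}"
    using J by (intro card_mono) auto
  finally have n: "0 < n" "length L = Suc n"
    by (auto simp: n_def)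
  define \<tau> where "\<tau> i = L ! i" for i
  have \<tau>: "\<forall>i<n. \<tau> i < \<tau> (Suc i)"
    using L n by (auto simp: \<tau>_def sorted_wrt_iff_nth_less)
  obtain i0 where i0: "i0 \<le> n" "\<tau> i0 = 0"
    using setL n unfolding \<tau>_def by (metis in_set_conv_nth insertI1 less_Suc_eq_le)
  define Q where "Q = (\<Pi>\<^sub>M i\<in>{..<n}. density lborel (\<lambda>x. ennreal (normal_density 0 (sqrt (\<tau> (Suc i) - \<tau> i)) x)))"
  \<comment> \<open>The value at \<open>\<tau> i\<close> is the sum of the first \<open>i\<close>
    increments minus the sum of the first \<open>i0\<close>, whether \<open>\<tau> i\<close> is
    before or after 0.\<close>
  define V where "V = {d \<in> space (\<Pi>\<^sub>M i\<in>{..<n}. borel :: real measure).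
      \<forall>i\<in>{i. i \<le> n \<and> \<tau> i \<in> J}. c (\<tau> i) < (\<Sum>k<i. d k) - (\<Sum>k<i0. d k)}"
  have V: "V \<in> sets (\<Pi>\<^sub>M i\<in>{..<n}. borel)"
  proof -
    have [measurable]: "(\<lambda>d. \<Sum>k<i. d k) \<in> borel_measurable (\<Pi>\<^sub>M i\<in>{..<n}. borel :: real measure)"
      if "i \<le> n" for i
      using that by (intro borel_measurable_sum measurable_component_singleton) auto
    show ?thesis
      unfolding V_def using i0
      by (intro sets.sets_Collect_finite_All) auto
  qed
  have *: "measure (distr K path_space (\<lambda>\<omega> t. Z t \<omega>)) {\<omega> \<in> space path_space. \<forall>j\<in>J. c j < \<omega> j} = measure Q V"
    if K: "two_sided_BM K Z" for K :: "'c measure" and Z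
  proof -
    interpret K: prob_space K using K by (simp add: two_sided_BM_def)
    have Z[measurable]: "Z t \<in> borel_measurable K" for t
      using K by (simp add: two_sided_BM_def)
    let ?D = "\<lambda>\<omega>. \<lambda>i\<in>{..<n}. Z (\<tau> (Suc i)) \<omega> - Z (\<tau> i) \<omega>"
    have D: "?D \<in> K \<rightarrow>\<^sub>M (\<Pi>\<^sub>M i\<in>{..<n}. borel)" by measurable
    have "measure (distr K path_space (\<lambda>\<omega> t. Z t \<omega>)) {\<omega> \<in> space path_space. \<forall>j\<in>J. c j < \<omega> j}
        = measure K ((\<lambda>\<omega> t. Z t \<omega>) -` {\<omega> \<in> space path_space. \<forall>j\<in>J. c j < \<omega> j} \<inter> space K)"
      using J by (intro measure_distr path[OF K]) measurable
    also have "\<dots> = measure K (?D -` V \<inter> space K)"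
    proof (rule K.finite_measure_eq_AE)
      show "AE x in K. (x \<in> (\<lambda>\<omega> t. Z t \<omega>) -` {\<omega> \<in> space path_space. \<forall>j\<in>J. c j < \<omega> j} \<inter> space K)
          = (x \<in> ?D -` V \<inter> space K)"
      proof -
        have "AE \<omega> in K. Z 0 \<omega> = 0" using K by (simp add: two_sided_BM_def)
        then show ?thesis
        proof eventually_elim
          case (elim \<omega>)
          have sum: "(\<Sum>k<i. ?D \<omega> k) = Z (\<tau> i) \<omega> - Z (\<tau> 0) \<omega>" if "i \<le> n" for i
          proof -
            have "(\<Sum>k<i. ?D \<omega> k) = (\<Sum>k<i. Z (\<tau> (Suc k)) \<omega> - Z (\<tau> k) \<omega>)"
              using that by (intro sum.cong) auto
            then show ?thesis
              using sum_lessThan_telescope[of "\<lambda>k. Z (\<tau> k) \<omega>" i] by simp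
          qed
          have "?D \<omega> \<in> space (\<Pi>\<^sub>M i\<in>{..<n}. borel)"
            by (simp add: space_PiM)
          then have "?D \<omega> \<in> V \<longleftrightarrow> (\<forall>i\<in>{i. i \<le> n \<and> \<tau> i \<in> J}. c (\<tau> i) < Z (\<tau> i) \<omega>)"
            unfolding V_def using sum i0 elim by auto
          also have "\<dots> \<longleftrightarrow> (\<forall>j\<in>J. c j < Z j \<omega>)"
          proof -
            have "\<exists>i\<le>n. \<tau> i = j" if "j \<in> J" for j
              using that setL n unfolding \<tau>_def
              by (metis in_set_conv_nth insertI2 less_Suc_eq_le)
            then show ?thesis by fastforce
          qed
          finally show ?case
            using K by (auto simp: space_path_space two_sided_BM_def)
        qed
      qed
      show "(\<lambda>\<omega> t. Z t \<omega>) -` {\<omega> \<in> space path_space. \<forall>j\<in>J. c j < \<omega> j} \<inter> space K \<in> sets K"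
        using J by (intro measurable_sets[OF path[OF K]]) measurable
      show "?D -` V \<inter> space K \<in> sets K"
        by (rule measurable_sets[OF D V])
    qed
    also have "\<dots> = measure (distr K (\<Pi>\<^sub>M i\<in>{..<n}. borel) ?D) V"
      by (rule measure_distr[symmetric, OF D V])
    also have "\<dots> = measure Q V"
      unfolding Q_def by (subst distr_increments_BM[OF K \<tau> n(1)]) simp
    finally show ?thesis .
  qed
  show "measure (distr M path_space (\<lambda>\<omega> t. X t \<omega>)) {\<omega> \<in> space path_space. \<forall>j\<in>J. c j < \<omega> j}
      = measure (distr N path_space (\<lambda>\<omega> t. Y t \<omega>)) {\<omega> \<in> space path_space. \<forall>j\<in>J. c j < \<omega> j}"
    using *[OF BM(1)] *[OF BM(2)] by simp
qed simp_all


text \<open>Every clause of \<open>two_sided_BM\<close> depends only on the law of the path, apart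
  from continuity, which holds because \<open>\<phi>\<close> takes values in
  \<open>path_space\<close>. Thus an identity of laws can be turned back into a statement about the
  shifted process.\<close>

lemma two_sided_BM_distr:
  assumes "prob_space M" and \<phi>: "\<phi> \<in> M \<rightarrow>\<^sub>M path_space"
    and law: "two_sided_BM_law (distr M path_space \<phi>)"
  shows "two_sided_BM M (\<lambda>t \<omega>. \<phi> \<omega> t)"
proof -
  let ?P = "distr M path_space \<phi>"
  interpret prob_space M by fact
  interpret P: prob_space ?P using law by (simp add: two_sided_BM_law_def two_sided_BM_def)
  note [measurable] = \<phi>
  have ev [measurable]: "(\<lambda>\<omega>. \<phi> \<omega> t) \<in> borel_measurable M" for t
    using measurable_compose[OF \<phi> measurable_path_space_eval] .
  have BM: "two_sided_BM ?P (\<lambda>t \<omega>. \<omega> t)" using law by (simp add: two_sided_BM_law_def)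
  show ?thesis
    unfolding two_sided_BM_def
  proof (intro conjI allI ballI impI)
    show "continuous_on UNIV (\<lambda>t. \<phi> \<omega> t)" if "\<omega> \<in> space M" for \<omega>
      using measurable_space[OF \<phi> that] by (simp add: space_path_space)
    show "AE \<omega> in M. \<phi> \<omega> 0 = 0"
      using BM AE_distrD[OF \<phi>, of "\<lambda>\<omega>. \<omega> 0 = 0"] by (simp add: two_sided_BM_def)
  next
    fix s t :: real assume "s < t"
    then have "distributed ?P lborel (\<lambda>\<omega>. \<omega> t - \<omega> s) (\<lambda>x. ennreal (normal_density 0 (sqrt (t - s)) x))"
      using BM by (simp add: two_sided_BM_def)
    then show "distributed M lborel (\<lambda>\<omega>. \<phi> \<omega> t - \<phi> \<omega> s) (\<lambda>x. ennreal (normal_density 0 (sqrt (t - s)) x))"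
      unfolding distributed_def by (subst (asm) distr_distr) (auto simp: o_def)
  next
    fix n :: nat and \<tau> :: "nat \<Rightarrow> real" assume \<tau>: "\<forall>i<n. \<tau> i < \<tau> (Suc i)"
    show "indep_vars (\<lambda>_. borel) (\<lambda>i \<omega>. \<phi> \<omega> (\<tau> (Suc i)) - \<phi> \<omega> (\<tau> i)) {..<n}"
    proof (cases "n = 0")
      case True
      then show ?thesis by (simp add: indep_vars_def indep_sets_def)
    next
      case False
      have "P.indep_vars (\<lambda>_. borel) (\<lambda>i \<omega>. \<omega> (\<tau> (Suc i)) - \<omega> (\<tau> i)) {..<n}"
        using BM \<tau> by (simp add: two_sided_BM_def)
      then have "distr ?P (\<Pi>\<^sub>M i\<in>{..<n}. borel) (\<lambda>\<omega>. \<lambda>i\<in>{..<n}. \<omega> (\<tau> (Suc i)) - \<omega> (\<tau> i))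
        = (\<Pi>\<^sub>M i\<in>{..<n}. distr ?P borel (\<lambda>\<omega>. \<omega> (\<tau> (Suc i)) - \<omega> (\<tau> i)))"
        using False by (subst (asm) P.indep_vars_iff_distr_eq_PiM) auto
      then show ?thesis
        using False by (subst indep_vars_iff_distr_eq_PiM) (auto simp: distr_distr o_def)
    qed
  qed (use ev assms(1) in auto)
qed

text \<open>Serves to reverse the order of the increments and to pass from natural numbers to the
  booleans as indices.\<close>

lemma (in prob_space) indep_vars_reindex:
  assumes inj: "inj_on r I" and indep: "indep_vars N X (r ` I)"
  shows "indep_vars (\<lambda>i. N (r i)) (\<lambda>i. X (r i)) I"
  unfolding indep_vars_def2
proof (intro conjI ballI)
  show "random_variable (N (r i)) (X (r i))" if "i \<in> I" for i
    using indep that by (simp add: indep_vars_def2)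
  let ?F = "\<lambda>j. {X j -` A \<inter> space M |A. A \<in> sets (N j)}"
  have F: "indep_sets ?F (r ` I)"
    using indep by (simp add: indep_vars_def2)
  show "indep_sets (\<lambda>i. ?F (r i)) I"
  proof (rule indep_setsI)
    show "?F (r i) \<subseteq> events" if "i \<in> I" for i
      using F that by (simp add: indep_sets_def)
    fix A J assume J: "J \<noteq> {}" "J \<subseteq> I" "finite J" and A: "\<forall>j\<in>J. A j \<in> ?F (r j)"
    have injJ: "inj_on r J" using inj J by (rule_tac inj_on_subset)
    define A' where "A' = A \<circ> the_inv_into J r"
    have A': "A' (r j) = A j" if "j \<in> J" for j
      using that injJ by (simp add: A'_def the_inv_into_f_f)
    have "prob (\<Inter>j\<in>r ` J. A' j) = (\<Prod>j\<in>r ` J. prob (A' j))"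
      using J A A' by (intro indep_setsD[OF F]) auto
    then show "prob (\<Inter>j\<in>J. A j) = (\<Prod>j\<in>J. prob (A j))"
      using A' by (simp add: prod.reindex[OF injJ])
  qed
qed

section \<open>Invariance of the law under reversal at a fixed time\<close>

definition reversal :: "real \<Rightarrow> (real \<Rightarrow> real) \<Rightarrow> real \<Rightarrow> real" where
  "reversal u \<omega> = (\<lambda>t. \<omega> (u - t) - \<omega> u)"

text \<open>An increment of the reversed process is minus an increment of \<open>X\<close> over the
  reflected interval, and centred Gaussians are symmetric. Subtracting \<open>X u \<omega>\<close>
  makes the process start at 0.\<close>

lemma two_sided_BM_reversal:
  assumes BM: "two_sided_BM M X"
  shows "two_sided_BM M (\<lambda>t \<omega>. X (u - t) \<omega> - X u \<omega>)"
proof -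
  interpret prob_space M using BM by (simp add: two_sided_BM_def)
  have X[measurable]: "X t \<in> borel_measurable M" for t
    using BM by (simp add: two_sided_BM_def)
  show ?thesis
    unfolding two_sided_BM_def
  proof (intro conjI allI ballI impI)
    show "prob_space M" by (rule prob_space_axioms)
    show "continuous_on UNIV (\<lambda>t. X (u - t) \<omega> - X u \<omega>)" if "\<omega> \<in> space M" for \<omega>
    proof -
      have "continuous_on UNIV (\<lambda>t. X t \<omega>)" using BM that by (simp add: two_sided_BM_def)
      then show ?thesis
        by (intro continuous_intros continuous_on_compose2[of UNIV "\<lambda>t. X t \<omega>" UNIV "\<lambda>t. u - t"]) auto
    qed
  next
    fix s t :: real assume "s < t"
    then have "distributed M lborel (\<lambda>\<omega>. X (u - s) \<omega> - X (u - t) \<omega>) (normal_density 0 (sqrt (t - s)))"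
    proof -
      have "\<forall>s t. s < t \<longrightarrow> distributed M lborel (\<lambda>\<omega>. X t \<omega> - X s \<omega>)
          (\<lambda>x. ennreal (normal_density 0 (sqrt (t - s)) x))"
        using BM by (simp add: two_sided_BM_def)
      from this[rule_format, of "u - t" "u - s"] show ?thesis
        using \<open>s < t\<close> by simp
    qed
    from normal_density_affine[OF this, of "-1" 0]
    show "distributed M lborel (\<lambda>\<omega>. X (u - t) \<omega> - X u \<omega> - (X (u - s) \<omega> - X u \<omega>))
        (\<lambda>x. ennreal (normal_density 0 (sqrt (t - s)) x))"
      using \<open>s < t\<close> by simp
  next
    fix n :: nat and \<tau> :: "nat \<Rightarrow> real" assume \<tau>: "\<forall>i<n. \<tau> i < \<tau> (Suc i)"
    \<comment> \<open>Reflection at \<open>u\<close> reverses the order, so the partition is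
      renumbered from its end to be increasing again; increment \<open>i\<close> of
      \<open>\<tau>\<close> then corresponds to increment \<open>n - Suc i\<close> of
      \<open>\<sigma>\<close>.\<close>
    define \<sigma> where "\<sigma> i = u - \<tau> (n - i)" for i
    let ?r = "\<lambda>i. n - Suc i"
    have "\<sigma> i < \<sigma> (Suc i)" if "i < n" for i
    proof -
      have "Suc (n - Suc i) = n - i" using that by simp
      then show ?thesis using \<tau>[rule_format, of "n - Suc i"] that by (simp add: \<sigma>_def)
    qed
    then have "indep_vars (\<lambda>_. borel) (\<lambda>i \<omega>. X (\<sigma> (Suc i)) \<omega> - X (\<sigma> i) \<omega>) {..<n}"
      using BM by (simp add: two_sided_BM_def)
    moreover have r: "?r ` {..<n} = {..<n}" "inj_on ?r {..<n}"
    proof -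
      show "inj_on ?r {..<n}" by (auto simp: inj_on_def)
      have "?r ` {..<n} \<subseteq> {..<n}" by auto
      then show "?r ` {..<n} = {..<n}"
        by (rule endo_inj_surj[OF finite_lessThan _ \<open>inj_on ?r {..<n}\<close>])
    qed
    ultimately have "indep_vars (\<lambda>_. borel) (\<lambda>i \<omega>. X (\<sigma> (Suc (?r i))) \<omega> - X (\<sigma> (?r i)) \<omega>) {..<n}"
      using indep_vars_reindex[OF r(2), of "\<lambda>_. borel" "\<lambda>i \<omega>. X (\<sigma> (Suc i)) \<omega> - X (\<sigma> i) \<omega>"] by simp
    then have "indep_vars (\<lambda>_. borel) (\<lambda>i \<omega>. - (X (\<sigma> (Suc (?r i))) \<omega> - X (\<sigma> (?r i)) \<omega>)) {..<n}"
      by (rule indep_vars_compose2) simp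
    also have "?this \<longleftrightarrow> indep_vars (\<lambda>_. borel)
        (\<lambda>i \<omega>. X (u - \<tau> (Suc i)) \<omega> - X u \<omega> - (X (u - \<tau> i) \<omega> - X u \<omega>)) {..<n}"
    proof (rule indep_vars_cong[OF refl _ refl])
      fix i assume "i \<in> {..<n}"
      then have "n - (n - Suc i) = Suc i" "n - Suc (n - Suc i) = i" by auto
      then show "(\<lambda>\<omega>. - (X (\<sigma> (Suc (?r i))) \<omega> - X (\<sigma> (?r i)) \<omega>))
          = (\<lambda>\<omega>. X (u - \<tau> (Suc i)) \<omega> - X u \<omega> - (X (u - \<tau> i) \<omega> - X u \<omega>))"
        by (simp add: \<sigma>_def)
    qed
    finally show "indep_vars (\<lambda>_. borel)
        (\<lambda>i \<omega>. X (u - \<tau> (Suc i)) \<omega> - X u \<omega> - (X (u - \<tau> i) \<omega> - X u \<omega>)) {..<n}" .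
  qed auto
qed

lemma reversal_measurable [measurable]: "reversal u \<in> path_space \<rightarrow>\<^sub>M path_space"
proof (rule measurable_path_spaceI)
  show "(\<lambda>\<omega>. reversal u \<omega> t) \<in> borel_measurable path_space" for t
    unfolding reversal_def by measurable
  fix \<omega> :: "real \<Rightarrow> real" assume "\<omega> \<in> space path_space"
  then show "continuous_on UNIV (reversal u \<omega>)"
    unfolding space_path_space reversal_def
    by (intro continuous_intros continuous_on_compose2[of UNIV \<omega> UNIV "\<lambda>t. u - t"]) auto
qed

lemma two_sided_BM_law_distr_eq:
  assumes law: "two_sided_BM_law P" and BM: "two_sided_BM P (\<lambda>t \<omega>. \<phi> \<omega> t)"
  shows "distr P path_space \<phi> = P"
proof -
  have "distr P path_space \<phi> = distr P path_space (\<lambda>\<omega>. \<omega>)"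
    using two_sided_BM_unique[OF BM, of P "\<lambda>t \<omega>. \<omega> t"] law by (simp add: two_sided_BM_law_def)
  also have "\<dots> = P"
    using law by (intro distr_id2) (simp add: two_sided_BM_law_def)
  finally show ?thesis .
qed

lemma distr_reversal:
  "two_sided_BM_law P \<Longrightarrow> distr P path_space (reversal u) = P"
  using two_sided_BM_reversal[of P "\<lambda>t \<omega>. \<omega> t" u]
  by (intro two_sided_BM_law_distr_eq) (simp_all add: reversal_def two_sided_BM_law_def)

declare measurable_path_space_eval [measurable del]

section \<open>Second moments of occupation integrals\<close>

context prob_space
begin

text \<open>Fubini for a bounded process with continuous paths. Continuity is available on
  \<open>{a..b}\<close> only, so the time is clamped to this interval by \<open>r\<close>; the
  clamped process is continuous on the whole line and jointly measurable.\<close>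

lemma
  fixes Y :: "real \<Rightarrow> 'a \<Rightarrow> real"
  assumes meas: "\<And>u. Y u \<in> borel_measurable M"
    and cont: "\<And>\<omega>. \<omega> \<in> space M \<Longrightarrow> continuous_on {a..b} (\<lambda>u. Y u \<omega>)"
    and bound: "\<And>u \<omega>. u \<in> {a..b} \<Longrightarrow> \<omega> \<in> space M \<Longrightarrow> \<bar>Y u \<omega>\<bar> \<le> C"
    and ab: "a \<le> b"
  shows borel_measurable_integral_path: "(\<lambda>\<omega>. integral {a..b} (\<lambda>u. Y u \<omega>)) \<in> borel_measurable M"
    and continuous_on_expectation: "continuous_on {a..b} (\<lambda>u. expectation (Y u))"
    and expectation_integral_path:
      "expectation (\<lambda>\<omega>. integral {a..b} (\<lambda>u. Y u \<omega>)) = integral {a..b} (\<lambda>u. expectation (Y u))"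
proof -
  define r where "r u = max a (min b u)" for u
  have r: "r u \<in> {a..b}" "u \<in> {a..b} \<Longrightarrow> r u = u" for u using ab by (auto simp: r_def)
  have "(\<lambda>(u, \<omega>). Y (r u) \<omega>) \<in> borel_measurable (borel \<Otimes>\<^sub>M M)"
  proof (rule borel_measurable_caratheodory)
    show "continuous_on UNIV (\<lambda>u. Y (r u) \<omega>)" if "\<omega> \<in> space M" for \<omega>
      by (rule continuous_on_compose2[OF cont[OF that]]) (auto simp: r_def ab intro!: continuous_intros)
  qed (rule meas)
  then have measurable_joint [measurable]: "(\<lambda>x. Y (r (fst x)) (snd x)) \<in> borel_measurable (lborel \<Otimes>\<^sub>M M)"
    by (simp add: case_prod_beta' cong: measurable_cong_sets)
  interpret L: pair_sigma_finite lborel M ..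
  have int: "integrable (lborel \<Otimes>\<^sub>M M) (\<lambda>x. indicator {a..b} (fst x) * Y (r (fst x)) (snd x))"
  proof (rule integrableI_bounded_set[where A="{a..b} \<times> space M" and B="\<bar>C\<bar>"])
    show "emeasure (lborel \<Otimes>\<^sub>M M) ({a..b} \<times> space M) < \<infinity>"
      by (subst emeasure_pair_measure_Times) (auto simp: emeasure_space_1 emeasure_lborel_Icc_eq)
    show "AE x in lborel \<Otimes>\<^sub>M M. x \<in> {a..b} \<times> space M \<longrightarrow>
        norm (indicator {a..b} (fst x) * Y (r (fst x)) (snd x)) \<le> \<bar>C\<bar>"
      using bound[OF r(1)] by (intro AE_I2) (auto simp: indicator_def intro: order_trans[OF _ abs_ge_self])
    show "AE x in lborel \<Otimes>\<^sub>M M. x \<notin> {a..b} \<times> space M \<longrightarrow>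
        indicator {a..b} (fst x) * Y (r (fst x)) (snd x) = 0"
      by (intro AE_I2) (auto simp: space_pair_measure indicator_def)
  qed measurable
  have eq: "(\<integral>u. indicator {a..b} u * Y (r u) \<omega> \<partial>lborel) = integral {a..b} (\<lambda>u. Y u \<omega>)"
    if "\<omega> \<in> space M" for \<omega>
  proof -
    have "set_integrable lborel {a..b} (\<lambda>u. Y u \<omega>)"
      by (rule borel_integrable_atLeastAtMost'[OF cont[OF that]])
    from set_borel_integral_eq_integral(2)[OF this]
    have "(\<integral>u. indicator {a..b} u * Y u \<omega> \<partial>lborel) = integral {a..b} (\<lambda>u. Y u \<omega>)"
      by (simp add: set_lebesgue_integral_def)
    also have "(\<integral>u. indicator {a..b} u * Y u \<omega> \<partial>lborel) = (\<integral>u. indicator {a..b} u * Y (r u) \<omega> \<partial>lborel)"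
      by (intro Bochner_Integration.integral_cong) (auto simp: indicator_def r(2))
    finally show ?thesis by simp
  qed
  have "(\<lambda>\<omega>. \<integral>u. indicator {a..b} u * Y (r u) \<omega> \<partial>lborel) \<in> borel_measurable M"
    using measurable_compose[OF measurable_pair_swap' measurable_joint]
    by (intro lborel.borel_measurable_lebesgue_integral) (simp add: case_prod_beta')
  also have "?this \<longleftrightarrow> (\<lambda>\<omega>. integral {a..b} (\<lambda>u. Y u \<omega>)) \<in> borel_measurable M"
    by (intro measurable_cong eq)
  finally show "(\<lambda>\<omega>. integral {a..b} (\<lambda>u. Y u \<omega>)) \<in> borel_measurable M" .
  show ctE: "continuous_on {a..b} (\<lambda>u. expectation (Y u))"
    unfolding continuous_on_sequentially comp_def
  proof (intro ballI allI impI)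
    fix x u assume x: "u \<in> {a..b}" and *: "(\<forall>n. x n \<in> {a..b}) \<and> x \<longlonglongrightarrow> u"
    show "(\<lambda>n. expectation (Y (x n))) \<longlonglongrightarrow> expectation (Y u)"
    proof (rule integral_dominated_convergence[where w="\<lambda>_. C"])
      show "AE \<omega> in M. (\<lambda>i. Y (x i) \<omega>) \<longlonglongrightarrow> Y u \<omega>"
        using cont x * unfolding continuous_on_sequentially comp_def by auto
      show "AE \<omega> in M. norm (Y (x i) \<omega>) \<le> C" for i
        using bound * by auto
    qed (use meas in auto)
  qed
  have "expectation (\<lambda>\<omega>. integral {a..b} (\<lambda>u. Y u \<omega>))
      = expectation (\<lambda>\<omega>. \<integral>u. indicator {a..b} u * Y (r u) \<omega> \<partial>lborel)"
    by (intro Bochner_Integration.integral_cong) (auto simp: eq)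
  also have "\<dots> = (\<integral>u. expectation (\<lambda>\<omega>. indicator {a..b} u * Y (r u) \<omega>) \<partial>lborel)"
    by (rule L.Fubini_integral) (use int in \<open>simp add: case_prod_beta'\<close>)
  also have "\<dots> = (\<integral>u. indicator {a..b} u *\<^sub>R expectation (Y u) \<partial>lborel)"
    by (intro Bochner_Integration.integral_cong) (auto simp: indicator_def r(2))
  also have "\<dots> = integral {a..b} (\<lambda>u. expectation (Y u))"
    using set_borel_integral_eq_integral(2)[OF borel_integrable_atLeastAtMost'[OF ctE]]
    by (simp add: set_lebesgue_integral_def)
  finally show "expectation (\<lambda>\<omega>. integral {a..b} (\<lambda>u. Y u \<omega>)) = integral {a..b} (\<lambda>u. expectation (Y u))" .
qed

end

lemma continuous_on_integral_left:
  fixes y :: "real \<Rightarrow> real"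
  assumes "continuous_on {a..b} y"
  shows "continuous_on {a..b} (\<lambda>s. integral {s..b} y)"
  using assms by (intro indefinite_integral_continuous_1' integrable_continuous_real)

text \<open>The derivative of the square of \<open>integral {s..b} y\<close> in \<open>s\<close> is
  \<open>- 2 * y s * integral {s..b} y\<close>. A second moment is thereby reduced to products at
  ordered times \<open>s < u\<close>.\<close>

lemma integral_square:
  fixes y :: "real \<Rightarrow> real"
  assumes y: "continuous_on {a..b} y" and ab: "a \<le> b"
  shows "(integral {a..b} y)\<^sup>2 = 2 * integral {a..b} (\<lambda>s. y s * integral {s..b} y)"
proof -
  have "((\<lambda>s. 2 * (y s * integral {s..b} y)) has_integral
      - (integral {b..b} y)\<^sup>2 - (- (integral {a..b} y)\<^sup>2)) {a..b}"
  proof (rule fundamental_theorem_of_calculus[OF ab])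
    fix s assume s: "s \<in> {a..b}"
    have "((\<lambda>u. integral {u..b} y) has_real_derivative - y s) (at s within {a..b})"
      using integral_has_vector_derivative'[OF y s]
      by (simp add: has_real_derivative_iff_has_vector_derivative)
    then show "((\<lambda>s. - (integral {s..b} y)\<^sup>2) has_vector_derivative 2 * (y s * integral {s..b} y)) (at s within {a..b})"
      unfolding has_real_derivative_iff_has_vector_derivative[symmetric]
      by (auto intro!: derivative_eq_intros)
  qed
  from integral_unique[OF this] show ?thesis by simp
qed

lemma abs_integral_le:
  fixes y :: "real \<Rightarrow> real"
  assumes "continuous_on {a..b} y" "a \<le> b" "\<And>u. u \<in> {a..b} \<Longrightarrow> \<bar>y u\<bar> \<le> C"
  shows "\<bar>integral {a..b} y\<bar> \<le> C * (b - a)"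
  using integral_bound[OF assms(2,1)] assms(3) by auto

context prob_space
begin

text \<open>Taking expectations in \<open>integral_square\<close> gives an iterated integral of the
  two-point function over the triangle \<open>s < u\<close>. Here \<open>q\<close> bounds that
  function, \<open>k\<close> is the inner integral of \<open>q\<close>, and \<open>k'\<close> a
  simpler bound whose integral is known.\<close>

lemma second_moment_le:
  fixes Y :: "real \<Rightarrow> 'a \<Rightarrow> real"
  assumes meas [measurable]: "\<And>u. Y u \<in> borel_measurable M"
    and cont: "\<And>\<omega>. \<omega> \<in> space M \<Longrightarrow> continuous_on {a..b} (\<lambda>u. Y u \<omega>)"
    and bound: "\<And>u \<omega>. u \<in> {a..b} \<Longrightarrow> \<omega> \<in> space M \<Longrightarrow> \<bar>Y u \<omega>\<bar> \<le> C"
    and ab: "a \<le> b"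
    and le: "\<And>s u. a < s \<Longrightarrow> s < u \<Longrightarrow> u < b \<Longrightarrow> expectation (\<lambda>\<omega>. Y s \<omega> * Y u \<omega>) \<le> q s u"
    and q: "\<And>s. a < s \<Longrightarrow> s < b \<Longrightarrow> (q s has_integral k s) {s..b}"
    and k: "\<And>s. a < s \<Longrightarrow> s < b \<Longrightarrow> k s \<le> k' s"
    and I: "(k' has_integral I) {a..b}"
  shows "expectation (\<lambda>\<omega>. (integral {a..b} (\<lambda>u. Y u \<omega>))\<^sup>2) \<le> 2 * I"
proof -
  let ?Z = "\<lambda>s \<omega>. Y s \<omega> * integral {s..b} (\<lambda>u. Y u \<omega>)"
  define r where "r u = max a (min b u)" for u
  have r: "r u \<in> {a..b}" "u \<in> {a..b} \<Longrightarrow> r u = u" for u using ab by (auto simp: r_def)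
  have sub: "continuous_on {s..b} (\<lambda>u. Y u \<omega>)" if "s \<in> {a..b}" "\<omega> \<in> space M" for s \<omega>
    using cont[OF that(2)] that(1) by (rule_tac continuous_on_subset) auto
  have C: "0 \<le> C" if "\<omega> \<in> space M" for \<omega>
    using bound[OF r(1)[of a] that] by linarith
  have A: "\<bar>integral {s..b} (\<lambda>u. Y u \<omega>)\<bar> \<le> C * (b - a)" if "s \<in> {a..b}" "\<omega> \<in> space M" for s \<omega>
  proof -
    have "\<bar>integral {s..b} (\<lambda>u. Y u \<omega>)\<bar> \<le> C * (b - s)"
      using that bound by (intro abs_integral_le sub) auto
    also have "\<dots> \<le> C * (b - a)"
      using that C by (intro mult_left_mono) auto
    finally show ?thesis .
  qed
  have Zb: "\<bar>?Z s \<omega>\<bar> \<le> C * (C * (b - a))" if "s \<in> {a..b}" "\<omega> \<in> space M" for s \<omega>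
    unfolding abs_mult using that bound A C by (intro mult_mono) auto
  have Zm: "?Z (r s) \<in> borel_measurable M" for s
    using r(1)[of s] sub bound
    by (intro borel_measurable_times meas borel_measurable_integral_path[where C=C]) auto
  have Zc: "continuous_on {a..b} (\<lambda>s. ?Z (r s) \<omega>)" if "\<omega> \<in> space M" for \<omega>
  proof -
    have "continuous_on {a..b} (\<lambda>s. ?Z s \<omega>)"
      by (intro continuous_intros cont[OF that] continuous_on_integral_left)
    then show ?thesis by (rule continuous_on_eq) (simp add: r(2))
  qed
  have "expectation (\<lambda>\<omega>. (integral {a..b} (\<lambda>u. Y u \<omega>))\<^sup>2)
      = expectation (\<lambda>\<omega>. 2 * integral {a..b} (\<lambda>s. ?Z (r s) \<omega>))"
  proof (intro Bochner_Integration.integral_cong refl)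
    fix \<omega> assume \<omega>: "\<omega> \<in> space M"
    have "integral {a..b} (\<lambda>s. ?Z (r s) \<omega>) = integral {a..b} (\<lambda>s. ?Z s \<omega>)"
      by (intro integral_cong) (simp add: r(2))
    then show "(integral {a..b} (\<lambda>u. Y u \<omega>))\<^sup>2 = 2 * integral {a..b} (\<lambda>s. ?Z (r s) \<omega>)"
      using integral_square[OF cont[OF \<omega>] ab] by simp
  qed
  also have "\<dots> = 2 * integral {a..b} (\<lambda>s. expectation (?Z (r s)))"
    by (subst integral_mult_right_zero, subst expectation_integral_path[OF Zm Zc _ ab])
      (use Zb r(1) in auto)
  also have "integral {a..b} (\<lambda>s. expectation (?Z (r s))) \<le> I"
  proof -
    have "(\<lambda>s. expectation (?Z (r s))) integrable_on {a..b}"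
      using continuous_on_expectation[OF Zm Zc _ ab] Zb r(1)
      by (intro integrable_continuous_real) auto
    \<comment> \<open>Both integrals are restricted to open intervals because \<open>q\<close>,
      \<open>k\<close> and \<open>k'\<close> are controlled only for \<open>a < s < u < b\<close>;
      the one-point density at time 0, for instance, is degenerate.\<close>
    then have 1: "(\<lambda>s. expectation (?Z (r s))) integrable_on {a<..<b}"
      by (simp add: integrable_on_open_interval_real)
    have 2: "(k' has_integral I) {a<..<b}"
      using I by (simp add: has_integral_Icc_iff_Ioo)
    have "integral {a<..<b} (\<lambda>s. expectation (?Z (r s))) \<le> integral {a<..<b} k'"
    proof (rule integral_le[OF 1])
      show "k' integrable_on {a<..<b}" using 2 by blast
      fix s assume s: "s \<in> {a<..<b}"
      let ?W = "\<lambda>u \<omega>. Y s \<omega> * Y u \<omega>"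
      have Wc: "continuous_on {s..b} (\<lambda>u. ?W u \<omega>)" if "\<omega> \<in> space M" for \<omega>
        using s that by (intro continuous_intros sub) auto
      have Wb: "\<bar>?W u \<omega>\<bar> \<le> C * C" if "u \<in> {s..b}" "\<omega> \<in> space M" for u \<omega>
        unfolding abs_mult using s that bound C by (intro mult_mono) auto
      have "expectation (?Z (r s)) = expectation (\<lambda>\<omega>. integral {s..b} (\<lambda>u. ?W u \<omega>))"
        using s by (simp add: r(2))
      also have "\<dots> = integral {s..b} (\<lambda>u. expectation (?W u))"
        using s by (intro expectation_integral_path[OF _ Wc Wb]) auto
      also have "\<dots> = integral {s<..<b} (\<lambda>u. expectation (?W u))"
        by (rule integral_open_interval_real)
      also have "\<dots> \<le> integral {s<..<b} (q s)"
      proof (rule integral_le)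
        have "(\<lambda>u. expectation (?W u)) integrable_on {s..b}"
          using s by (intro integrable_continuous_real continuous_on_expectation[OF _ Wc Wb]) auto
        then show "(\<lambda>u. expectation (?W u)) integrable_on {s<..<b}"
          by (simp add: integrable_on_open_interval_real)
        show "q s integrable_on {s<..<b}"
          using q[of s] s by (auto simp: integrable_on_open_interval_real)
      qed (use s le in auto)
      also have "\<dots> = k s"
        using q[of s] s integral_open_interval_real[of s b "q s"] by (auto dest: integral_unique)
      finally show "expectation (?Z (r s)) \<le> k' s" using k[of s] s by auto
    qed
    then show ?thesis
      using integral_unique[OF 2] by (simp add: integral_open_interval_real)
  qed
  finally show ?thesis by simp
qed

end


locale brownian_law =
  fixes P :: "(real \<Rightarrow> real) measure"
  assumes law: "two_sided_BM_law P"
begin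

lemma sets_P [measurable_cong]: "sets P = sets path_space"
  and BM_P: "two_sided_BM P (\<lambda>t \<omega>. \<omega> t)"
  using law by (simp_all add: two_sided_BM_law_def)

lemma space_P: "space P = {\<omega>. continuous_on UNIV \<omega>}"
  using sets_eq_imp_space_eq[OF sets_P] space_path_space by simp

sublocale prob_space P
  using BM_P by (simp add: two_sided_BM_def)

lemma AE_start: "AE \<omega> in P. \<omega> 0 = 0"
  using BM_P by (simp add: two_sided_BM_def)

lemma continuous_on_path:
  assumes "\<omega> \<in> space P" "continuous_on A f"
  shows "continuous_on A (\<lambda>u. \<omega> (f u))"
  by (rule continuous_on_compose2[of UNIV \<omega>]) (use assms in \<open>auto simp: space_P\<close>)

lemma continuous_on_path_id: "\<omega> \<in> space P \<Longrightarrow> continuous_on A \<omega>"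
  using continuous_on_path[of \<omega> A "\<lambda>u. u"] by simp

lemma borel_measurable_eval: "(\<lambda>\<omega>. \<omega> t) \<in> borel_measurable P"
  using measurable_path_space_eval by (simp cong: measurable_cong_sets add: sets_P)

lemma borel_measurable_gauss_eval [measurable]: "(\<lambda>\<omega>. gauss e (\<omega> t)) \<in> borel_measurable P"
  by (rule measurable_compose[OF borel_measurable_eval]) measurable

lemma distributed_increment:
  assumes "s < t"
  shows "distributed P lborel (\<lambda>\<omega>. \<omega> t - \<omega> s) (\<lambda>x. ennreal (gauss (t - s) x))"
proof -
  have "distributed P lborel (\<lambda>\<omega>. \<omega> t - \<omega> s) (\<lambda>x. ennreal (normal_density 0 (sqrt (t - s)) x))"
    using BM_P assms by (simp add: two_sided_BM_def)
  then show ?thesis using assms by (simp add: normal_density_eq_gauss)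
qed

text \<open>A partition with three points; the booleans are the index set behind
  \<open>indep_var\<close>, and \<open>lborel\<close> is the codomain in which the joint density is
  formed.\<close>

lemma indep_increments:
  assumes "r < s" "s < t"
  shows "indep_var lborel (\<lambda>\<omega>. \<omega> s - \<omega> r) lborel (\<lambda>\<omega>. \<omega> t - \<omega> s)"
proof -
  define \<tau> :: "nat \<Rightarrow> real" where "\<tau> i = (if i = 0 then r else if i = 1 then s else t)" for i
  have "\<forall>i<2. \<tau> i < \<tau> (Suc i)"
    using assms by (auto simp: \<tau>_def less_2_cases_iff)
  then have "indep_vars (\<lambda>_. borel) (\<lambda>i \<omega>. \<omega> (\<tau> (Suc i)) - \<omega> (\<tau> i)) {..<2}"
    using BM_P by (simp add: two_sided_BM_def)
  moreover have "{..<2} = (\<lambda>b. if b then 0 else 1 :: nat) ` UNIV"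
    by (auto simp: UNIV_bool)
  ultimately have "indep_vars (\<lambda>_. borel)
      (\<lambda>b \<omega>. \<omega> (\<tau> (Suc (if b then 0 else 1))) - \<omega> (\<tau> (if b then 0 else 1))) UNIV"
    using indep_vars_reindex[of "\<lambda>b. if b then 0 else 1 :: nat" UNIV "\<lambda>_. borel"
        "\<lambda>i \<omega>. \<omega> (\<tau> (Suc i)) - \<omega> (\<tau> i)"]
    by (simp add: inj_on_def)
  also have "?this \<longleftrightarrow> indep_var borel (\<lambda>\<omega>. \<omega> s - \<omega> r) borel (\<lambda>\<omega>. \<omega> t - \<omega> s)"
    unfolding indep_var_def
    by (intro indep_vars_cong refl) (auto simp: \<tau>_def fun_eq_iff split: bool.split)
  finally have "indep_var lborel ((\<lambda>x. x) \<circ> (\<lambda>\<omega>. \<omega> s - \<omega> r)) lborel ((\<lambda>x. x) \<circ> (\<lambda>\<omega>. \<omega> t - \<omega> s))"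
    by (rule indep_var_compose) auto
  then show ?thesis by (simp add: o_def)
qed

section \<open>One- and two-point functions of Brownian motion\<close>

lemma nn_integral_one_point:
  assumes "0 < s" and [measurable]: "f \<in> borel_measurable borel"
  shows "(\<integral>\<^sup>+\<omega>. f (\<omega> s) \<partial>P) = (\<integral>\<^sup>+x. ennreal (gauss s x) * f x \<partial>lborel)"
proof -
  have "(\<integral>\<^sup>+\<omega>. f (\<omega> s) \<partial>P) = (\<integral>\<^sup>+\<omega>. f (\<omega> s - \<omega> 0) \<partial>P)"
    using AE_start by (intro nn_integral_cong_AE) auto
  also have "\<dots> = (\<integral>\<^sup>+x. ennreal (gauss s x) * f x \<partial>lborel)"
    using distributed_nn_integral[OF distributed_increment[OF assms(1)], of f] by simp
  finally show ?thesis .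
qed

lemma nn_integral_two_point:
  assumes "0 < s" "s < u" and [measurable]: "f \<in> borel_measurable borel" "g \<in> borel_measurable borel"
  shows "(\<integral>\<^sup>+\<omega>. f (\<omega> s) * g (\<omega> u) \<partial>P)
    = (\<integral>\<^sup>+x. ennreal (gauss s x) * f x * (\<integral>\<^sup>+y. ennreal (gauss (u - s) y) * g (x + y) \<partial>lborel) \<partial>lborel)"
proof -
  have D: "distributed P (lborel \<Otimes>\<^sub>M lborel) (\<lambda>\<omega>. (\<omega> s - \<omega> 0, \<omega> u - \<omega> s))
      (\<lambda>(x, y). ennreal (gauss s x) * ennreal (gauss (u - s) y))"
    using distributed_joint_indep[OF _ _ distributed_increment[OF assms(1)]
      distributed_increment[OF assms(2)] indep_increments[OF assms(1,2)]] lborel.sigma_finite_measure_axioms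
    by simp
  have "(\<integral>\<^sup>+\<omega>. f (\<omega> s) * g (\<omega> u) \<partial>P)
      = (\<integral>\<^sup>+\<omega>. (\<lambda>(x, y). f x * g (x + y)) (\<omega> s - \<omega> 0, \<omega> u - \<omega> s) \<partial>P)"
    using AE_start by (intro nn_integral_cong_AE) auto
  also have "\<dots> = (\<integral>\<^sup>+z. (case z of (x, y) \<Rightarrow> ennreal (gauss s x) * ennreal (gauss (u - s) y)) *
      (case z of (x, y) \<Rightarrow> f x * g (x + y)) \<partial>(lborel \<Otimes>\<^sub>M lborel))"
    by (rule distributed_nn_integral[OF D, symmetric]) measurable
  also have "\<dots> = (\<integral>\<^sup>+x. \<integral>\<^sup>+y. ennreal (gauss s x) * f x * (ennreal (gauss (u - s) y) * g (x + y)) \<partial>lborel \<partial>lborel)"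
    by (subst lborel.nn_integral_fst[symmetric]) (auto simp: mult_ac)
  also have "\<dots> = (\<integral>\<^sup>+x. ennreal (gauss s x) * f x * (\<integral>\<^sup>+y. ennreal (gauss (u - s) y) * g (x + y) \<partial>lborel) \<partial>lborel)"
    by (intro nn_integral_cong nn_integral_cmult) measurable
  finally show ?thesis .
qed

lemma expectation_gauss:
  assumes "0 < s" "0 < e"
  shows "expectation (\<lambda>\<omega>. gauss e (\<omega> s)) = gauss (s + e) 0"
proof -
  have "(\<integral>\<^sup>+\<omega>. ennreal (gauss e (\<omega> s)) \<partial>P) = ennreal (gauss (s + e) 0)"
    using nn_integral_one_point[of s "\<lambda>x. ennreal (gauss e x)"] nn_integral_gauss_mult[of s e] assms
    by (simp add: ennreal_mult)
  then show ?thesis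
    using assms by (subst integral_eq_nn_integral) auto
qed

text \<open>Integrating out the increment after \<open>s\<close> convolves \<open>gauss e\<close> to
  variance \<open>e + (u - s)\<close>. The density of the path at \<open>s\<close> times
  \<open>gauss d\<close> is, by \<open>gauss_mult\<close>, a constant times a Gaussian of variance
  \<open>s * d / (s + d)\<close>, and the last integral is a convolution at 0.\<close>

lemma expectation_gauss_gauss:
  assumes "0 < s" "s < u" "0 < d" "0 < e"
  shows "expectation (\<lambda>\<omega>. gauss d (\<omega> s) * gauss e (\<omega> u))
    = gauss (s + d) 0 * gauss (s * d / (s + d) + (e + (u - s))) 0"
proof -
  have "(\<integral>\<^sup>+\<omega>. ennreal (gauss d (\<omega> s) * gauss e (\<omega> u)) \<partial>P)
      = (\<integral>\<^sup>+x. ennreal (gauss s x * gauss d x) * (\<integral>\<^sup>+y. ennreal (gauss e (x + y) * gauss (u - s) y) \<partial>lborel) \<partial>lborel)"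
    using nn_integral_two_point[of s u "\<lambda>x. ennreal (gauss d x)" "\<lambda>x. ennreal (gauss e x)"] assms
    by (simp add: ennreal_mult mult_ac)
  also have "\<dots> = (\<integral>\<^sup>+x. ennreal (gauss s x * gauss d x) * ennreal (gauss (e + (u - s)) x) \<partial>lborel)"
    using assms by (subst nn_integral_gauss_conv') auto
  also have "\<dots> = (\<integral>\<^sup>+x. ennreal (gauss (s + d) 0) * ennreal (gauss (s * d / (s + d)) x * gauss (e + (u - s)) x) \<partial>lborel)"
    using assms unfolding gauss_mult[OF assms(1,3)] by (simp add: ennreal_mult mult.assoc)
  also have "\<dots> = ennreal (gauss (s + d) 0 * gauss (s * d / (s + d) + (e + (u - s))) 0)"
    using assms nn_integral_gauss_mult[of "s * d / (s + d)" "e + (u - s)"]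
    by (subst nn_integral_cmult) (auto simp: ennreal_mult)
  finally show ?thesis
    using assms by (subst integral_eq_nn_integral) auto
qed

text \<open>The density at 0 decreases with the variance, so dropping \<open>s * d / (s + d)\<close>
  and lowering \<open>d\<close> and \<open>e\<close> to \<open>n\<close> gives an upper
  bound.\<close>

lemma expectation_gauss_gauss_le:
  assumes "0 < s" "s < u" "0 < n" "n \<le> d" "n \<le> e"
  shows "expectation (\<lambda>\<omega>. gauss d (\<omega> s) * gauss e (\<omega> u)) \<le> gauss (s + n) 0 * gauss (u - s + n) 0"
proof -
  have "gauss (s + d) 0 \<le> gauss (s + n) 0"
    using assms by (intro gauss_zero_antimono) auto
  moreover have d: "0 < d" and e: "0 < e"
    using assms by auto
  have nonneg: "0 \<le> s * d / (s + d)"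
    using assms by simp
  then have "gauss (s * d / (s + d) + (e + (u - s))) 0 \<le> gauss (u - s + n) 0"
    using assms by (intro gauss_zero_antimono) linarith+
  ultimately show ?thesis
    unfolding expectation_gauss_gauss[OF assms(1-2) d e]
    by (intro mult_mono) (use assms nonneg in \<open>auto intro!: gauss_nonneg\<close>)
qed

text \<open>Here \<open>s * d / (s + d) \<le> d \<le> m\<close>; together with
  \<open>e \<le> m\<close> the second variance grows to at most
  \<open>u - s + 2 * m\<close>.\<close>

lemma expectation_gauss_gauss_ge:
  assumes "0 < s" "s < u" and d: "0 < d" and e: "0 < e" and "d \<le> m" "e \<le> m"
  shows "gauss (s + m) 0 * gauss (u - s + 2 * m) 0 \<le> expectation (\<lambda>\<omega>. gauss d (\<omega> s) * gauss e (\<omega> u))"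
proof -
  have "s * d / (s + d) \<le> d"
    using assms by (simp add: pos_divide_le_eq distrib_left)
  then have "gauss (u - s + 2 * m) 0 \<le> gauss (s * d / (s + d) + (e + (u - s))) 0"
    using assms by (intro gauss_zero_antimono add_nonneg_pos) (linarith | simp)+
  moreover have "gauss (s + m) 0 \<le> gauss (s + d) 0"
    using assms by (intro gauss_zero_antimono) auto
  ultimately show ?thesis
    unfolding expectation_gauss_gauss[OF assms(1-2) d e]
    by (intro mult_mono) (use assms in auto)
qed

end

section \<open>Occupation integrals and their moments\<close>

definition occ :: "real \<Rightarrow> (real \<Rightarrow> real) \<Rightarrow> real \<Rightarrow> real" where
  "occ e \<omega> t = integral {0..t} (\<lambda>v. gauss e (\<omega> v))"

context brownian_law
begin

lemma continuous_on_gauss_path: "\<omega> \<in> space P \<Longrightarrow> continuous_on A (\<lambda>v. gauss e (\<omega> v))"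
  by (rule continuous_on_gauss[OF continuous_on_path_id])

lemma integrable_gauss_path: "\<omega> \<in> space P \<Longrightarrow> (\<lambda>v. gauss e (\<omega> v)) integrable_on {a..b}"
  by (intro integrable_continuous_real continuous_on_gauss_path)

lemma abs_gauss_le: "0 < e \<Longrightarrow> \<bar>gauss e x\<bar> \<le> gauss e 0"
  using gauss_pos[of e x] gauss_le_zero[of e x] by simp

lemma measurable_integral_gauss [measurable]:
  assumes "0 < e"
  shows "(\<lambda>\<omega>. integral {a..b} (\<lambda>v. gauss e (\<omega> v))) \<in> borel_measurable P"
proof (cases "a \<le> b")
  case True
  then show ?thesis
    using assms by (intro borel_measurable_integral_path[where C="gauss e 0"])
      (auto intro: continuous_on_gauss_path gauss_le_zero)
qed simp

lemma measurable_occ [measurable]: "0 < e \<Longrightarrow> (\<lambda>\<omega>. occ e \<omega> t) \<in> borel_measurable P"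
  unfolding occ_def by measurable

lemma occ_zero [simp]: "occ e \<omega> 0 = 0"
  by (simp add: occ_def)

lemma occ_diff:
  assumes "\<omega> \<in> space P" "0 \<le> s" "s \<le> t"
  shows "occ e \<omega> t - occ e \<omega> s = integral {s..t} (\<lambda>v. gauss e (\<omega> v))"
  unfolding occ_def
  using Henstock_Kurzweil_Integration.integral_combine[OF assms(2,3) integrable_gauss_path[OF assms(1), where e=e]] by simp

lemma integral_gauss_nonneg:
  assumes "\<omega> \<in> space P" "0 < e"
  shows "0 \<le> integral {s..t} (\<lambda>v. gauss e (\<omega> v))"
  using assms by (intro integral_nonneg integrable_gauss_path) auto

lemma integral_gauss_le:
  assumes "\<omega> \<in> space P" "0 < e" "s \<le> t"
  shows "integral {s..t} (\<lambda>v. gauss e (\<omega> v)) \<le> gauss e 0 * (t - s)"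
  using abs_integral_le[OF continuous_on_gauss_path assms(3), of \<omega> e "gauss e 0"] assms abs_gauss_le
  by (auto dest: abs_le_D1)

lemma occ_mono:
  assumes "\<omega> \<in> space P" "0 < e" "0 \<le> s" "s \<le> t"
  shows "occ e \<omega> s \<le> occ e \<omega> t"
  using occ_diff[OF assms(1,3,4), of e] integral_gauss_nonneg[OF assms(1,2), of s t] by simp

lemma occ_nonneg: "\<omega> \<in> space P \<Longrightarrow> 0 < e \<Longrightarrow> 0 \<le> occ e \<omega> t"
  unfolding occ_def by (rule integral_gauss_nonneg)

lemma occ_le: "\<omega> \<in> space P \<Longrightarrow> 0 < e \<Longrightarrow> 0 \<le> t \<Longrightarrow> occ e \<omega> t \<le> gauss e 0 * t"
  unfolding occ_def using integral_gauss_le[of \<omega> e 0 t] by simp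

lemma continuous_on_occ:
  assumes "\<omega> \<in> space P"
  shows "continuous_on {0..N} (occ e \<omega>)"
  unfolding occ_def[abs_def] by (intro indefinite_integral_continuous_1 integrable_gauss_path assms)

text \<open>The mean is exactly \<open>sqrt (2 / pi) * (sqrt (t + e) - sqrt e)\<close>; the point is
  that the bound does not depend on \<open>e\<close>. It also shows that little local time
  accumulates near time 0.\<close>

lemma expectation_occ_le:
  assumes "0 < e" "0 \<le> t"
  shows "expectation (\<lambda>\<omega>. occ e \<omega> t) \<le> sqrt t"
proof -
  have "expectation (\<lambda>\<omega>. occ e \<omega> t) = integral {0..t} (\<lambda>u. expectation (\<lambda>\<omega>. gauss e (\<omega> u)))"
    unfolding occ_def using assms
    by (intro expectation_integral_path[where C="gauss e 0"])
      (auto intro: continuous_on_gauss_path gauss_le_zero)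
  also have "\<dots> = integral {0<..<t} (\<lambda>u. expectation (\<lambda>\<omega>. gauss e (\<omega> u)))"
    by (rule integral_open_interval_real)
  also have "\<dots> = integral {0<..<t} (\<lambda>u. gauss (u + e) 0)"
    using assms by (intro integral_cong expectation_gauss) auto
  also have "\<dots> = sqrt (2 / pi) * (sqrt (t + e) - sqrt e)"
    using has_integral_gauss_zero[of 0 t e] assms
    by (simp add: integral_open_interval_real[symmetric] integral_unique)
  also have "\<dots> \<le> 1 * sqrt t"
    using sqrt_add_le_add_sqrt[of t e] assms pi_gt3
    by (intro mult_mono) (auto simp: field_simps)
  finally show ?thesis by simp
qed

text \<open>The inner integral of the two-point function contributes at most
  \<open>sqrt (b - a)\<close>, the outer one a difference of square roots. The product form is kept
  because over a partition of equal steps the first factor is small while the second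
  telescopes.\<close>

lemma second_moment_gauss:
  assumes e: "0 < e" and ab: "0 \<le> a" "a \<le> b"
  shows "expectation (\<lambda>\<omega>. (integral {a..b} (\<lambda>u. gauss e (\<omega> u)))\<^sup>2)
    \<le> 2 * (sqrt (b - a) * (sqrt (b + e) - sqrt (a + e)))"
proof -
  let ?c = "sqrt (2 / pi)"
  have c2: "?c * ?c = 2 / pi" using pi_gt_zero by simp
  have "expectation (\<lambda>\<omega>. (integral {a..b} (\<lambda>u. gauss e (\<omega> u)))\<^sup>2)
     \<le> 2 * (?c * (sqrt (b + e) - sqrt (a + e)) * (?c * sqrt (b - a)))"
  proof (rule second_moment_le[where C="gauss e 0"
        and q="\<lambda>s u. gauss (s + e) 0 * gauss (u + (e - s)) 0"
        and k="\<lambda>s. gauss (s + e) 0 * (?c * (sqrt (b + (e - s)) - sqrt (s + (e - s))))"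
        and k'="\<lambda>s. gauss (s + e) 0 * (?c * sqrt (b - a))"])
    show "expectation (\<lambda>\<omega>. gauss e (\<omega> s) * gauss e (\<omega> u)) \<le> gauss (s + e) 0 * gauss (u + (e - s)) 0"
      if "a < s" "s < u" "u < b" for s u
      using expectation_gauss_gauss_le[of s u e e e] that e ab by (simp add: algebra_simps)
    show "((\<lambda>u. gauss (s + e) 0 * gauss (u + (e - s)) 0) has_integral
        gauss (s + e) 0 * (?c * (sqrt (b + (e - s)) - sqrt (s + (e - s))))) {s..b}" if "a < s" "s < b" for s
      using that e by (intro has_integral_mult_right has_integral_gauss_zero) auto
    show "gauss (s + e) 0 * (?c * (sqrt (b + (e - s)) - sqrt (s + (e - s)))) \<le> gauss (s + e) 0 * (?c * sqrt (b - a))"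
      if s: "a < s" "s < b" for s
    proof -
      have "sqrt (b + (e - s)) \<le> sqrt (b - s) + sqrt e"
        using sqrt_add_le_add_sqrt[of "b - s" e] that e by (simp add: algebra_simps)
      also have "sqrt (b - s) \<le> sqrt (b - a)" using that by simp
      finally show ?thesis using s ab e by (intro mult_left_mono) auto
    qed
    show "((\<lambda>s. gauss (s + e) 0 * (?c * sqrt (b - a))) has_integral
        ?c * (sqrt (b + e) - sqrt (a + e)) * (?c * sqrt (b - a))) {a..b}"
      using ab e by (intro has_integral_mult_left has_integral_gauss_zero) auto
  qed (use assms in \<open>auto intro: continuous_on_gauss_path gauss_le_zero\<close>)
  also have "2 * (?c * (sqrt (b + e) - sqrt (a + e)) * (?c * sqrt (b - a)))
      = (?c * ?c) * (2 * (sqrt (b - a) * (sqrt (b + e) - sqrt (a + e))))"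
    by (simp only: mult_ac)
  also have "\<dots> \<le> 1 * (2 * (sqrt (b - a) * (sqrt (b + e) - sqrt (a + e))))"
    unfolding c2 using ab e pi_gt3 by (intro mult_right_mono mult_nonneg_nonneg) (auto simp: field_simps)
  finally show ?thesis by simp
qed

lemma integrable_gauss_gauss: "0 < d \<Longrightarrow> 0 < e \<Longrightarrow> integrable P (\<lambda>\<omega>. gauss d (\<omega> s) * gauss e (\<omega> u))"
  by (rule integrable_const_bound[where B="gauss d 0 * gauss e 0"])
    (auto intro!: AE_I2 mult_mono gauss_le_zero)

text \<open>In the expanded square the diagonal terms are bounded above with the variance
  \<open>n\<close>, the cross terms below with \<open>m\<close>, and only the gap between the two
  bounds remains. It is of order \<open>sqrt m\<close> uniformly in \<open>n\<close>: the expression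
  \<open>sqrt (t + n) - sqrt n\<close> is at most \<open>sqrt t\<close> and exceeds its analogue at
  \<open>m\<close> by at most \<open>sqrt m\<close>. The factor 8 is \<open>24 / pi\<close> rounded
  up.\<close>

lemma second_moment_occ_diff:
  assumes d: "0 < d" "d \<le> m" and e: "0 < e" "e \<le> m" and t: "0 \<le> t"
  shows "expectation (\<lambda>\<omega>. (occ d \<omega> t - occ e \<omega> t)\<^sup>2) \<le> 8 * (sqrt t * sqrt m)"
proof -
  let ?c = "sqrt (2 / pi)"
  define n where "n = min d e"
  have n: "0 < n" "n \<le> d" "n \<le> e" "n \<le> m" "0 < m" using d e by (auto simp: n_def)
  have c2: "?c * ?c = 2 / pi" using pi_gt_zero by simp
  let ?I = "2 * ?c * ((?c * (sqrt (t + n) - sqrt (0 + n))) * sqrt (2 * m)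
      + (?c * (sqrt (t + n) - sqrt (0 + n)) - ?c * (sqrt (t + m) - sqrt (0 + m))) * sqrt t)"
  have "expectation (\<lambda>\<omega>. (occ d \<omega> t - occ e \<omega> t)\<^sup>2)
      = expectation (\<lambda>\<omega>. (integral {0..t} (\<lambda>u. gauss d (\<omega> u) - gauss e (\<omega> u)))\<^sup>2)"
    unfolding occ_def
    by (intro Bochner_Integration.integral_cong refl) (simp add: integral_diff integrable_gauss_path)
  also have "\<dots> \<le> 2 * ?I"
  proof (rule second_moment_le[where C="gauss d 0 + gauss e 0"
        and q="\<lambda>s u. 2 * (gauss (s + n) 0 * gauss (u + (n - s)) 0 - gauss (s + m) 0 * gauss (u + (2 * m - s)) 0)"
        and k="\<lambda>s. 2 * (gauss (s + n) 0 * (?c * (sqrt (t + (n - s)) - sqrt (s + (n - s))))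
          - gauss (s + m) 0 * (?c * (sqrt (t + (2 * m - s)) - sqrt (s + (2 * m - s)))))"
        and k'="\<lambda>s. 2 * ?c * (gauss (s + n) 0 * sqrt (2 * m) + (gauss (s + n) 0 - gauss (s + m) 0) * sqrt t)"])
    show "continuous_on {0..t} (\<lambda>u. gauss d (\<omega> u) - gauss e (\<omega> u))" if "\<omega> \<in> space P" for \<omega>
      using that by (intro continuous_on_diff continuous_on_gauss_path)
    show "\<bar>gauss d (\<omega> u) - gauss e (\<omega> u)\<bar> \<le> gauss d 0 + gauss e 0" for u \<omega>
      using abs_gauss_le[of d "\<omega> u"] abs_gauss_le[of e "\<omega> u"] d e by linarith
    show "expectation (\<lambda>\<omega>. (gauss d (\<omega> s) - gauss e (\<omega> s)) * (gauss d (\<omega> u) - gauss e (\<omega> u)))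
        \<le> 2 * (gauss (s + n) 0 * gauss (u + (n - s)) 0 - gauss (s + m) 0 * gauss (u + (2 * m - s)) 0)"
      if s: "0 < s" "s < u" "u < t" for s u
    proof -
      have "expectation (\<lambda>\<omega>. (gauss d (\<omega> s) - gauss e (\<omega> s)) * (gauss d (\<omega> u) - gauss e (\<omega> u)))
        = expectation (\<lambda>\<omega>. gauss d (\<omega> s) * gauss d (\<omega> u) - gauss d (\<omega> s) * gauss e (\<omega> u)
          - gauss e (\<omega> s) * gauss d (\<omega> u) + gauss e (\<omega> s) * gauss e (\<omega> u))"
        by (intro Bochner_Integration.integral_cong refl) (simp add: algebra_simps)
      also have "\<dots> = expectation (\<lambda>\<omega>. gauss d (\<omega> s) * gauss d (\<omega> u)) - expectation (\<lambda>\<omega>. gauss d (\<omega> s) * gauss e (\<omega> u))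
          - expectation (\<lambda>\<omega>. gauss e (\<omega> s) * gauss d (\<omega> u)) + expectation (\<lambda>\<omega>. gauss e (\<omega> s) * gauss e (\<omega> u))"
        using d e by (simp add: integrable_gauss_gauss)
      also have "\<dots> \<le> 2 * (gauss (s + n) 0 * gauss (u - s + n) 0 - gauss (s + m) 0 * gauss (u - s + 2 * m) 0)"
      proof -
        have "x1 - x2 - x3 + x4 \<le> 2 * (g - h)" if "x1 \<le> g" "x4 \<le> g" "h \<le> x2" "h \<le> x3" for x1 x2 x3 x4 g h :: real
          using that by (simp add: algebra_simps)
        from this[OF expectation_gauss_gauss_le[OF s(1,2) n(1) n(2) n(2)] expectation_gauss_gauss_le[OF s(1,2) n(1) n(3) n(3)]
          expectation_gauss_gauss_ge[OF s(1,2) d(1) e(1) d(2) e(2)] expectation_gauss_gauss_ge[OF s(1,2) e(1) d(1) e(2) d(2)]]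
        show ?thesis .
      qed
      also have "u - s + n = u + (n - s)" by simp
      also have "u - s + 2 * m = u + (2 * m - s)" by simp
      finally show ?thesis .
    qed
    show "((\<lambda>u. 2 * (gauss (s + n) 0 * gauss (u + (n - s)) 0 - gauss (s + m) 0 * gauss (u + (2 * m - s)) 0)) has_integral
        2 * (gauss (s + n) 0 * (?c * (sqrt (t + (n - s)) - sqrt (s + (n - s))))
          - gauss (s + m) 0 * (?c * (sqrt (t + (2 * m - s)) - sqrt (s + (2 * m - s)))))) {s..t}"
      if "0 < s" "s < t" for s
      using that n by (intro has_integral_mult_right has_integral_diff has_integral_gauss_zero) auto
    show "2 * (gauss (s + n) 0 * (?c * (sqrt (t + (n - s)) - sqrt (s + (n - s))))
          - gauss (s + m) 0 * (?c * (sqrt (t + (2 * m - s)) - sqrt (s + (2 * m - s)))))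
        \<le> 2 * ?c * (gauss (s + n) 0 * sqrt (2 * m) + (gauss (s + n) 0 - gauss (s + m) 0) * sqrt t)"
      if s: "0 < s" "s < t" for s
    proof -
      define X where "X = sqrt (t + (n - s)) - sqrt (s + (n - s))"
      define Y where "Y = sqrt (t + (2 * m - s)) - sqrt (s + (2 * m - s))"
      have X: "X \<le> sqrt (t - s)"
        using sqrt_add_le_add_sqrt[of "t - s" n] s n by (simp add: X_def algebra_simps)
      have "sqrt (t + (2 * m - s)) \<le> sqrt (t - s) + sqrt (2 * m)"
        using sqrt_add_le_add_sqrt[of "t - s" "2 * m"] s n by (simp add: algebra_simps)
      moreover have "sqrt (t - s) \<le> sqrt t" using s by simp
      moreover have Y: "Y = sqrt (t + (2 * m - s)) - sqrt (2 * m)" by (simp add: Y_def)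
      ultimately have Y1: "Y \<le> sqrt t" by argo
      have "sqrt (t - s) \<le> sqrt (t + (2 * m - s))" using n by simp
      then have Y2: "X - Y \<le> sqrt (2 * m)" using X Y by argo
      have g: "gauss (s + m) 0 \<le> gauss (s + n) 0" using s n by (intro gauss_zero_antimono) auto
      \<comment> \<open>The splitting separates the two errors: the inner integrals satisfy
        \<open>X - Y \<le> sqrt (2 * m)\<close>, and the difference of the outer densities is kept
        so that it can be integrated exactly.\<close>
      have "gauss (s + n) 0 * X - gauss (s + m) 0 * Y
          = gauss (s + n) 0 * (X - Y) + (gauss (s + n) 0 - gauss (s + m) 0) * Y"
        by (simp add: algebra_simps)
      also have "\<dots> \<le> gauss (s + n) 0 * sqrt (2 * m) + (gauss (s + n) 0 - gauss (s + m) 0) * sqrt t"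
        using Y1 Y2 g s n by (intro add_mono mult_left_mono) auto
      finally have "2 * ?c * (gauss (s + n) 0 * X - gauss (s + m) 0 * Y)
          \<le> 2 * ?c * (gauss (s + n) 0 * sqrt (2 * m) + (gauss (s + n) 0 - gauss (s + m) 0) * sqrt t)"
        by (rule mult_left_mono) simp
      then show ?thesis unfolding X_def[symmetric] Y_def[symmetric] by (simp add: algebra_simps)
    qed
    show "((\<lambda>s. 2 * ?c * (gauss (s + n) 0 * sqrt (2 * m) + (gauss (s + n) 0 - gauss (s + m) 0) * sqrt t)) has_integral ?I) {0..t}"
      using t n by (intro has_integral_mult_right has_integral_add has_integral_mult_left has_integral_diff has_integral_gauss_zero) auto
  qed (use assms in auto)
  also have "2 * ?I \<le> 8 * (sqrt t * sqrt m)"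
  proof -
    define A where "A = sqrt (t + n) - sqrt (0 + n)"
    define B where "B = sqrt (t + m) - sqrt (0 + m)"
    have A: "A \<le> sqrt t" using sqrt_add_le_add_sqrt[of t n] t n by (simp add: A_def)
    have "sqrt t \<le> sqrt (t + m)" using n by simp
    moreover have "B = sqrt (t + m) - sqrt m" by (simp add: B_def)
    ultimately have AB: "A - B \<le> sqrt m" using A by argo
    have s2: "sqrt 2 \<le> (2 :: real)" using sqrt2_less_2 by simp
    have "2 * ?I = (?c * ?c) * (4 * (A * (sqrt 2 * sqrt m) + (A - B) * sqrt t))"
      unfolding A_def[symmetric] B_def[symmetric] real_sqrt_mult by (simp add: algebra_simps)
    also have "\<dots> \<le> (2 / pi) * (4 * (sqrt t * (2 * sqrt m) + sqrt m * sqrt t))"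
      unfolding c2 using A AB t n s2 
      by (intro mult_left_mono add_mono mult_mono) (auto simp: A_def)
    also have "\<dots> = (24 / pi) * (sqrt t * sqrt m)" by simp
    also have "\<dots> \<le> 8 * (sqrt t * sqrt m)"
      using pi_gt3 t n by (intro mult_right_mono) (auto simp: field_simps)
    finally show ?thesis .
  qed
  finally show ?thesis .
qed

text \<open>By \<open>abs_mult_gauss_le\<close> the integral is at most \<open>2 * sqrt e\<close>
  times an occupation integral of variance \<open>2 * e\<close>, whose mean is bounded uniformly in
  \<open>e\<close>. In the limit the weight charges only times when the path is at 0.\<close>

lemma expectation_abs_gauss_le:
  assumes "0 < e" "0 \<le> N"
  shows "expectation (\<lambda>\<omega>. integral {0..N} (\<lambda>u. \<bar>\<omega> u\<bar> * gauss e (\<omega> u))) \<le> 2 * sqrt e * sqrt N"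
proof -
  have "expectation (\<lambda>\<omega>. integral {0..N} (\<lambda>u. \<bar>\<omega> u\<bar> * gauss e (\<omega> u)))
      \<le> expectation (\<lambda>\<omega>. 2 * sqrt e * occ (2 * e) \<omega> N)"
  proof (rule integral_mono_AE')
    show "integrable P (\<lambda>\<omega>. 2 * sqrt e * occ (2 * e) \<omega> N)"
      by (rule integrable_const_bound[where B="2 * sqrt e * (gauss (2 * e) 0 * N)"])
        (use assms occ_le[of _ "2 * e" N] occ_nonneg[of _ "2 * e" N] in \<open>auto simp: abs_mult intro!: mult_left_mono\<close>)
    have "integral {0..N} (\<lambda>u. \<bar>\<omega> u\<bar> * gauss e (\<omega> u)) \<le> 2 * sqrt e * occ (2 * e) \<omega> N"
      if "\<omega> \<in> space P" for \<omega>
      unfolding occ_def integral_mult_right[symmetric] using that assms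
      by (intro integral_le integrable_continuous_real abs_mult_gauss_le
        continuous_on_mult continuous_on_const continuous_on_rabs continuous_on_gauss_path continuous_on_path_id[OF that])
    then show "AE \<omega> in P. integral {0..N} (\<lambda>u. \<bar>\<omega> u\<bar> * gauss e (\<omega> u)) \<le> 2 * sqrt e * occ (2 * e) \<omega> N"
      by auto
    show "AE \<omega> in P. 0 \<le> 2 * sqrt e * occ (2 * e) \<omega> N"
      using assms by (intro AE_I2 mult_nonneg_nonneg occ_nonneg) auto
  qed
  also have "\<dots> \<le> 2 * sqrt e * sqrt N"
    using expectation_occ_le[of "2 * e" N] assms by (simp add: mult_left_mono)
  finally show ?thesis .
qed

end

lemma grid_interval:
  fixes u N :: real
  assumes "0 < N" "0 < n" "0 \<le> u" "u \<le> N"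
  obtains k where "k < n" "N / real n * real k \<le> u" "u \<le> N / real n * real (Suc k)"
proof -
  define h where "h = N / real n"
  have h: "0 < h" "h * real n = N" using assms by (auto simp: h_def)
  \<comment> \<open>At \<open>u = N\<close> the quotient is \<open>n\<close>, one past the last
    cell; the minimum sends it back to cell \<open>n - 1\<close>.\<close>
  define k where "k = min (n - 1) (nat \<lfloor>u / h\<rfloor>)"
  have "0 \<le> u / h" using h assms by simp
  have "k < n" using assms by (simp add: k_def)
  moreover have "h * real k \<le> u"
  proof -
    have "real k \<le> u / h" using \<open>0 \<le> u / h\<close> unfolding k_def by linarith
    then show ?thesis using h by (simp add: pos_le_divide_eq mult.commute)
  qed
  moreover have "u \<le> h * real (Suc k)"
  proof (cases "n - 1 \<le> nat \<lfloor>u / h\<rfloor>")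
    case True
    then have "Suc k = n" using assms by (simp add: k_def)
    then show ?thesis using h assms by simp
  next
    case False
    then have "k = nat \<lfloor>u / h\<rfloor>" by (simp add: k_def)
    then have "u / h \<le> real (Suc k)" using \<open>0 \<le> u / h\<close> by linarith
    then show ?thesis using h by (simp add: pos_divide_le_eq mult.commute)
  qed
  ultimately show ?thesis using that unfolding h_def by blast
qed

lemma power2_le_sum3:
  fixes x y z w :: real
  assumes "\<bar>w\<bar> \<le> \<bar>x\<bar> + y + z" "0 \<le> y" "0 \<le> z"
  shows "w\<^sup>2 \<le> 3 * (x\<^sup>2 + y\<^sup>2 + z\<^sup>2)"
proof -
  have "w\<^sup>2 \<le> (\<bar>x\<bar> + y + z)\<^sup>2"
    using power_mono[OF assms(1), of 2] by simp
  also have "\<dots> \<le> 3 * (x\<^sup>2 + y\<^sup>2 + z\<^sup>2)"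
    using zero_le_power2[of "\<bar>x\<bar> - y"] zero_le_power2[of "\<bar>x\<bar> - z"] zero_le_power2[of "y - z"]
    by (simp add: power2_eq_square algebra_simps)
  finally show ?thesis .
qed

context brownian_law
begin

lemma integrable_bounded:
  fixes f :: "(real \<Rightarrow> real) \<Rightarrow> real"
  assumes "f \<in> borel_measurable P" "\<And>\<omega>. \<omega> \<in> space P \<Longrightarrow> \<bar>f \<omega>\<bar> \<le> C"
  shows "integrable P f"
  using assms by (intro integrable_const_bound[where B=C]) auto

lemma integrable_integral_gauss_square:
  assumes "0 < e" "a \<le> b"
  shows "integrable P (\<lambda>\<omega>. (integral {a..b} (\<lambda>v. gauss e (\<omega> v)))\<^sup>2)"
  using assms integral_gauss_le[of _ e a b] integral_gauss_nonneg[of _ e a b]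
  by (intro integrable_bounded[where C="(gauss e 0 * (b - a))\<^sup>2"]) (auto intro!: power_mono)

lemma abs_occ_diff_le:
  assumes "\<omega> \<in> space P" "0 < d" "0 < e" "0 \<le> t" "t \<le> N"
  shows "\<bar>occ d \<omega> t - occ e \<omega> t\<bar> \<le> (gauss d 0 + gauss e 0) * N"
proof -
  have "occ d \<omega> t \<le> gauss d 0 * N" "occ e \<omega> t \<le> gauss e 0 * N"
    using occ_le[of \<omega> d t] occ_le[of \<omega> e t] assms mult_left_mono[of t N "gauss d 0"] mult_left_mono[of t N "gauss e 0"]
    by auto
  moreover have "0 \<le> occ d \<omega> t" "0 \<le> occ e \<omega> t" using assms occ_nonneg by auto
  ultimately show ?thesis unfolding distrib_right by linarith
qed

lemma integrable_occ_diff_square: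
  assumes "0 < d" "0 < e" "0 \<le> t"
  shows "integrable P (\<lambda>\<omega>. (occ d \<omega> t - occ e \<omega> t)\<^sup>2)"
proof (rule integrable_bounded)
  fix \<omega> assume "\<omega> \<in> space P"
  then show "\<bar>(occ d \<omega> t - occ e \<omega> t)\<^sup>2\<bar> \<le> ((gauss d 0 + gauss e 0) * t)\<^sup>2"
    using abs_occ_diff_le[of \<omega> d e t t] assms by (simp add: abs_le_square_iff[symmetric])
qed (use assms in measurable)

text \<open>Both occupation integrals increase in time, so their difference at any \<open>u\<close>
  is bounded by the difference at the grid point before \<open>u\<close> plus the two increments
  over that cell. This bounds the supremum over time by finitely many second moments. The parameter
  \<open>l\<close> balances it against the total mass \<open>occ e \<omega> N\<close>, which is
  random as well.\<close>

lemma occ_difference_integral_le: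
  assumes d: "0 < d" "d \<le> m" and e: "0 < e" "e \<le> m" and N: "0 < N" and n: "0 < n" and l: "0 < l"
  shows "expectation (\<lambda>\<omega>. integral {0..N} (\<lambda>u. \<bar>occ e \<omega> u - occ d \<omega> u\<bar> * gauss e (\<omega> u)))
    \<le> l / 2 * (24 * real n * sqrt N * sqrt m + 12 * sqrt (N / real n) * sqrt N) + N / l"
proof -
  define h where "h = N / real n"
  have h: "0 < h" "h * real n = N" using N n by (auto simp: h_def)
  define I where "I e k \<omega> = integral {h * real k..h * real (Suc k)} (\<lambda>v. gauss e (\<omega> v))"
    for e k and \<omega> :: "real \<Rightarrow> real"
  define D where "D k \<omega> = occ e \<omega> (h * real k) - occ d \<omega> (h * real k)" for k \<omega>
  \<comment> \<open>The maximum over the cells is replaced by a sum, whose mean is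
    computable.\<close>
  define R where "R \<omega> = 3 * (\<Sum>k<n. (D k \<omega>)\<^sup>2 + (I e k \<omega>)\<^sup>2 + (I d k \<omega>)\<^sup>2)" for \<omega>
  have step: "h * real k \<le> h * real (Suc k)" for k using h by simp
  have R0: "0 \<le> R \<omega>" for \<omega> by (simp add: R_def sum_nonneg)
  have bound: "\<bar>occ e \<omega> u - occ d \<omega> u\<bar> \<le> sqrt (R \<omega>)" if \<omega>: "\<omega> \<in> space P" and u: "0 \<le> u" "u \<le> N" for \<omega> u
  proof -
    obtain k where k: "k < n" "h * real k \<le> u" "u \<le> h * real (Suc k)"
      using grid_interval[OF N n u] unfolding h_def by blast
    have hk: "0 \<le> h * real k" using h by simp
    have inc: "occ c \<omega> (h * real k) \<le> occ c \<omega> u" "occ c \<omega> u \<le> occ c \<omega> (h * real k) + I c k \<omega>"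
      "0 \<le> I c k \<omega>" if "0 < c" for c
      using occ_mono[OF \<omega> that hk k(2)] occ_mono[OF \<omega> that u(1) k(3)]
        occ_diff[OF \<omega> hk step, of c] integral_gauss_nonneg[OF \<omega> that] by (auto simp: I_def)
    have "\<bar>occ e \<omega> u - occ d \<omega> u\<bar> \<le> \<bar>D k \<omega>\<bar> + I e k \<omega> + I d k \<omega>"
      using inc[OF d(1)] inc[OF e(1)] unfolding D_def by argo
    then have "(occ e \<omega> u - occ d \<omega> u)\<^sup>2 \<le> 3 * ((D k \<omega>)\<^sup>2 + (I e k \<omega>)\<^sup>2 + (I d k \<omega>)\<^sup>2)"
      using inc(3)[OF e(1)] inc(3)[OF d(1)] by (rule power2_le_sum3)
    also have "\<dots> \<le> R \<omega>"
      unfolding R_def using k(1)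
      by (intro mult_left_mono member_le_sum[where f="\<lambda>k. (D k \<omega>)\<^sup>2 + (I e k \<omega>)\<^sup>2 + (I d k \<omega>)\<^sup>2"]) auto
    finally have "sqrt ((occ e \<omega> u - occ d \<omega> u)\<^sup>2) \<le> sqrt (R \<omega>)" by (rule real_sqrt_le_mono)
    then show ?thesis by simp
  qed
  have path: "integral {0..N} (\<lambda>u. \<bar>occ e \<omega> u - occ d \<omega> u\<bar> * gauss e (\<omega> u))
      \<le> l / 2 * R \<omega> + (occ e \<omega> N)\<^sup>2 / (2 * l)" if \<omega>: "\<omega> \<in> space P" for \<omega>
  proof -
    have "integral {0..N} (\<lambda>u. \<bar>occ e \<omega> u - occ d \<omega> u\<bar> * gauss e (\<omega> u))
        \<le> integral {0..N} (\<lambda>u. sqrt (R \<omega>) * gauss e (\<omega> u))"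
      using \<omega> bound e
      by (intro integral_le integrable_continuous_real continuous_on_mult continuous_on_rabs continuous_on_diff
          continuous_on_occ continuous_on_gauss_path continuous_on_const mult_right_mono) auto
    also have "\<dots> = sqrt (R \<omega>) * occ e \<omega> N" by (simp add: occ_def)
    also have "\<dots> \<le> l / 2 * R \<omega> + (occ e \<omega> N)\<^sup>2 / (2 * l)"
    proof -
      \<comment> \<open>Young's inequality with weight \<open>l\<close> decouples the supremum from
        the total mass.\<close>
      have "0 \<le> (l * sqrt (R \<omega>) - occ e \<omega> N)\<^sup>2" by simp
      also have "\<dots> = (l * l) * (sqrt (R \<omega>))\<^sup>2 - 2 * l * (sqrt (R \<omega>) * occ e \<omega> N) + (occ e \<omega> N)\<^sup>2"
        by (simp only: power2_eq_square) (simp add: algebra_simps)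
      finally have "2 * l * (sqrt (R \<omega>) * occ e \<omega> N) \<le> (l * l) * R \<omega> + (occ e \<omega> N)\<^sup>2"
        using R0 by simp
      then have "sqrt (R \<omega>) * occ e \<omega> N \<le> ((l * l) * R \<omega> + (occ e \<omega> N)\<^sup>2) / (2 * l)"
        using l by (simp add: pos_le_divide_eq mult.commute)
      also have "\<dots> = l / 2 * R \<omega> + (occ e \<omega> N)\<^sup>2 / (2 * l)"
        using l by (simp add: field_simps)
      finally show ?thesis .
    qed
    finally show ?thesis .
  qed
  have intD: "integrable P (\<lambda>\<omega>. (D k \<omega>)\<^sup>2)" for k
    unfolding D_def using d e h by (intro integrable_occ_diff_square) auto
  have intI: "integrable P (\<lambda>\<omega>. (I c k \<omega>)\<^sup>2)" if "0 < c" for c k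
    unfolding I_def using that step by (intro integrable_integral_gauss_square)
  have intR: "integrable P R"
    unfolding R_def[abs_def] using intD intI d e by (intro integrable_mult_right Bochner_Integration.integrable_sum Bochner_Integration.integrable_add) auto
  have intO: "integrable P (\<lambda>\<omega>. (occ e \<omega> N)\<^sup>2)"
    unfolding occ_def using e N by (intro integrable_integral_gauss_square) auto
  \<comment> \<open>Each cell contributes \<open>sqrt h\<close> times an increment of the square
    root, and the increments telescope, so the sum is small with the cell width
    \<open>h\<close>.\<close>
  have sumI: "(\<Sum>k<n. expectation (\<lambda>\<omega>. (I c k \<omega>)\<^sup>2)) \<le> 2 * sqrt h * sqrt N" if c: "0 < c" for c
  proof -
    have "(\<Sum>k<n. expectation (\<lambda>\<omega>. (I c k \<omega>)\<^sup>2))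
        \<le> (\<Sum>k<n. 2 * sqrt h * (sqrt (h * real (Suc k) + c) - sqrt (h * real k + c)))"
    proof (rule sum_mono)
      fix k
      have "h * real (Suc k) - h * real k = h" by (simp add: algebra_simps)
      then show "expectation (\<lambda>\<omega>. (I c k \<omega>)\<^sup>2) \<le> 2 * sqrt h * (sqrt (h * real (Suc k) + c) - sqrt (h * real k + c))"
        using second_moment_gauss[OF c _ step, of k] h unfolding I_def by simp
    qed
    also have "\<dots> = 2 * sqrt h * (sqrt (N + c) - sqrt c)"
      using sum_lessThan_telescope[of "\<lambda>k. sqrt (h * real k + c)" n] h
      by (simp add: sum_distrib_left[symmetric])
    also have "\<dots> \<le> 2 * sqrt h * sqrt N"
      using sqrt_add_le_add_sqrt[of N c] N c h by (intro mult_left_mono) auto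
    finally show ?thesis .
  qed
  have ER: "expectation R \<le> 24 * real n * sqrt N * sqrt m + 12 * sqrt h * sqrt N"
  proof -
    have "expectation R = 3 * ((\<Sum>k<n. expectation (\<lambda>\<omega>. (D k \<omega>)\<^sup>2))
        + (\<Sum>k<n. expectation (\<lambda>\<omega>. (I e k \<omega>)\<^sup>2)) + (\<Sum>k<n. expectation (\<lambda>\<omega>. (I d k \<omega>)\<^sup>2)))"
      unfolding R_def[abs_def] using intD intI d e
      by (simp add: Bochner_Integration.integral_sum Bochner_Integration.integrable_add sum.distrib)
    moreover have "(\<Sum>k<n. expectation (\<lambda>\<omega>. (D k \<omega>)\<^sup>2)) \<le> (\<Sum>k<n. 8 * (sqrt N * sqrt m))"
    proof (rule sum_mono)
      fix k assume "k \<in> {..<n}"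
      then have "h * real k \<le> h * real n" using h by (intro mult_left_mono) auto
      then have "sqrt (h * real k) \<le> sqrt N" using h by simp
      then have "8 * (sqrt (h * real k) * sqrt m) \<le> 8 * (sqrt N * sqrt m)"
        using d by (intro mult_left_mono mult_right_mono) auto
      then show "expectation (\<lambda>\<omega>. (D k \<omega>)\<^sup>2) \<le> 8 * (sqrt N * sqrt m)"
        unfolding D_def using second_moment_occ_diff[OF e d, of "h * real k"] h by (auto intro: order_trans)
    qed
    ultimately show ?thesis using sumI[OF d(1)] sumI[OF e(1)] by simp
  qed
  have EO: "expectation (\<lambda>\<omega>. (occ e \<omega> N)\<^sup>2) \<le> 2 * N"
  proof -
    have "expectation (\<lambda>\<omega>. (occ e \<omega> N)\<^sup>2) \<le> 2 * (sqrt N * (sqrt (N + e) - sqrt (0 + e)))"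
      unfolding occ_def using second_moment_gauss[OF e(1), of 0 N] N by simp
    also have "\<dots> \<le> 2 * (sqrt N * sqrt N)"
      using sqrt_add_le_add_sqrt[of N e] N e by (intro mult_left_mono) auto
    finally show ?thesis using N by simp
  qed
  have "expectation (\<lambda>\<omega>. integral {0..N} (\<lambda>u. \<bar>occ e \<omega> u - occ d \<omega> u\<bar> * gauss e (\<omega> u)))
      \<le> expectation (\<lambda>\<omega>. l / 2 * R \<omega> + (occ e \<omega> N)\<^sup>2 / (2 * l))"
  proof (rule integral_mono_AE')
    show "AE \<omega> in P. 0 \<le> l / 2 * R \<omega> + (occ e \<omega> N)\<^sup>2 / (2 * l)"
      using R0 l by (intro AE_I2 add_nonneg_nonneg) auto
  qed (use path intR intO in auto)
  also have "\<dots> = l / 2 * expectation R + expectation (\<lambda>\<omega>. (occ e \<omega> N)\<^sup>2) / (2 * l)"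
    using intR intO by simp
  also have "\<dots> \<le> l / 2 * (24 * real n * sqrt N * sqrt m + 12 * sqrt h * sqrt N) + (2 * N) / (2 * l)"
    using ER EO l by (intro add_mono mult_left_mono divide_right_mono) auto
  also have "(2 * N) / (2 * l) = N / l" by simp
  finally show ?thesis unfolding h_def .
qed

text \<open>The order of choices matters: \<open>l = 2 * N / \<eta>\<close> makes the term
  \<open>N / l\<close> equal to half of \<open>\<eta>\<close>, then \<open>n\<close> makes the
  increments over the cells small, and finally \<open>m\<close> beats the factor \<open>n\<close> in
  the grid term.\<close>

lemma occ_replace:
  assumes N: "0 < N" and \<eta>: "0 < \<eta>"
  obtains m where "0 < m" "\<And>d e. 0 < d \<Longrightarrow> d \<le> m \<Longrightarrow> 0 < e \<Longrightarrow> e \<le> m \<Longrightarrow>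
    expectation (\<lambda>\<omega>. integral {0..N} (\<lambda>u. \<bar>occ e \<omega> u - occ d \<omega> u\<bar> * gauss e (\<omega> u))) \<le> \<eta>"
proof -
  define l where "l = 2 * N / \<eta>"
  have l: "0 < l" using N \<eta> by (simp add: l_def)
  have "(\<lambda>n. l / 2 * (12 * sqrt (N / real n) * sqrt N)) \<longlonglongrightarrow> l / 2 * (12 * sqrt 0 * sqrt N)"
    by (intro tendsto_intros tendsto_divide_0[OF tendsto_const] filterlim_real_sequentially
        filterlim_at_top_imp_at_infinity)
  then have "\<forall>\<^sub>F n in sequentially. l / 2 * (12 * sqrt (N / real n) * sqrt N) < \<eta> / 4"
    by (rule order_tendstoD) (use \<eta> in simp)
  then obtain n where n: "0 < n" "l / 2 * (12 * sqrt (N / real n) * sqrt N) < \<eta> / 4"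
    using eventually_conj[OF eventually_gt_at_top[of 0]] by (metis (mono_tags, lifting) eventually_sequentially order_refl)
  have "((\<lambda>m. l / 2 * (24 * real n * sqrt N * sqrt m)) \<longlongrightarrow> l / 2 * (24 * real n * sqrt N * sqrt 0)) (at_right 0)"
    by (intro tendsto_intros)
  then have "\<forall>\<^sub>F m in at_right 0. l / 2 * (24 * real n * sqrt N * sqrt m) < \<eta> / 4"
    by (rule order_tendstoD) (use \<eta> in simp)
  then obtain m where m: "0 < m" "l / 2 * (24 * real n * sqrt N * sqrt m) < \<eta> / 4"
    by (metis (no_types, lifting) eventually_at_right_field field_lbound_gt_zero zero_less_one)
  show ?thesis
  proof (rule that[OF m(1)])
    fix d e assume "0 < d" "d \<le> m" "0 < e" "e \<le> m"
    from occ_difference_integral_le[OF this N n(1) l]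
    show "expectation (\<lambda>\<omega>. integral {0..N} (\<lambda>u. \<bar>occ e \<omega> u - occ d \<omega> u\<bar> * gauss e (\<omega> u))) \<le> \<eta>"
      using n m N \<eta> by (simp add: l_def distrib_left)
  qed
qed

end

section \<open>Changing the origin of the path\<close>

definition shift_by :: "real \<Rightarrow> (real \<Rightarrow> real) \<Rightarrow> real \<Rightarrow> real" where
  "shift_by u \<omega> = (\<lambda>t. \<omega> (u + t) - \<omega> u)"

text \<open>Both reversals preserve the law. Hence reversing at \<open>u\<close> carries
  \<open>f (reversal 0 \<omega>)\<close> to \<open>f (shift_by u \<omega>)\<close> under the
  expectation.\<close>

lemma reversal_reversal: "reversal 0 (reversal u \<omega>) = shift_by u \<omega>"
  by (simp add: reversal_def shift_by_def)

text \<open>Continuity is asked only along the orbit of shifts of each path: this is what a limit in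
  the time of the shift uses, and smooth functions of finitely many coordinates have it.\<close>

definition test_function :: "((real \<Rightarrow> real) \<Rightarrow> real) \<Rightarrow> bool" where
  "test_function f \<longleftrightarrow> f \<in> borel_measurable path_space \<and> (\<forall>\<omega>. 0 \<le> f \<omega> \<and> f \<omega> \<le> 1) \<and>
     (\<forall>\<omega>\<in>space path_space. continuous_on UNIV (\<lambda>u. f (shift_by u \<omega>)))"

text \<open>Fubini reduces the comparison of two path integrals to each fixed time. This is
  essential for reversals, where the map that preserves the law depends on the time
  \<open>u\<close>.\<close>

lemma (in prob_space) expectation_integral_diff_le:
  fixes Y Z D :: "real \<Rightarrow> 'a \<Rightarrow> real"
  assumes meas: "\<And>u. Y u \<in> borel_measurable M" "\<And>u. Z u \<in> borel_measurable M" "\<And>u. D u \<in> borel_measurable M"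
    and cont: "\<And>\<omega>. \<omega> \<in> space M \<Longrightarrow> continuous_on {a..b} (\<lambda>u. Y u \<omega>)"
      "\<And>\<omega>. \<omega> \<in> space M \<Longrightarrow> continuous_on {a..b} (\<lambda>u. Z u \<omega>)"
      "\<And>\<omega>. \<omega> \<in> space M \<Longrightarrow> continuous_on {a..b} (\<lambda>u. D u \<omega>)"
    and bound: "\<And>u \<omega>. u \<in> {a..b} \<Longrightarrow> \<omega> \<in> space M \<Longrightarrow> \<bar>Y u \<omega>\<bar> \<le> A"
      "\<And>u \<omega>. u \<in> {a..b} \<Longrightarrow> \<omega> \<in> space M \<Longrightarrow> \<bar>Z u \<omega>\<bar> \<le> B"
      "\<And>u \<omega>. u \<in> {a..b} \<Longrightarrow> \<omega> \<in> space M \<Longrightarrow> \<bar>D u \<omega>\<bar> \<le> C"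
    and ab: "a \<le> b"
    and le: "\<And>u. u \<in> {a..b} \<Longrightarrow> \<bar>expectation (Y u) - expectation (Z u)\<bar> \<le> expectation (D u)"
  shows "\<bar>expectation (\<lambda>\<omega>. integral {a..b} (\<lambda>u. Y u \<omega>)) - expectation (\<lambda>\<omega>. integral {a..b} (\<lambda>u. Z u \<omega>))\<bar>
    \<le> expectation (\<lambda>\<omega>. integral {a..b} (\<lambda>u. D u \<omega>))"
proof -
  have eqs: "(\<lambda>u. expectation (X u)) integrable_on {a..b}"
    "expectation (\<lambda>\<omega>. integral {a..b} (\<lambda>u. X u \<omega>)) = integral {a..b} (\<lambda>u. expectation (X u))"
    if "\<And>u. X u \<in> borel_measurable M" "\<And>\<omega>. \<omega> \<in> space M \<Longrightarrow> continuous_on {a..b} (\<lambda>u. X u \<omega>)"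
      "\<And>u \<omega>. u \<in> {a..b} \<Longrightarrow> \<omega> \<in> space M \<Longrightarrow> \<bar>X u \<omega>\<bar> \<le> K"
    for X :: "real \<Rightarrow> 'a \<Rightarrow> real" and K :: real
    using that ab
    by (auto intro!: integrable_continuous_real continuous_on_expectation[where C=K] expectation_integral_path[where C=K])
  note Y = eqs[OF meas(1) cont(1) bound(1)] and Z = eqs[OF meas(2) cont(2) bound(2)]
    and D = eqs[OF meas(3) cont(3) bound(3)]
  have "\<bar>integral {a..b} (\<lambda>u. expectation (Y u) - expectation (Z u))\<bar> \<le> integral {a..b} (\<lambda>u. expectation (D u))"
    using integral_norm_bound_integral[of "\<lambda>u. expectation (Y u) - expectation (Z u)" "{a..b}" "\<lambda>u. expectation (D u)"]
      Y(1) Z(1) D(1) le by (simp add: integrable_diff)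
  then show ?thesis
    using Y Z D by (simp add: integral_diff)
qed

lemma abs_diff_chain:
  fixes a b c d x y z r :: real
  assumes "\<bar>a - b\<bar> \<le> x" "\<bar>b - c\<bar> \<le> y" "\<bar>d - c\<bar> \<le> x" "x \<le> r / 4" "y < r / 4" "0 < r"
  shows "\<bar>a - d - 0\<bar> < r"
  using assms by argo

lemma abs_diff_mult:
  fixes c x y g :: real
  shows "\<bar>c * x * g - c * y * g\<bar> = \<bar>c\<bar> * \<bar>x - y\<bar> * \<bar>g\<bar>"
proof -
  have "c * x * g - c * y * g = c * (x - y) * g" by (simp add: algebra_simps)
  then show ?thesis by (simp only: abs_mult)
qed

context brownian_law
begin

lemma reversal_measurable_P: "reversal u \<in> P \<rightarrow>\<^sub>M P"
  using reversal_measurable by (simp cong: measurable_cong_sets add: sets_P)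

lemma expectation_reversal:
  fixes F :: "(real \<Rightarrow> real) \<Rightarrow> real"
  assumes "F \<in> borel_measurable P"
  shows "expectation (\<lambda>\<omega>. F (reversal u \<omega>)) = expectation F"
proof -
  have "integral\<^sup>L (distr P path_space (reversal u)) F = expectation (\<lambda>\<omega>. F (reversal u \<omega>))"
    using reversal_measurable assms
    by (intro integral_distr) (simp_all cong: measurable_cong_sets add: sets_P)
  then show ?thesis by (simp add: distr_reversal[OF law])
qed

text \<open>The substitution of \<open>u - v\<close> for \<open>v\<close> shows that the reversed
  path occupies 0 as long as the original one occupies its level at time \<open>u\<close>. If that
  level is near 0, the occupation integral hardly changes.\<close>

lemma occ_reversal:
  assumes "\<omega> \<in> space P" "0 \<le> u"
  shows "occ e (reversal u \<omega>) u = integral {0..u} (\<lambda>v. gauss e (\<omega> v - \<omega> u))"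
proof -
  let ?G = "\<lambda>v. gauss e (\<omega> v - \<omega> u)"
  have "integral {0..u} (\<lambda>v. ?G (u - v)) = integral {- u..- 0} (\<lambda>v. ?G (u - - v))"
    using Henstock_Kurzweil_Integration.integral_reflect_real[of u 0 "\<lambda>v. ?G (u - v)"] by simp
  also have "\<dots> = integral {- u..0} (?G \<circ> (\<lambda>v. v + u))"
    by (simp add: o_def add.commute)
  also have "\<dots> = integral {- u + u..0 + u} ?G"
    by (intro integral_shift continuous_on_gauss continuous_on_diff continuous_on_const continuous_on_path_id assms)
  finally show ?thesis by (simp add: occ_def reversal_def)
qed

lemma test_function_measurable:
  assumes "test_function f"
  shows "(\<lambda>\<omega>. f (reversal 0 \<omega>)) \<in> borel_measurable P" "(\<lambda>\<omega>. f (shift_by u \<omega>)) \<in> borel_measurable P"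
proof -
  have "f \<in> borel_measurable P"
    using assms by (simp add: test_function_def sets_P cong: measurable_cong_sets)
  then show *: "(\<lambda>\<omega>. f (reversal 0 \<omega>)) \<in> borel_measurable P"
    by (rule measurable_compose[OF reversal_measurable_P])
  show "(\<lambda>\<omega>. f (shift_by u \<omega>)) \<in> borel_measurable P"
    using measurable_compose[OF reversal_measurable_P *] by (simp add: reversal_reversal)
qed

end

locale occupation_change = brownian_law +
  fixes f :: "(real \<Rightarrow> real) \<Rightarrow> real" and h :: "real \<Rightarrow> real" and L Hb :: real
  assumes f: "test_function f"
    and h_cont: "continuous_on UNIV h"
    and h_bound: "\<bar>h x\<bar> \<le> Hb"
    and h_lip: "\<bar>h x - h y\<bar> \<le> L * \<bar>x - y\<bar>"
begin

lemma h_measurable [measurable]: "h \<in> borel_measurable borel"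
  by (rule borel_measurable_continuous_onI[OF h_cont])

lemma Hb: "0 \<le> Hb"
  using h_bound[of 0] by linarith

lemma L: "0 \<le> L"
  using h_lip[of 1 0] by simp

lemma continuous_on_h_occ: "\<omega> \<in> space P \<Longrightarrow> continuous_on {0..N} (\<lambda>u. h (occ e \<omega> u))"
  by (rule continuous_on_compose2[OF h_cont continuous_on_occ]) auto

lemma abs_weight_le:
  assumes "\<bar>c\<bar> \<le> 1" "0 < e"
  shows "\<bar>c * h x * gauss e y\<bar> \<le> Hb * gauss e 0"
proof -
  have "\<bar>c\<bar> * \<bar>h x\<bar> * \<bar>gauss e y\<bar> \<le> 1 * Hb * gauss e 0"
    using assms h_bound abs_gauss_le[of e y] Hb by (intro mult_mono) auto
  then show ?thesis by (simp add: abs_mult)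
qed

text \<open>At each time the change in \<open>h\<close> is controlled by its Lipschitz constant. The
  factor \<open>c\<close> is left open since both the shifted and the unshifted functional are
  inserted.\<close>

lemma replace_occ_in_h:
  assumes e: "0 < e" and d: "0 < d" and N: "0 < N"
    and c: "\<And>u. c u \<in> borel_measurable P" "\<And>\<omega>. \<omega> \<in> space P \<Longrightarrow> continuous_on {0..N} (\<lambda>u. c u \<omega>)"
      "\<And>u \<omega>. \<bar>c u \<omega>\<bar> \<le> 1"
  shows "\<bar>expectation (\<lambda>\<omega>. integral {0..N} (\<lambda>u. c u \<omega> * h (occ e \<omega> u) * gauss e (\<omega> u)))
      - expectation (\<lambda>\<omega>. integral {0..N} (\<lambda>u. c u \<omega> * h (occ d \<omega> u) * gauss e (\<omega> u)))\<bar>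
    \<le> L * expectation (\<lambda>\<omega>. integral {0..N} (\<lambda>u. \<bar>occ e \<omega> u - occ d \<omega> u\<bar> * gauss e (\<omega> u)))"
proof -
  note [measurable] = c(1)
  have "\<bar>expectation (\<lambda>\<omega>. integral {0..N} (\<lambda>u. c u \<omega> * h (occ e \<omega> u) * gauss e (\<omega> u)))
      - expectation (\<lambda>\<omega>. integral {0..N} (\<lambda>u. c u \<omega> * h (occ d \<omega> u) * gauss e (\<omega> u)))\<bar>
    \<le> expectation (\<lambda>\<omega>. integral {0..N} (\<lambda>u. L * (\<bar>occ e \<omega> u - occ d \<omega> u\<bar> * gauss e (\<omega> u))))"
  proof (rule expectation_integral_diff_le[where A="Hb * gauss e 0" and B="Hb * gauss e 0"
        and C="L * (((gauss e 0 + gauss d 0) * N) * gauss e 0)"])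
    show "continuous_on {0..N} (\<lambda>u. L * (\<bar>occ e \<omega> u - occ d \<omega> u\<bar> * gauss e (\<omega> u)))" if "\<omega> \<in> space P" for \<omega>
      using that by (intro continuous_on_mult continuous_on_rabs continuous_on_diff continuous_on_occ
          continuous_on_gauss_path continuous_on_const)
    show "\<bar>L * (\<bar>occ e \<omega> u - occ d \<omega> u\<bar> * gauss e (\<omega> u))\<bar> \<le> L * (((gauss e 0 + gauss d 0) * N) * gauss e 0)"
      if "u \<in> {0..N}" "\<omega> \<in> space P" for u \<omega>
      using that abs_occ_diff_le[of \<omega> e d u N] d e L gauss_le_zero[of e "\<omega> u"]
      by (auto simp: abs_mult intro!: mult_left_mono mult_mono)
    show "\<bar>expectation (\<lambda>\<omega>. c u \<omega> * h (occ e \<omega> u) * gauss e (\<omega> u)) - expectation (\<lambda>\<omega>. c u \<omega> * h (occ d \<omega> u) * gauss e (\<omega> u))\<bar>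
        \<le> expectation (\<lambda>\<omega>. L * (\<bar>occ e \<omega> u - occ d \<omega> u\<bar> * gauss e (\<omega> u)))" if u: "u \<in> {0..N}" for u
    proof -
      have i: "integrable P (\<lambda>\<omega>. c u \<omega> * h (occ a \<omega> u) * gauss e (\<omega> u))" if "0 < a" for a
        using c(3) e that by (intro integrable_bounded[OF _ abs_weight_le]) auto
      have "\<bar>expectation (\<lambda>\<omega>. c u \<omega> * h (occ e \<omega> u) * gauss e (\<omega> u)) - expectation (\<lambda>\<omega>. c u \<omega> * h (occ d \<omega> u) * gauss e (\<omega> u))\<bar>
        = \<bar>expectation (\<lambda>\<omega>. c u \<omega> * h (occ e \<omega> u) * gauss e (\<omega> u) - c u \<omega> * h (occ d \<omega> u) * gauss e (\<omega> u))\<bar>"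
        using i d e by simp
      also have "\<dots> \<le> expectation (\<lambda>\<omega>. \<bar>c u \<omega> * h (occ e \<omega> u) * gauss e (\<omega> u) - c u \<omega> * h (occ d \<omega> u) * gauss e (\<omega> u)\<bar>)"
        by (rule integral_abs_bound)
      also have "\<dots> \<le> expectation (\<lambda>\<omega>. L * (\<bar>occ e \<omega> u - occ d \<omega> u\<bar> * gauss e (\<omega> u)))"
      proof (rule integral_mono)
        show "integrable P (\<lambda>\<omega>. \<bar>c u \<omega> * h (occ e \<omega> u) * gauss e (\<omega> u) - c u \<omega> * h (occ d \<omega> u) * gauss e (\<omega> u)\<bar>)"
          using i d e by (intro integrable_abs Bochner_Integration.integrable_diff)
        show "integrable P (\<lambda>\<omega>. L * (\<bar>occ e \<omega> u - occ d \<omega> u\<bar> * gauss e (\<omega> u)))"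
          using u abs_occ_diff_le[of _ e d u N] d e gauss_le_zero[of e "_ u"]
          by (intro integrable_mult_right integrable_bounded[where C="((gauss e 0 + gauss d 0) * N) * gauss e 0"])
            (auto simp: abs_mult intro!: mult_mono)
        fix \<omega>
        have "\<bar>c u \<omega> * h (occ e \<omega> u) * gauss e (\<omega> u) - c u \<omega> * h (occ d \<omega> u) * gauss e (\<omega> u)\<bar>
            = \<bar>c u \<omega>\<bar> * \<bar>h (occ e \<omega> u) - h (occ d \<omega> u)\<bar> * gauss e (\<omega> u)"
          using e by (simp add: abs_diff_mult)
        also have "\<dots> \<le> 1 * (L * \<bar>occ e \<omega> u - occ d \<omega> u\<bar>) * gauss e (\<omega> u)"
          using c(3) h_lip e L by (intro mult_right_mono mult_mono) auto
        finally show "\<bar>c u \<omega> * h (occ e \<omega> u) * gauss e (\<omega> u) - c u \<omega> * h (occ d \<omega> u) * gauss e (\<omega> u)\<bar>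
            \<le> L * (\<bar>occ e \<omega> u - occ d \<omega> u\<bar> * gauss e (\<omega> u))" by simp
      qed
      finally show ?thesis .
    qed
  qed (use c e d N abs_weight_le[OF c(3)] in
      \<open>auto intro!: continuous_on_mult continuous_on_h_occ continuous_on_gauss_path\<close>)
  then show ?thesis by simp
qed

text \<open>The mass transport step, at fixed \<open>d\<close>. Reversal at \<open>u\<close>
  preserves the law, maps the unshifted functional to the shifted one and fixes the weight, because
  the path starts at 0. The only error comes from \<open>occ d\<close>, by the Lipschitz bound on
  \<open>gauss d\<close> at most a multiple of \<open>\<bar>\<omega> u\<bar>\<close>, and the weight
  makes that of order \<open>sqrt e\<close>.\<close>

lemma reverse_at_level:
  assumes e: "0 < e" and d: "0 < d" and N: "0 < N"
  shows "\<bar>expectation (\<lambda>\<omega>. integral {0..N} (\<lambda>u. f (shift_by u \<omega>) * h (occ d \<omega> u) * gauss e (\<omega> u)))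
      - expectation (\<lambda>\<omega>. integral {0..N} (\<lambda>u. f (reversal 0 \<omega>) * h (occ d \<omega> u) * gauss e (\<omega> u)))\<bar>
    \<le> (L * (N * (2 / sqrt d * gauss (2 * d) 0))) * (2 * sqrt e * sqrt N)"
proof -
  define K where "K = L * (N * (2 / sqrt d * gauss (2 * d) 0))"
  have K: "0 \<le> K" using L N d by (simp add: K_def)
  note fm [measurable] = test_function_measurable[OF f]
  have fb: "\<bar>f \<omega>\<bar> \<le> 1" for \<omega> using f by (auto simp: test_function_def)
  have sp: "\<omega> \<in> space P \<Longrightarrow> \<omega> \<in> space path_space" for \<omega>
    using sets_eq_imp_space_eq[OF sets_P] by simp
  have fc: "continuous_on {0..N} (\<lambda>u. f (shift_by u \<omega>))" if "\<omega> \<in> space P" for \<omega>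
    using f sp[OF that] unfolding test_function_def by (auto intro: continuous_on_subset)
  have "\<bar>expectation (\<lambda>\<omega>. integral {0..N} (\<lambda>u. f (shift_by u \<omega>) * h (occ d \<omega> u) * gauss e (\<omega> u)))
      - expectation (\<lambda>\<omega>. integral {0..N} (\<lambda>u. f (reversal 0 \<omega>) * h (occ d \<omega> u) * gauss e (\<omega> u)))\<bar>
    \<le> expectation (\<lambda>\<omega>. integral {0..N} (\<lambda>u. K * (\<bar>\<omega> u\<bar> * gauss e (\<omega> u))))"
  proof (rule expectation_integral_diff_le[where A="Hb * gauss e 0" and B="Hb * gauss e 0"
        and C="K * (2 * sqrt e * gauss (2 * e) 0)"])
    have D: "\<bar>\<omega> u\<bar> * gauss e (\<omega> u) \<le> 2 * sqrt e * gauss (2 * e) 0" for u and \<omega> :: "real \<Rightarrow> real"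
      using abs_mult_gauss_le[OF e, of "\<omega> u"] gauss_le_zero[of "2 * e" "\<omega> u"] e
      by (auto elim!: order_trans)
    then show "\<bar>K * (\<bar>\<omega> u\<bar> * gauss e (\<omega> u))\<bar> \<le> K * (2 * sqrt e * gauss (2 * e) 0)" for u and \<omega> :: "real \<Rightarrow> real"
      using K e by (simp add: abs_mult mult_left_mono)
    show Dm: "(\<lambda>\<omega>. K * (\<bar>\<omega> u\<bar> * gauss e (\<omega> u))) \<in> borel_measurable P" for u
      using borel_measurable_eval[of u] by measurable
    show "continuous_on {0..N} (\<lambda>u. K * (\<bar>\<omega> u\<bar> * gauss e (\<omega> u)))" if "\<omega> \<in> space P" for \<omega>
      by (intro continuous_on_mult continuous_on_const continuous_on_rabs continuous_on_path_id[OF that]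
          continuous_on_gauss_path[OF that])
    fix u assume u: "u \<in> {0..N}"
    \<comment> \<open>The integrand on the unshifted side; composing it with
      \<open>reversal u\<close> gives the integrand on the shifted side up to the change in
      \<open>occ d\<close>.\<close>
    define F where "F \<omega> = f (reversal 0 \<omega>) * h (occ d \<omega> u) * gauss e (\<omega> u)" for \<omega>
    let ?Y = "\<lambda>\<omega>. f (shift_by u \<omega>) * h (occ d \<omega> u) * gauss e (\<omega> u)"
    have F: "F \<in> borel_measurable P"
      unfolding F_def[abs_def] using d by measurable
    have FR: "(\<lambda>\<omega>. F (reversal u \<omega>)) \<in> borel_measurable P"
      by (rule measurable_compose[OF reversal_measurable_P F])
    have intF: "integrable P (\<lambda>\<omega>. F (reversal u \<omega>))"
      using FR by (rule integrable_bounded) (unfold F_def, rule abs_weight_le[OF fb e])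
    have intY: "integrable P ?Y"
      using d e abs_weight_le[OF fb e] by (intro integrable_bounded[where C="Hb * gauss e 0"]) auto
    have intD: "integrable P (\<lambda>\<omega>. K * (\<bar>\<omega> u\<bar> * gauss e (\<omega> u)))"
      using D K e by (intro integrable_bounded[OF Dm, where C="K * (2 * sqrt e * gauss (2 * e) 0)"])
        (simp add: abs_mult mult_left_mono)
    have "\<bar>expectation ?Y - expectation F\<bar> = \<bar>expectation (\<lambda>\<omega>. ?Y \<omega> - F (reversal u \<omega>))\<bar>"
      using expectation_reversal[OF F, of u] intF intY by simp
    also have "\<dots> \<le> expectation (\<lambda>\<omega>. \<bar>?Y \<omega> - F (reversal u \<omega>)\<bar>)"
      by (rule integral_abs_bound)
    also have "\<dots> \<le> expectation (\<lambda>\<omega>. K * (\<bar>\<omega> u\<bar> * gauss e (\<omega> u)))"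
    proof (rule integral_mono_AE)
      show "integrable P (\<lambda>\<omega>. \<bar>?Y \<omega> - F (reversal u \<omega>)\<bar>)"
        using intF intY by (intro integrable_abs Bochner_Integration.integrable_diff)
      show "AE \<omega> in P. \<bar>?Y \<omega> - F (reversal u \<omega>)\<bar> \<le> K * (\<bar>\<omega> u\<bar> * gauss e (\<omega> u))"
        using AE_start AE_space
      proof eventually_elim
        case (elim \<omega>)
        have "\<bar>occ d \<omega> u - occ d (reversal u \<omega>) u\<bar>
            = \<bar>integral {0..u} (\<lambda>v. gauss d (\<omega> v) - gauss d (\<omega> v - \<omega> u))\<bar>"
          using occ_reversal[OF elim(2), of u d] u elim(2)
          by (subst integral_diff) (auto simp: occ_def intro!: integrable_gauss_path integrable_continuous_real
              continuous_on_gauss continuous_on_diff continuous_on_path_id[OF elim(2)])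
        also have "\<dots> \<le> (2 / sqrt d * gauss (2 * d) 0 * \<bar>\<omega> u\<bar>) * (u - 0)"
          using gauss_lipschitz[OF d] u
          by (intro abs_integral_le) (auto intro!: continuous_on_gauss continuous_on_diff continuous_on_path_id[OF elim(2)] order_trans[OF gauss_lipschitz[OF d]])
        also have "\<dots> \<le> (2 / sqrt d * gauss (2 * d) 0 * \<bar>\<omega> u\<bar>) * N"
          using u d by (intro mult_left_mono) auto
        finally have o: "\<bar>occ d \<omega> u - occ d (reversal u \<omega>) u\<bar> \<le> N * (2 / sqrt d * gauss (2 * d) 0) * \<bar>\<omega> u\<bar>"
          by (simp add: mult_ac)
        have g: "gauss e (reversal u \<omega> u) = gauss e (\<omega> u)"
          using elim(1) by (simp add: reversal_def)
        have "\<bar>?Y \<omega> - F (reversal u \<omega>)\<bar>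
            = \<bar>f (shift_by u \<omega>)\<bar> * \<bar>h (occ d \<omega> u) - h (occ d (reversal u \<omega>) u)\<bar> * \<bar>gauss e (\<omega> u)\<bar>"
          unfolding F_def g reversal_reversal by (rule abs_diff_mult)
        also have "\<dots> \<le> 1 * (L * (N * (2 / sqrt d * gauss (2 * d) 0) * \<bar>\<omega> u\<bar>)) * gauss e (\<omega> u)"
          using fb e L order_trans[OF h_lip mult_left_mono[OF o L]] d N
          by (intro mult_mono) auto
        finally show ?case by (simp add: K_def mult_ac)
      qed
    qed (rule intD)
    finally show "\<bar>expectation ?Y - expectation (\<lambda>\<omega>. f (reversal 0 \<omega>) * h (occ d \<omega> u) * gauss e (\<omega> u))\<bar>
        \<le> expectation (\<lambda>\<omega>. K * (\<bar>\<omega> u\<bar> * gauss e (\<omega> u)))"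
      unfolding F_def[abs_def] .
  qed (use fc e d N abs_weight_le[OF fb e] in
      \<open>auto intro!: continuous_on_mult continuous_on_h_occ continuous_on_gauss_path\<close>)
  also have "\<dots> = K * expectation (\<lambda>\<omega>. integral {0..N} (\<lambda>u. \<bar>\<omega> u\<bar> * gauss e (\<omega> u)))"
    by simp
  also have "\<dots> \<le> K * (2 * sqrt e * sqrt N)"
    using expectation_abs_gauss_le[OF e, of N] N K by (intro mult_left_mono) auto
  finally show ?thesis unfolding K_def .
qed

lemma change_of_origin:
  assumes N: "0 < N"
  shows "((\<lambda>e. expectation (\<lambda>\<omega>. integral {0..N} (\<lambda>u. f (shift_by u \<omega>) * h (occ e \<omega> u) * gauss e (\<omega> u)))
      - expectation (\<lambda>\<omega>. f (reversal 0 \<omega>) * integral {0..N} (\<lambda>u. h (occ e \<omega> u) * gauss e (\<omega> u)))) \<longlongrightarrow> 0) (at_right 0)"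
    (is "((\<lambda>e. ?I1 e - ?I4 e) \<longlongrightarrow> 0) (at_right 0)")
proof (rule tendstoI)
  fix r :: real assume r: "0 < r"
  \<comment> \<open>Dividing by \<open>L + 1\<close> rather than \<open>L\<close> also covers
    \<open>L = 0\<close>.\<close>
  define \<eta> where "\<eta> = r / (4 * (L + 1))"
  have \<eta>: "0 < \<eta>" using r L by (simp add: \<eta>_def)
  have L\<eta>: "L * \<eta> \<le> r / 4"
    using r L by (simp add: \<eta>_def field_simps)
  obtain m where m: "0 < m" "\<And>d e. 0 < d \<Longrightarrow> d \<le> m \<Longrightarrow> 0 < e \<Longrightarrow> e \<le> m \<Longrightarrow>
    expectation (\<lambda>\<omega>. integral {0..N} (\<lambda>u. \<bar>occ e \<omega> u - occ d \<omega> u\<bar> * gauss e (\<omega> u))) \<le> \<eta>"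
    using occ_replace[OF N \<eta>] by blast
  have "((\<lambda>e. (L * (N * (2 / sqrt m * gauss (2 * m) 0))) * (2 * sqrt e * sqrt N)) \<longlongrightarrow>
      (L * (N * (2 / sqrt m * gauss (2 * m) 0))) * (2 * sqrt 0 * sqrt N)) (at_right 0)"
    by (intro tendsto_intros)
  then have "\<forall>\<^sub>F e in at_right 0. (L * (N * (2 / sqrt m * gauss (2 * m) 0))) * (2 * sqrt e * sqrt N) < r / 4"
    by (rule order_tendstoD) (use r in simp)
  moreover have "\<forall>\<^sub>F e in at_right 0. 0 < e \<and> e \<le> m"
    using m(1) by (auto simp: eventually_at_right_field intro!: exI[of _ m])
  ultimately show "\<forall>\<^sub>F e in at_right 0. dist (?I1 e - ?I4 e) 0 < r"
  proof eventually_elim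
    case (elim e)
    then have e: "0 < e" "e \<le> m" by auto
    have fm: "(\<lambda>\<omega>. f (reversal 0 \<omega>)) \<in> borel_measurable P" "(\<lambda>\<omega>. f (shift_by u \<omega>)) \<in> borel_measurable P" for u
      using test_function_measurable[OF f] by auto
    have fb: "\<bar>f \<omega>\<bar> \<le> 1" for \<omega> using f by (auto simp: test_function_def)
    have fc: "continuous_on {0..N} (\<lambda>u. f (shift_by u \<omega>))" if "\<omega> \<in> space P" for \<omega>
      using f that sets_eq_imp_space_eq[OF sets_P] unfolding test_function_def by (auto intro: continuous_on_subset)
    have D: "L * expectation (\<lambda>\<omega>. integral {0..N} (\<lambda>u. \<bar>occ e \<omega> u - occ m \<omega> u\<bar> * gauss e (\<omega> u))) \<le> r / 4"
      using mult_left_mono[OF m(2)[OF m(1) order_refl e] L] L\<eta> by simp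
    have I4: "?I4 e = expectation (\<lambda>\<omega>. integral {0..N} (\<lambda>u. f (reversal 0 \<omega>) * h (occ e \<omega> u) * gauss e (\<omega> u)))"
      by (simp add: mult.assoc)
    show ?case
      unfolding I4 dist_real_def
      by (rule abs_diff_chain[OF replace_occ_in_h[OF e(1) m(1) N fm(2) fc fb]
        reverse_at_level[OF e(1) m(1) N] replace_occ_in_h[OF e(1) m(1) N fm(1) continuous_on_const fb] D elim(1) r])
  qed
qed

end

section \<open>Inverses of approximating clocks\<close>

text \<open>Rational times suffice for an infimum and turn its sublevel sets into countable unions.
  The strict inequality \<open>r < l q\<close> selects the right-continuous inverse.\<close>

definition right_inverse :: "(real \<Rightarrow> real) \<Rightarrow> real \<Rightarrow> real" where
  "right_inverse l r = Inf {q \<in> \<rat>. 0 \<le> q \<and> r < l q}"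

lemma right_inverse_less_iff:
  assumes "\<exists>q\<in>\<rat>. 0 \<le> q \<and> r < l q"
  shows "right_inverse l r < a \<longleftrightarrow> (\<exists>q\<in>\<rat>. 0 \<le> q \<and> q < a \<and> r < l q)"
proof -
  have "{q \<in> \<rat>. 0 \<le> q \<and> r < l q} \<noteq> {}" "bdd_below {q \<in> \<rat>. 0 \<le> q \<and> r < l q}"
    using assms by (auto intro: bdd_belowI)
  then show ?thesis
    unfolding right_inverse_def by (subst cInf_less_iff) auto
qed

lemma right_inverse_nonneg:
  assumes "\<exists>q\<in>\<rat>. 0 \<le> q \<and> r < l q"
  shows "0 \<le> right_inverse l r"
  unfolding right_inverse_def using assms by (intro cInf_greatest) auto

lemma right_inverse_mono:
  assumes "\<And>r. \<exists>q\<in>\<rat>. 0 \<le> q \<and> r < l q"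
  shows "mono (right_inverse l)"
proof (rule monoI)
  fix r r' :: real assume "r \<le> r'"
  moreover have "{q \<in> \<rat>. 0 \<le> q \<and> r' < l q} \<noteq> {}" using assms[of r'] by auto
  ultimately show "right_inverse l r \<le> right_inverse l r'"
    unfolding right_inverse_def by (intro cInf_superset_mono) (auto intro!: bdd_belowI[of _ 0])
qed

text \<open>A rational witness \<open>q\<close> with \<open>r < l q\<close> is also a witness for
  every level up to \<open>l q\<close>; the other direction is monotonicity.\<close>

lemma right_inverse_right_continuous:
  assumes l: "\<And>r. \<exists>q\<in>\<rat>. 0 \<le> q \<and> r < l q"
  shows "(right_inverse l \<longlongrightarrow> right_inverse l r) (at_right r)"
proof (rule order_tendstoI)
  fix a assume a: "a < right_inverse l r"
  have "a < right_inverse l x" if "r < x" for x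
    using monoD[OF right_inverse_mono[OF l], of r x] that a by simp
  then show "\<forall>\<^sub>F x in at_right r. a < right_inverse l x"
    by (auto simp: eventually_at_right_less eventually_at_filter intro!: always_eventually)
next
  fix a assume "right_inverse l r < a"
  then obtain q where q: "q \<in> \<rat>" "0 \<le> q" "q < a" "r < l q"
    using right_inverse_less_iff[OF l] by blast
  then have "right_inverse l x < a" if "x < l q" for x
    using right_inverse_less_iff[OF l] that by blast
  then show "\<forall>\<^sub>F x in at_right r. right_inverse l x < a"
    using q(4) by (auto simp: eventually_at_right_field)
qed

text \<open>
  Time change by a sequence of strictly increasing clocks: convergence of the clocks at rational
  times makes their inverses converge except at the countably many levels \<open>l q\<close>.
\<close>

lemma clock_limit:
  fixes a :: "nat \<Rightarrow> real \<Rightarrow> real" and G h l :: "real \<Rightarrow> real"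
  assumes a: "\<And>n. continuous_on UNIV (a n)" "\<And>n u. 0 < a n u"
    and G: "continuous_on UNIV G" "\<And>u. \<bar>G u\<bar> \<le> 1"
    and h: "continuous_on UNIV h" "\<And>x. \<bar>h x\<bar> \<le> Hb" "\<And>x. R \<le> x \<Longrightarrow> h x = 0" and R: "0 \<le> R"
    and lim: "\<And>q. q \<in> \<rat> \<Longrightarrow> 0 \<le> q \<Longrightarrow> (\<lambda>n. integral {0..q} (a n)) \<longlonglongrightarrow> l q"
    and l: "\<And>r. \<exists>q\<in>\<rat>. 0 \<le> q \<and> r < l q"
    and N: "N \<in> \<rat>" "0 < N"
  shows "(\<lambda>n. integral {0..N} (\<lambda>u. G u * h (integral {0..u} (a n)) * a n u)) \<longlonglongrightarrow>
      (\<integral>r. indicator {0..<l N} r * h r * G (right_inverse l r) \<partial>lborel)"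
    and "\<bar>integral {0..N} (\<lambda>u. G u * h (integral {0..u} (a n)) * a n u)\<bar> \<le> Hb * R"
proof -
  define A where "A n u = integral {0..u} (a n)" for n u
  have int: "a n integrable_on {s..t}" for n s t
    using a(1) by (intro integrable_continuous_real continuous_on_subset[OF a(1)]) auto
  have A0: "A n 0 = 0" for n by (simp add: A_def)
  have A_deriv: "(A n has_real_derivative a n u) (at u within {0..t})" if "u \<in> {0..t}" for n u t
    unfolding A_def[abs_def] has_real_derivative_iff_has_vector_derivative using that
    by (intro integral_has_vector_derivative continuous_on_subset[OF a(1)]) auto
  have A_less: "A n s < A n t" if "0 \<le> s" "s < t" for n s t
  proof (rule DERIV_pos_imp_increasing_open[OF that(2)])
    show "\<exists>y. (A n has_real_derivative y) (at x) \<and> 0 < y" if x: "s < x" "x < t" for x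
    proof -
      have "at x within {0..t} = at x"
        using x \<open>0 \<le> s\<close> by (intro at_within_interior) (auto simp: interior_atLeastAtMost_real)
      then show ?thesis using A_deriv[of x t n] a(2)[of n x] x \<open>0 \<le> s\<close> by auto
    qed
    have "continuous_on {0..t} (A n)"
      using A_deriv by (rule DERIV_continuous_on)
    then show "continuous_on {s..t} (A n)"
      by (rule continuous_on_subset) (use that in auto)
  qed
  have A_cont: "continuous_on {0..N} (A n)" for n
    using A_deriv by (rule DERIV_continuous_on)
  have A_inj: "inj_on (A n) {0..N}" for n
    using A_less by (intro linorder_inj_onI') (auto simp: less_le)
  have A_image: "A n ` {0..N} = {0..A n N}" for n
  proof
    show "A n ` {0..N} \<subseteq> {0..A n N}"
    proof
      fix r assume "r \<in> A n ` {0..N}"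
      then obtain u where u: "0 \<le> u" "u \<le> N" "r = A n u" by auto
      have "u = 0 \<or> A n 0 < A n u" "u = N \<or> A n u < A n N"
        using A_less[of 0 u n] A_less[of u N n] u by linarith+
      then show "r \<in> {0..A n N}"
        using A0[of n] A_less[of 0 N n] N(2) u(3) by auto
    qed
    show "{0..A n N} \<subseteq> A n ` {0..N}"
    proof
      fix r assume "r \<in> {0..A n N}"
      then show "r \<in> A n ` {0..N}"
        using IVT'[of "A n" 0 r N] A_cont A0 N(2) by (auto simp: image_iff)
    qed
  qed
  define B where "B n = the_inv_into {0..N} (A n)" for n
  have BA: "B n (A n u) = u" if "u \<in> {0..N}" for n u
    unfolding B_def using that A_inj by (rule_tac the_inv_into_f_f)
  have AB: "A n (B n r) = r" "B n r \<in> {0..N}" if "r \<in> {0..A n N}" for n r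
  proof -
    from that A_image[of n] obtain u where "u \<in> {0..N}" "r = A n u" by blast
    then show "A n (B n r) = r" "B n r \<in> {0..N}" using BA by auto
  qed
  have B_cont: "continuous_on {0..A n N} (B n)" for n
    using continuous_on_inv[OF A_cont[of n] compact_Icc, of "B n"] BA A_image[of n] by simp
  define F where "F n r = h r * G (B n r)" for n r
  have F_cont: "continuous_on {0..A n N} (F n)" for n
    unfolding F_def[abs_def]
    by (intro continuous_on_mult continuous_on_subset[OF h(1)] continuous_on_compose2[OF G(1) B_cont]) auto
  \<comment> \<open>With \<open>r = A n u\<close> the weight \<open>a n u\<close> becomes Lebesgue
    measure in the level \<open>r\<close>, and the time at which \<open>G\<close> is evaluated
    becomes the inverse clock \<open>B n r\<close>.\<close>
  have subst: "integral {0..N} (\<lambda>u. G u * h (integral {0..u} (a n)) * a n u)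
      = (\<integral>r. indicator {0..A n N} r * F n r \<partial>lborel)" for n
  proof -
    have "((\<lambda>u. a n u *\<^sub>R F n (A n u)) has_integral integral {A n 0..A n N} (F n)) {0..N}"
      using A0[of n] A_image[of n] N A_less[of 0 N n] A_deriv
      by (intro has_integral_substitution[OF _ _ _ F_cont]) auto
    then have "integral {0..A n N} (F n) = integral {0..N} (\<lambda>u. a n u *\<^sub>R F n (A n u))"
      using A0 by (simp add: integral_unique)
    also have "\<dots> = integral {0..N} (\<lambda>u. G u * h (integral {0..u} (a n)) * a n u)"
      by (intro integral_cong) (simp add: F_def BA mult_ac flip: A_def)
    finally show ?thesis
      using set_borel_integral_eq_integral(2)[OF borel_integrable_atLeastAtMost'[OF F_cont[of n]]]
      by (simp add: set_lebesgue_integral_def)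
  qed
  have Hb: "0 \<le> Hb" using h(2)[of 0] by linarith
  have w: "integrable lborel (\<lambda>r. indicator {0..R} r * Hb)"
    using borel_integrable_atLeastAtMost'[of 0 R "\<lambda>_. Hb"] by (simp add: set_integrable_def)
  \<comment> \<open>The dominating function is independent of \<open>n\<close>, because levels are
    nonnegative and \<open>h\<close> vanishes from \<open>R\<close> on.\<close>
  have Fb: "\<bar>indicator {0..A n N} r * F n r\<bar> \<le> indicator {0..R} r * Hb" for n r
  proof (cases "r \<in> {0..A n N} \<and> r \<le> R")
    case True
    have "\<bar>h r\<bar> * \<bar>G (B n r)\<bar> \<le> Hb * 1"
      using h(2) G(2) Hb by (intro mult_mono) auto
    then show ?thesis using True by (simp add: F_def abs_mult)
  next
    case False
    then show ?thesis using h(3)[of r] Hb by (auto simp: F_def indicator_def)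
  qed
  have Fm: "(\<lambda>r. indicator {0..A n N} r * F n r) \<in> borel_measurable lborel" for n
    using borel_measurable_continuous_on_indicator[OF _ F_cont[of n]] by simp
  show "\<bar>integral {0..N} (\<lambda>u. G u * h (integral {0..u} (a n)) * a n u)\<bar> \<le> Hb * R"
  proof -
    have i: "integrable lborel (\<lambda>r. indicator {0..A n N} r * F n r)"
      using Fb by (intro Bochner_Integration.integrable_bound[OF w Fm]) (auto intro: order_trans[OF _ abs_ge_self])
    have "\<bar>\<integral>r. indicator {0..A n N} r * F n r \<partial>lborel\<bar> \<le> (\<integral>r. \<bar>indicator {0..A n N} r * F n r\<bar> \<partial>lborel)"
      by (rule integral_abs_bound)
    also have "\<dots> \<le> (\<integral>r. indicator {0..R} r * Hb \<partial>lborel)"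
      using Fb i w by (intro integral_mono) auto
    also have "\<dots> = Hb * R" using R by simp
    finally show ?thesis unfolding subst .
  qed
  have T: "right_inverse l \<in> borel_measurable borel"
    by (rule borel_measurable_mono[OF right_inverse_mono[OF l]])
  show "(\<lambda>n. integral {0..N} (\<lambda>u. G u * h (integral {0..u} (a n)) * a n u)) \<longlonglongrightarrow>
      (\<integral>r. indicator {0..<l N} r * h r * G (right_inverse l r) \<partial>lborel)"
    unfolding subst
  proof (rule integral_dominated_convergence[OF _ Fm w])
    show "(\<lambda>r. indicator {0..<l N} r * h r * G (right_inverse l r)) \<in> borel_measurable lborel"
      using borel_measurable_continuous_onI[OF h(1)] measurable_compose[OF T borel_measurable_continuous_onI[OF G(1)]]
      by (auto intro!: borel_measurable_times borel_measurable_indicator)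
    show "AE r in lborel. norm (indicator {0..A n N} r * F n r) \<le> indicator {0..R} r * Hb" for n
      using Fb by auto
    \<comment> \<open>At a level equal to some \<open>l q\<close> the approximating clocks may reach
      it before or after \<open>q\<close>; these countably many levels are discarded.\<close>
    have "countable (l ` \<rat>)" by (intro countable_image countable_rat)
    then have "AE r in lborel. r \<notin> l ` \<rat>"
      by (intro AE_not_in countable_imp_null_set_lborel)
    then show "AE r in lborel. (\<lambda>n. indicator {0..A n N} r * F n r) \<longlonglongrightarrow>
        indicator {0..<l N} r * h r * G (right_inverse l r)"
    proof eventually_elim
      case (elim r)
      have limA: "(\<lambda>n. A n q) \<longlonglongrightarrow> l q" if "q \<in> \<rat>" "0 \<le> q" for q
        unfolding A_def using lim[OF that] .
      consider "r < 0" | "l N < r" "0 \<le> r" | "0 \<le> r" "r < l N"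
        using elim N by fastforce
      then show ?case
      proof cases
        case 1
        then show ?thesis by simp
      next
        case 2
        then have "\<forall>\<^sub>F n in sequentially. A n N < r"
          using N by (intro order_tendstoD(2)[OF limA]) auto
        then have "\<forall>\<^sub>F n in sequentially. indicator {0..A n N} r * F n r = 0"
          by eventually_elim simp
        then show ?thesis using 2 by (auto intro: tendsto_eventually)
      next
        case 3
        have ev: "\<forall>\<^sub>F n in sequentially. r < A n N"
          using N 3 by (intro order_tendstoD(1)[OF limA]) auto
        have "(\<lambda>n. B n r) \<longlonglongrightarrow> right_inverse l r"
        proof (rule order_tendstoI)
          fix s assume s: "s < right_inverse l r"
          show "\<forall>\<^sub>F n in sequentially. s < B n r"
          proof (cases "s < 0")
            case True
            from ev show ?thesis
            proof eventually_elim
              case (elim n)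
              then have "B n r \<in> {0..N}" using 3 by (intro AB(2)) auto
              then show ?case using True by auto
            qed
          next
            case False
            obtain q where q: "q \<in> \<rat>" "s < q" "q < right_inverse l r"
              using Rats_dense_in_real[OF s] by auto
            have "\<not> r < l q"
              using q False right_inverse_less_iff[OF l, of r "right_inverse l r"] by auto
            \<comment> \<open>A rational \<open>q\<close> before the inverse only satisfies
              \<open>l q \<le> r\<close>; the exclusion of levels makes this strict, so that
              eventually \<open>A n q < r\<close> and the inverse clock at \<open>r\<close> exceeds
              \<open>q\<close>.\<close>
            moreover have "l q \<noteq> r" using elim q by auto
            ultimately have "\<forall>\<^sub>F n in sequentially. A n q < r"
              using q False by (intro order_tendstoD(2)[OF limA]) auto
            with ev show ?thesis
            proof eventually_elim
              case (elim n)
              then have "\<not> B n r < q" "B n r \<noteq> q"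
                using AB[of r n] A_less[of "B n r" q n] 3 by auto
              then show ?case using q by simp
            qed
          qed
        next
          fix s assume "right_inverse l r < s"
          then obtain q where q: "q \<in> \<rat>" "0 \<le> q" "q < s" "r < l q"
            using right_inverse_less_iff[OF l] by blast
          then have "\<forall>\<^sub>F n in sequentially. r < A n q"
            by (intro order_tendstoD(1)[OF limA]) auto
          with ev show "\<forall>\<^sub>F n in sequentially. B n r < s"
          proof eventually_elim
            case (elim n)
            then have "\<not> q < B n r"
              using AB[of r n] A_less[of q "B n r" n] 3 q by auto
            then show ?case using q by simp
          qed
        qed
        then have "(\<lambda>n. F n r) \<longlonglongrightarrow> h r * G (right_inverse l r)"
          unfolding F_def using G(1)
          by (intro tendsto_intros isCont_tendsto_compose[of _ G]) (auto simp: continuous_on_eq_continuous_at)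
        moreover have "\<forall>\<^sub>F n in sequentially. F n r = indicator {0..A n N} r * F n r"
          using ev by eventually_elim (use 3 in simp)
        ultimately show ?thesis
          using 3 by (auto intro: Lim_transform_eventually)
      qed
    qed
  qed
qed

text \<open>The bump is supported in \<open>{0..2}\<close>, so that rescaled around 1 it sees only
  levels to the right of 1, the side on which the inverse local time is continuous.\<close>

definition tent :: "real \<Rightarrow> real" where
  "tent x = max 0 (1 - \<bar>x - 1\<bar>)"

lemma tent_measurable [measurable]: "tent \<in> borel_measurable borel"
  unfolding tent_def by measurable

lemma tent_le: "\<bar>tent x\<bar> \<le> indicator {0..2} x"
  by (auto simp: tent_def indicator_def)

lemma integrable_tent: "integrable lborel tent"
  by (rule Bochner_Integration.integrable_bound[of _ "indicator {0..2} :: real \<Rightarrow> real"])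
    (auto intro: order_trans[OF tent_le])

lemma integral_tent_pos: "0 < (\<integral>x. tent x \<partial>lborel)"
proof -
  have "integrable lborel (indicator {1/2..1 :: real} :: real \<Rightarrow> real)"
    using borel_integrable_atLeastAtMost'[of "1/2" 1 "\<lambda>_. 1 :: real"] by (simp add: set_integrable_def)
  then have "integrable lborel (\<lambda>x. indicator {1/2..1 :: real} x * (1/2 :: real))"
    by (rule integrable_mult_left)
  then have "(\<integral>x. indicator {1/2..1 :: real} x * (1/2) \<partial>lborel) \<le> (\<integral>x. tent x \<partial>lborel)"
    by (rule integral_mono[OF _ integrable_tent]) (auto simp: tent_def indicator_def)
  then show ?thesis by simp
qed

lemma tent_scaled_limit:
  fixes g :: "real \<Rightarrow> real"
  assumes g: "g \<in> borel_measurable borel" "\<And>x. \<bar>g x\<bar> \<le> 1" and lim: "(g \<longlongrightarrow> g 1) (at_right 1)"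
  shows "(\<lambda>n. \<integral>x. tent x * g (1 + inverse (real (Suc n)) * x) \<partial>lborel) \<longlonglongrightarrow> (\<integral>x. tent x \<partial>lborel) * g 1"
proof -
  have "(\<lambda>n. \<integral>x. tent x * g (1 + inverse (real (Suc n)) * x) \<partial>lborel) \<longlonglongrightarrow> (\<integral>x. tent x * g 1 \<partial>lborel)"
  proof (rule integral_dominated_convergence[where w="indicator {0..2}"])
    show "AE x in lborel. (\<lambda>n. tent x * g (1 + inverse (real (Suc n)) * x)) \<longlonglongrightarrow> tent x * g 1"
    proof (rule AE_I2)
      fix x :: real
      show "(\<lambda>n. tent x * g (1 + inverse (real (Suc n)) * x)) \<longlonglongrightarrow> tent x * g 1"
      proof (cases "0 < x")
        case True
        have "(\<lambda>n. 1 + inverse (real (Suc n)) * x) \<longlonglongrightarrow> 1 + 0 * x"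
          by (intro tendsto_intros LIMSEQ_inverse_real_of_nat)
        then have "filterlim (\<lambda>n. 1 + inverse (real (Suc n)) * x) (at_right 1) sequentially"
          using True by (auto simp: filterlim_at intro!: always_eventually simp del: of_nat_Suc)
        from filterlim_compose[OF lim this] show ?thesis by (intro tendsto_intros)
      next
        case False
        then show ?thesis by (simp add: tent_def)
      qed
    qed
    show "AE x in lborel. norm (tent x * g (1 + inverse (real (Suc n)) * x)) \<le> indicator {0..2} x" for n
    proof (rule AE_I2)
      fix x
      have "\<bar>tent x\<bar> * \<bar>g (1 + inverse (real (Suc n)) * x)\<bar> \<le> indicator {0..2} x * 1"
        using g(2) tent_le by (intro mult_mono) auto
      then show "norm (tent x * g (1 + inverse (real (Suc n)) * x)) \<le> indicator {0..2} x"
        by (simp add: abs_mult)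
    qed
    show "(\<lambda>x. tent x * g (1 + inverse (real (Suc n)) * x)) \<in> borel_measurable lborel" for n
      using g(1) by measurable
  qed auto
  then show ?thesis by simp
qed

section \<open>Recurrence of the local time at zero\<close>

text \<open>The square root of the mesh is \<open>(1 / 4) ^ n\<close>. This rate bounds the second
  moment of successive differences and remains summable after multiplication by
  \<open>2 ^ n\<close>.\<close>

definition mesh :: "nat \<Rightarrow> real" where
  "mesh n = (1 / 16) ^ n"

lemma mesh_pos [simp]: "0 < mesh n" and mesh_le_one: "mesh n \<le> 1"
  by (simp_all add: mesh_def power_le_one)

lemma mesh_tendsto: "filterlim mesh (at_right 0) sequentially"
proof -
  have "mesh \<longlonglongrightarrow> 0" unfolding mesh_def[abs_def] by (rule LIMSEQ_power_zero) simp
  then show ?thesis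
    unfolding filterlim_at by (auto intro!: always_eventually simp: less_imp_neq[symmetric])
qed

lemma convergent_if_summable_diff:
  fixes X :: "nat \<Rightarrow> real"
  assumes "summable (\<lambda>n. \<bar>X (Suc n) - X n\<bar>)"
  shows "convergent X"
proof -
  have "summable (\<lambda>n. X (Suc n) - X n)"
    using assms by (rule summable_rabs_cancel)
  then have "convergent (\<lambda>n. \<Sum>k<n. X (Suc k) - X k)"
    by (simp add: summable_iff_convergent)
  then have "convergent (\<lambda>n. X n - X 0)"
    by (simp add: sum_lessThan_telescope)
  then have "convergent (\<lambda>n. (X n - X 0) + X 0)"
    by (intro convergent_add convergent_const)
  then show ?thesis by simp
qed

context brownian_law
begin

text \<open>The elementary bound of \<open>\<bar>x\<bar>\<close> by \<open>2 ^ n\<close> times its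
  square plus \<open>(1 / 2) ^ n\<close> turns the second moment into a first moment; with the
  chosen mesh both terms are of order \<open>(1 / 2) ^ n\<close>.\<close>

lemma expectation_abs_occ_diff_le:
  assumes "0 \<le> t"
  shows "expectation (\<lambda>\<omega>. \<bar>occ (mesh (Suc n)) \<omega> t - occ (mesh n) \<omega> t\<bar>) \<le> (8 * sqrt t + 1) * (1 / 2) ^ n"
proof -
  let ?X = "\<lambda>\<omega>. occ (mesh (Suc n)) \<omega> t - occ (mesh n) \<omega> t"
  have "\<bar>x\<bar> \<le> 2 ^ n * x\<^sup>2 + (1 / 2) ^ n" for x :: real
  proof -
    have "0 \<le> (2 ^ n * \<bar>x\<bar> - 1)\<^sup>2" by simp
    then have "2 * (2 ^ n * \<bar>x\<bar>) \<le> 2 ^ n * (2 ^ n * x\<^sup>2) + 1"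
      by (simp add: power2_eq_square algebra_simps)
    also have "\<dots> = 2 ^ n * (2 ^ n * x\<^sup>2 + (1 / 2) ^ n)"
      by (simp add: power_one_over field_simps)
    finally have "2 ^ n * (2 * \<bar>x\<bar>) \<le> 2 ^ n * (2 ^ n * x\<^sup>2 + (1 / 2) ^ n)"
      by (simp add: mult_ac)
    then have "2 * \<bar>x\<bar> \<le> 2 ^ n * x\<^sup>2 + (1 / 2) ^ n"
      by (simp only: mult_le_cancel_left_pos[OF zero_less_power[OF zero_less_numeral]])
    then show ?thesis using abs_ge_zero[of x] by argo
  qed
  then have "expectation (\<lambda>\<omega>. \<bar>?X \<omega>\<bar>) \<le> expectation (\<lambda>\<omega>. 2 ^ n * (?X \<omega>)\<^sup>2 + (1 / 2) ^ n)"
    using assms integrable_occ_diff_square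
    by (intro integral_mono_AE') auto
  also have "\<dots> = 2 ^ n * expectation (\<lambda>\<omega>. (?X \<omega>)\<^sup>2) + (1 / 2) ^ n"
    using assms integrable_occ_diff_square by (simp add: prob_space)
  also have "\<dots> \<le> 2 ^ n * (8 * (sqrt t * sqrt (mesh n))) + (1 / 2) ^ n"
  proof -
    have "mesh (Suc n) \<le> mesh n" by (simp add: mesh_def)
    then show ?thesis
      using assms by (intro add_right_mono mult_left_mono second_moment_occ_diff) auto
  qed
  also have "sqrt (mesh n) = (1 / 4) ^ n"
  proof -
    have "mesh n = ((1 / 4) ^ n)\<^sup>2"
      by (simp add: mesh_def power_mult[symmetric] power_even_eq power_divide) (simp add: mult.commute[of n] power_mult)
    then show ?thesis by simp
  qed
  also have "2 ^ n * (8 * (sqrt t * (1 / 4) ^ n)) + (1 / 2) ^ n = (8 * sqrt t + 1) * (1 / 2) ^ n"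
  proof -
    have "(2 :: real) ^ n * (1 / 4) ^ n = (1 / 2) ^ n"
      by (simp flip: power_mult_distrib)
    then have "8 * sqrt t * (2 ^ n * (1 / 4) ^ n) = 8 * sqrt t * (1 / 2) ^ n" by simp
    then show ?thesis by (simp add: algebra_simps)
  qed
  finally show ?thesis .
qed

text \<open>The expected sum of absolute successive differences is finite, so almost every path has
  absolutely summable differences. Passing to the sequence \<open>mesh\<close> thus upgrades mean
  square to almost sure convergence.\<close>

lemma AE_convergent_occ:
  assumes t: "0 \<le> t"
  shows "AE \<omega> in P. convergent (\<lambda>n. occ (mesh n) \<omega> t)"
proof -
  let ?D = "\<lambda>n \<omega>. \<bar>occ (mesh (Suc n)) \<omega> t - occ (mesh n) \<omega> t\<bar>"
  have [measurable]: "?D n \<in> borel_measurable P" for n by measurable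
  have int: "integrable P (?D n)" for n
    using abs_occ_diff_le[of _ "mesh (Suc n)" "mesh n" t t] t
    by (intro integrable_bounded[where C="(gauss (mesh (Suc n)) 0 + gauss (mesh n) 0) * t"]) auto
  have "(\<integral>\<^sup>+\<omega>. (\<Sum>n. ennreal (?D n \<omega>)) \<partial>P) = (\<Sum>n. \<integral>\<^sup>+\<omega>. ennreal (?D n \<omega>) \<partial>P)"
    by (rule nn_integral_suminf) measurable
  also have "\<dots> \<le> (\<Sum>n. ennreal ((8 * sqrt t + 1) * (1 / 2) ^ n))"
    using expectation_abs_occ_diff_le[OF t] int
    by (intro suminf_le) (auto simp: nn_integral_eq_integral intro!: ennreal_leI)
  also have "\<dots> < \<infinity>"
  proof -
    have "summable (\<lambda>n. (8 * sqrt t + 1) * (1 / 2 :: real) ^ n)"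
      by (intro summable_mult summable_geometric) simp
    then show ?thesis
      using t by (subst suminf_ennreal2) auto
  qed
  finally have "(\<integral>\<^sup>+\<omega>. (\<Sum>n. ennreal (?D n \<omega>)) \<partial>P) \<noteq> \<infinity>" by simp
  then have "AE \<omega> in P. (\<Sum>n. ennreal (?D n \<omega>)) \<noteq> \<infinity>"
    by (intro nn_integral_PInf_AE) measurable
  then show ?thesis
  proof eventually_elim
    case (elim \<omega>)
    then have "summable (\<lambda>n. ?D n \<omega>)"
      by (intro summable_suminf_not_top) auto
    then show ?case by (rule convergent_if_summable_diff)
  qed
qed

text \<open>
  Recurrence comes from the logarithmic average \<open>\<integral>\<^sub>1\<^sup>N s\<^sup>-\<^sup>1\<^sup>/\<^sup>2 dL\<^sub>s \<le> L\<^sub>N\<close>, whose mean is of order \<open>ln N\<close>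
  while its variance is only \<open>O(ln N)\<close>.
\<close>

definition log_occ :: "real \<Rightarrow> real \<Rightarrow> (real \<Rightarrow> real) \<Rightarrow> real" where
  "log_occ e N \<omega> = integral {1..N} (\<lambda>s. gauss e (\<omega> s) / sqrt s)"

lemma continuous_on_log_weight:
  "\<omega> \<in> space P \<Longrightarrow> continuous_on {1..N} (\<lambda>s. gauss e (\<omega> s) / sqrt s)"
  by (intro continuous_on_divide continuous_on_gauss_path continuous_on_real_sqrt continuous_on_id) auto

lemma log_weight_le:
  assumes "0 < e" "1 \<le> s"
  shows "gauss e x / sqrt s \<le> gauss e x"
  using assms gauss_pos[of e x] by (simp add: divide_le_eq mult_le_cancel_left1)

lemma abs_log_weight_le:
  assumes "0 < e" "1 \<le> s"
  shows "\<bar>gauss e x / sqrt s\<bar> \<le> gauss e 0"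
  using assms log_weight_le[OF assms, of x] gauss_le_zero[of e x] by auto

lemma log_weight_le_zero: "0 < e \<Longrightarrow> 1 \<le> s \<Longrightarrow> gauss e x / sqrt s \<le> gauss e 0"
  using abs_log_weight_le[of e s x] by linarith

lemma log_occ_le_occ:
  assumes "\<omega> \<in> space P" "0 < e" "1 \<le> N"
  shows "log_occ e N \<omega> \<le> occ e \<omega> N"
proof -
  have "log_occ e N \<omega> \<le> integral {1..N} (\<lambda>s. gauss e (\<omega> s))"
    unfolding log_occ_def using assms log_weight_le
    by (intro integral_le integrable_continuous_real continuous_on_log_weight continuous_on_gauss_path) auto
  also have "\<dots> = occ e \<omega> N - occ e \<omega> 1"
    using occ_diff[of \<omega> 1 N e] assms by simp
  finally show ?thesis using occ_nonneg[of \<omega> e 1] assms by simp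
qed

lemma log_occ_measurable: "0 < e \<Longrightarrow> 1 \<le> N \<Longrightarrow> log_occ e N \<in> borel_measurable P"
  unfolding log_occ_def[abs_def]
  by (intro borel_measurable_integral_path[where C="gauss e 0"] continuous_on_log_weight)
    (auto intro: log_weight_le_zero)

lemma log_occ_bound:
  assumes "\<omega> \<in> space P" "0 < e" "1 \<le> N"
  shows "\<bar>log_occ e N \<omega>\<bar> \<le> gauss e 0 * (N - 1)"
  unfolding log_occ_def using assms
  by (intro abs_integral_le continuous_on_log_weight) (auto intro: log_weight_le_zero)

text \<open>The density at 0 divided by \<open>sqrt s\<close> is at least a multiple of
  \<open>1 / (s + e)\<close>, whose antiderivative is logarithmic; the loss at the lower end is
  \<open>ln (1 + e) \<le> e\<close>.\<close>

lemma expectation_log_occ_ge: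
  assumes e: "0 < e" "e \<le> 1" and N: "1 \<le> N"
  shows "(ln N - e) / sqrt (2 * pi) \<le> expectation (log_occ e N)"
proof -
  have "((\<lambda>s. 1 / sqrt (2 * pi) * (1 / (s + e))) has_integral
      1 / sqrt (2 * pi) * (ln (N + e) - ln (1 + e))) {1..N}"
  proof (intro has_integral_mult_right fundamental_theorem_of_calculus N)
    fix x assume "x \<in> {1..N}"
    then show "((\<lambda>s. ln (s + e)) has_vector_derivative 1 / (x + e)) (at x within {1..N})"
      using e unfolding has_real_derivative_iff_has_vector_derivative[symmetric]
      by (auto intro!: derivative_eq_intros)
  qed
  note I = this
  have "ln N \<le> ln (N + e)" using e N by simp
  moreover have "ln (1 + e) \<le> e" using e by (intro ln_add_one_self_le_self) simp
  ultimately have "(ln N - e) / sqrt (2 * pi) \<le> (ln (N + e) - ln (1 + e)) / sqrt (2 * pi)"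
    by (intro divide_right_mono) auto
  also have "\<dots> = integral {1..N} (\<lambda>s. 1 / sqrt (2 * pi) * (1 / (s + e)))"
    using integral_unique[OF I] by simp
  also have "\<dots> \<le> integral {1..N} (\<lambda>s. expectation (\<lambda>\<omega>. gauss e (\<omega> s) / sqrt s))"
  proof (rule integral_le)
    show "(\<lambda>s. 1 / sqrt (2 * pi) * (1 / (s + e))) integrable_on {1..N}" using I by blast
    show "(\<lambda>s. expectation (\<lambda>\<omega>. gauss e (\<omega> s) / sqrt s)) integrable_on {1..N}"
      using e N by (intro integrable_continuous_real continuous_on_expectation[where C="gauss e 0"] continuous_on_log_weight)
        (auto intro: log_weight_le_zero)
    fix s assume s: "s \<in> {1..N}"
    have "sqrt s * sqrt (s + e) \<le> sqrt (s + e) * sqrt (s + e)"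
      using s e by (intro mult_right_mono) auto
    then have "sqrt s * sqrt (s + e) \<le> s + e" using s e by simp
    then have "1 / (s + e) \<le> 1 / (sqrt s * sqrt (s + e))"
      using s e by (intro divide_left_mono) auto
    then have "1 / sqrt (2 * pi) * (1 / (s + e)) \<le> 1 / sqrt (2 * pi) * (1 / (sqrt s * sqrt (s + e)))"
      by (intro mult_left_mono) auto
    also have "\<dots> = gauss (s + e) 0 / sqrt s"
      by (simp add: gauss_zero real_sqrt_mult)
    also have "\<dots> = expectation (\<lambda>\<omega>. gauss e (\<omega> s) / sqrt s)"
      using s e expectation_gauss[of s e] by simp
    finally show "1 / sqrt (2 * pi) * (1 / (s + e)) \<le> expectation (\<lambda>\<omega>. gauss e (\<omega> s) / sqrt s)" .
  qed
  also have "\<dots> = expectation (log_occ e N)"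
    unfolding log_occ_def[abs_def] using e N
    by (intro expectation_integral_path[symmetric, where C="gauss e 0"] continuous_on_log_weight)
      (auto intro: log_weight_le_zero)
  finally show ?thesis .
qed

text \<open>The inner time integral is a logarithm, bounded by \<open>ln 4 + ln N - ln s\<close>;
  integrating it against \<open>1 / s\<close> produces half the square of \<open>ln N\<close>. After
  doubling, the quadratic term matches the squared mean, so the variance is linear in
  \<open>ln N\<close>.\<close>

lemma second_moment_log_occ:
  assumes e: "0 < e" "e \<le> 1" and N: "1 \<le> N"
  shows "expectation (\<lambda>\<omega>. (log_occ e N \<omega>)\<^sup>2) \<le> (2 * ln 4 * ln N + (ln N)\<^sup>2) / (2 * pi)"
proof -
  let ?I = "1 / (2 * pi) * (ln 4 * ln N + (ln N)\<^sup>2 / 2)"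
  have "expectation (\<lambda>\<omega>. (log_occ e N \<omega>)\<^sup>2) \<le> 2 * ?I"
    unfolding log_occ_def
  proof (rule second_moment_le[where C="gauss e 0"
        and q="\<lambda>s u. 1 / (2 * pi * s) * (1 / (sqrt u * sqrt (u + (e - s))))"
        and k="\<lambda>s. 1 / (2 * pi * s) * (2 * ln (sqrt N + sqrt (N + (e - s))) - 2 * ln (sqrt s + sqrt (s + (e - s))))"
        and k'="\<lambda>s. 1 / (2 * pi) * ((ln 4 + ln N - ln s) * (1 / s))"])
    show "expectation (\<lambda>\<omega>. gauss e (\<omega> s) / sqrt s * (gauss e (\<omega> u) / sqrt u))
        \<le> 1 / (2 * pi * s) * (1 / (sqrt u * sqrt (u + (e - s))))" if s: "1 < s" "s < u" "u < N" for s u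
    proof -
      have "expectation (\<lambda>\<omega>. gauss e (\<omega> s) / sqrt s * (gauss e (\<omega> u) / sqrt u))
          = expectation (\<lambda>\<omega>. gauss e (\<omega> s) * gauss e (\<omega> u)) / (sqrt s * sqrt u)"
        by simp
      also have "\<dots> \<le> (gauss (s + e) 0 * gauss (u - s + e) 0) / (sqrt s * sqrt u)"
        using s e by (intro divide_right_mono expectation_gauss_gauss_le) auto
      also have "\<dots> \<le> (gauss s 0 * gauss (u - s + e) 0) / (sqrt s * sqrt u)"
        using s e by (intro divide_right_mono mult_right_mono gauss_zero_antimono) auto
      also have "\<dots> = 1 / (2 * pi * s) * (1 / (sqrt u * sqrt (u + (e - s))))"
      proof -
        have v: "u + (e - s) = u - s + e" by simp
        have "sqrt (2 * pi * s) * sqrt (2 * pi * (u - s + e)) * (sqrt s * sqrt u)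
            = (sqrt (2 * pi) * sqrt (2 * pi)) * (sqrt s * sqrt s) * (sqrt u * sqrt (u + (e - s)))"
          unfolding v real_sqrt_mult by (simp only: mult_ac)
        also have "\<dots> = (2 * pi * s) * (sqrt u * sqrt (u + (e - s)))"
          using s pi_gt_zero by simp
        finally show ?thesis by (simp add: gauss_zero)
      qed
      finally show ?thesis .
    qed
    show "((\<lambda>u. 1 / (2 * pi * s) * (1 / (sqrt u * sqrt (u + (e - s))))) has_integral
        1 / (2 * pi * s) * (2 * ln (sqrt N + sqrt (N + (e - s))) - 2 * ln (sqrt s + sqrt (s + (e - s))))) {s..N}"
      if s: "1 < s" "s < N" for s
    proof (intro has_integral_mult_right fundamental_theorem_of_calculus)
      fix u assume u: "u \<in> {s..N}"
      define a where "a = sqrt u"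
      define b where "b = sqrt (u + (e - s))"
      have ab: "0 < a" "0 < b" using u s e by (auto simp: a_def b_def)
      \<comment> \<open>The product of the two square roots has this antiderivative for its
        reciprocal: the numerator of the derivative is half the sum of the inverse roots, which
        cancels against the sum of the roots.\<close>
      have "((\<lambda>u. 2 * ln (sqrt u + sqrt (u + (e - s)))) has_real_derivative
          2 * ((inverse (sqrt u) / 2 + inverse (sqrt (u + (e - s))) / 2) / (sqrt u + sqrt (u + (e - s))))) (at u within {s..N})"
        using u s e ab by (auto intro!: derivative_eq_intros simp: a_def b_def add_pos_pos)
      also have "2 * ((inverse (sqrt u) / 2 + inverse (sqrt (u + (e - s))) / 2) / (sqrt u + sqrt (u + (e - s))))
          = 1 / (sqrt u * sqrt (u + (e - s)))"
      proof -
        have "inverse a / 2 + inverse b / 2 = (a + b) / (2 * (a * b))"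
          using ab by (simp add: field_simps)
        then show ?thesis using ab by (simp flip: a_def b_def)
      qed
      finally show "((\<lambda>u. 2 * ln (sqrt u + sqrt (u + (e - s)))) has_vector_derivative
          1 / (sqrt u * sqrt (u + (e - s)))) (at u within {s..N})"
        by (simp add: has_real_derivative_iff_has_vector_derivative)
    qed (use s in auto)
    show "1 / (2 * pi * s) * (2 * ln (sqrt N + sqrt (N + (e - s))) - 2 * ln (sqrt s + sqrt (s + (e - s))))
        \<le> 1 / (2 * pi) * ((ln 4 + ln N - ln s) * (1 / s))" if s: "1 < s" "s < N" for s
    proof -
      have "sqrt N + sqrt (N + (e - s)) \<le> 2 * sqrt N"
        using s e by simp
      then have "ln (sqrt N + sqrt (N + (e - s))) \<le> ln (2 * sqrt N)"
        using s e by (subst ln_le_cancel_iff) (auto intro!: add_pos_pos)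
      then have 1: "2 * ln (sqrt N + sqrt (N + (e - s))) \<le> 2 * ln (2 * sqrt N)" by simp
      have 2: "2 * ln (2 * sqrt N) = ln 4 + ln N"
      proof -
        have "ln (4 :: real) = ln (2 ^ 2)" by simp
        also have "\<dots> = 2 * ln 2" by (subst ln_realpow) auto
        finally show ?thesis using s by (simp add: ln_mult ln_sqrt)
      qed
      have "ln (sqrt s) \<le> ln (sqrt s + sqrt (s + (e - s)))"
        using s e by (subst ln_le_cancel_iff) (auto intro!: add_pos_pos)
      then have 3: "ln s \<le> 2 * ln (sqrt s + sqrt (s + (e - s)))"
        using s by (simp add: ln_sqrt)
      have "2 * ln (sqrt N + sqrt (N + (e - s))) - 2 * ln (sqrt s + sqrt (s + (e - s))) \<le> ln 4 + ln N - ln s"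
        using 1 2 3 by argo
      then have "1 / (2 * pi * s) * (2 * ln (sqrt N + sqrt (N + (e - s))) - 2 * ln (sqrt s + sqrt (s + (e - s))))
          \<le> 1 / (2 * pi * s) * (ln 4 + ln N - ln s)"
        using s by (intro mult_left_mono) auto
      also have "\<dots> = 1 / (2 * pi) * ((ln 4 + ln N - ln s) * (1 / s))" by simp
      finally show ?thesis .
    qed
    show "((\<lambda>s. 1 / (2 * pi) * ((ln 4 + ln N - ln s) * (1 / s))) has_integral ?I) {1..N}"
    proof (intro has_integral_mult_right)
      have "((\<lambda>s. (ln 4 + ln N - ln s) * (1 / s)) has_integral
          ((ln 4 + ln N) * ln N - (ln N)\<^sup>2 / 2) - ((ln 4 + ln N) * ln 1 - (ln 1)\<^sup>2 / 2)) {1..N}"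
      proof (rule fundamental_theorem_of_calculus[OF N])
        fix x assume "x \<in> {1..N}"
        then show "((\<lambda>s. (ln 4 + ln N) * ln s - (ln s)\<^sup>2 / 2) has_vector_derivative (ln 4 + ln N - ln x) * (1 / x)) (at x within {1..N})"
          unfolding has_real_derivative_iff_has_vector_derivative[symmetric]
          by (auto intro!: derivative_eq_intros simp: field_simps)
      qed
      then show "((\<lambda>s. (ln 4 + ln N - ln s) * (1 / s)) has_integral (ln 4 * ln N + (ln N)\<^sup>2 / 2)) {1..N}"
        by (simp add: power2_eq_square algebra_simps)
    qed
  qed (use e N in \<open>auto intro: continuous_on_log_weight log_weight_le_zero\<close>)
  also have "2 * ?I = (2 * ln 4 * ln N + (ln N)\<^sup>2) / (2 * pi)"
    by (simp add: field_simps)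
  finally show ?thesis .
qed

end

text \<open>Only countably many times and levels are quantified over, so goodness is a measurable
  event. The second clause makes every level be exceeded at some natural, hence rational,
  time.\<close>

definition good_path :: "(real \<Rightarrow> real) \<Rightarrow> bool" where
  "good_path \<omega> \<longleftrightarrow> (\<forall>q\<in>{q \<in> \<rat>. 0 \<le> q}. Cauchy (\<lambda>n. occ (mesh n) \<omega> q)) \<and>
     (\<forall>k::nat. \<exists>N::nat. real k < lim (\<lambda>n. occ (mesh n) \<omega> (real N)))"

text \<open>
  Off the null set of bad paths the local time is replaced by the identity clock, so that its inverse
  is a finite and measurable function of all paths.
\<close>

definition local_time :: "(real \<Rightarrow> real) \<Rightarrow> real \<Rightarrow> real" where
  "local_time \<omega> q = (if good_path \<omega> then lim (\<lambda>n. occ (mesh n) \<omega> q) else q)"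

definition inverse_local_time :: "real \<Rightarrow> (real \<Rightarrow> real) \<Rightarrow> real" where
  "inverse_local_time r \<omega> = right_inverse (local_time \<omega>) r"

lemma good_path_tendsto:
  assumes "good_path \<omega>" "q \<in> \<rat>" "0 \<le> q"
  shows "(\<lambda>n. occ (mesh n) \<omega> q) \<longlonglongrightarrow> local_time \<omega> q"
  using assms by (auto simp: good_path_def local_time_def Cauchy_convergent_iff convergent_LIMSEQ_iff)

lemma local_time_unbounded: "\<exists>q\<in>\<rat>. 0 \<le> q \<and> r < local_time \<omega> q"
proof (cases "good_path \<omega>")
  case True
  obtain k :: nat where "r < real k" using reals_Archimedean2 by blast
  moreover obtain N :: nat where "real k < lim (\<lambda>n. occ (mesh n) \<omega> (real N))"
    using True by (auto simp: good_path_def)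
  ultimately show ?thesis
    using True by (intro bexI[of _ "real N"]) (auto simp: local_time_def)
next
  case False
  obtain k :: nat where "r < real k" using reals_Archimedean2 by blast
  then show ?thesis using False by (intro bexI[of _ "real k"]) (auto simp: local_time_def)
qed

lemma inverse_local_time_nonneg: "0 \<le> inverse_local_time r \<omega>"
  unfolding inverse_local_time_def by (rule right_inverse_nonneg[OF local_time_unbounded])

context brownian_law
begin

text \<open>Chebyshev's inequality for \<open>log_occ\<close>, with a continuous cutoff so that the
  bound survives the limit in \<open>e\<close>. Since \<open>sqrt (2 * pi) \<le> 3\<close>, the mean
  is at least \<open>(ln N - 1) / 3\<close>; the assumption \<open>6 * K + 8 \<le> ln N\<close> puts
  it \<open>ln N / 6\<close> above \<open>K + 1\<close>. The variance is at most
  \<open>ln N\<close>, hence the quotient \<open>36 / ln N\<close>.\<close>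

lemma expectation_small_occ_le:
  assumes e: "0 < e" "e \<le> 1" and K: "0 \<le> K" and N: "6 * K + 8 \<le> ln N" "1 \<le> N"
  shows "expectation (\<lambda>\<omega>. max 0 (min 1 (K + 1 - occ e \<omega> N))) \<le> 36 / ln N"
proof -
  define L where "L = ln N"
  define Z where "Z = log_occ e N"
  define m where "m = expectation Z"
  have L: "8 \<le> L" using N K by (simp add: L_def)
  have Zm [measurable]: "Z \<in> borel_measurable P"
    unfolding Z_def using e N by (intro log_occ_measurable)
  have intZ: "integrable P Z" "integrable P (\<lambda>\<omega>. (Z \<omega>)\<^sup>2)"
  proof -
    show "integrable P Z"
      using log_occ_bound[of _ e N] e N unfolding Z_def
      by (intro integrable_bounded[OF log_occ_measurable]) auto
    show "integrable P (\<lambda>\<omega>. (Z \<omega>)\<^sup>2)"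
    proof (rule integrable_bounded)
      fix \<omega> assume "\<omega> \<in> space P"
      then have "\<bar>Z \<omega>\<bar> \<le> gauss e 0 * (N - 1)" using log_occ_bound e N by (simp add: Z_def)
      then show "\<bar>(Z \<omega>)\<^sup>2\<bar> \<le> (gauss e 0 * (N - 1))\<^sup>2"
        by (metis abs_ge_zero abs_power2 power2_abs power_mono)
    qed measurable
  qed
  have m1: "(L - e) / sqrt (2 * pi) \<le> m"
    using expectation_log_occ_ge[OF e N(2)] by (simp add: L_def m_def Z_def)
  have "sqrt (2 * pi) \<le> sqrt (3\<^sup>2)" using pi_less_4 by (intro real_sqrt_le_mono) simp
  then have "(L - e) / 3 \<le> (L - e) / sqrt (2 * pi)"
    using L e pi_gt_zero by (intro divide_left_mono) auto
  then have m2: "(L - 1) / 3 \<le> m" 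
  proof -
    have "(L - 1) / 3 \<le> (L - e) / 3" using e by simp
    with \<open>(L - e) / 3 \<le> _\<close> m1 show ?thesis by (meson order_trans)
  qed
  have gap: "L / 6 \<le> m - (K + 1)" using m2 N L by (simp add: L_def[symmetric] field_simps)
  have var: "expectation (\<lambda>\<omega>. (Z \<omega> - m)\<^sup>2) \<le> L"
  proof -
    have "expectation (\<lambda>\<omega>. (Z \<omega> - m)\<^sup>2) = expectation (\<lambda>\<omega>. (Z \<omega>)\<^sup>2) - m\<^sup>2"
      unfolding m_def using intZ by (rule variance_eq)
    also have "\<dots> \<le> (2 * ln 4 * L + L\<^sup>2) / (2 * pi) - ((L - e) / sqrt (2 * pi))\<^sup>2"
      using second_moment_log_occ[OF e N(2)] m1 L e
      unfolding L_def[symmetric] Z_def[symmetric] by (intro diff_mono power_mono) auto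
    also have "((L - e) / sqrt (2 * pi))\<^sup>2 = (L - e)\<^sup>2 / (2 * pi)"
      using pi_gt_zero by (simp add: power_divide)
    also have "(2 * ln 4 * L + L\<^sup>2) / (2 * pi) - (L - e)\<^sup>2 / (2 * pi) = (2 * ln 4 * L + L\<^sup>2 - (L - e)\<^sup>2) / (2 * pi)"
      by (simp add: diff_divide_distrib)
    also have "\<dots> \<le> (6 * L) / (2 * pi)"
    proof (intro divide_right_mono)
      \<comment> \<open>From \<open>ln 4 \<le> 2\<close> the first term is at most
        \<open>4 * L\<close>, and the difference of squares at most \<open>2 * L\<close> because
        \<open>e \<le> 1\<close>.\<close>
      have "ln (4 :: real) = ln (2 ^ 2)" by simp
      also have "\<dots> = 2 * ln 2" by (subst ln_realpow) auto
      also have "\<dots> \<le> 2" using ln2_le_25_over_36 by simp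
      finally have "2 * ln 4 * L \<le> 4 * L" using L by simp
      moreover have "L\<^sup>2 - (L - e)\<^sup>2 = 2 * (e * L) - e\<^sup>2" by (simp add: power2_eq_square algebra_simps)
      moreover have "e * L \<le> 1 * L" using e L by (intro mult_right_mono) auto
      moreover have "0 \<le> e\<^sup>2" by simp
      ultimately show "2 * ln 4 * L + L\<^sup>2 - (L - e)\<^sup>2 \<le> 6 * L" by argo
    qed simp
    also have "\<dots> \<le> L" using pi_gt3 L by (simp add: field_simps)
    finally show ?thesis .
  qed
  have "expectation (\<lambda>\<omega>. max 0 (min 1 (K + 1 - occ e \<omega> N))) \<le> expectation (\<lambda>\<omega>. (Z \<omega> - m)\<^sup>2 / (L / 6)\<^sup>2)"
  proof (rule integral_mono_AE')
    have "integrable P (\<lambda>\<omega>. (Z \<omega>)\<^sup>2 - 2 * m * Z \<omega> + m\<^sup>2)"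
      using intZ by simp
    then show "integrable P (\<lambda>\<omega>. (Z \<omega> - m)\<^sup>2 / (L / 6)\<^sup>2)"
      by (simp add: power2_diff algebra_simps)
    show "AE \<omega> in P. max 0 (min 1 (K + 1 - occ e \<omega> N)) \<le> (Z \<omega> - m)\<^sup>2 / (L / 6)\<^sup>2"
    proof (rule AE_I2)
      fix \<omega> assume \<omega>: "\<omega> \<in> space P"
      show "max 0 (min 1 (K + 1 - occ e \<omega> N)) \<le> (Z \<omega> - m)\<^sup>2 / (L / 6)\<^sup>2"
      proof (cases "occ e \<omega> N < K + 1")
        case True
        then have "Z \<omega> \<le> K + 1" using log_occ_le_occ[OF \<omega> e(1) N(2)] by (simp add: Z_def)
        then have "L / 6 \<le> m - Z \<omega>" using gap by argo
        then have "(L / 6)\<^sup>2 \<le> (m - Z \<omega>)\<^sup>2" using L by (intro power_mono) auto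
        then have "1 \<le> (Z \<omega> - m)\<^sup>2 / (L / 6)\<^sup>2"
          using L by (simp add: power2_commute[of m] le_divide_eq)
        then show ?thesis by simp
      qed simp
    qed
  qed auto
  also have "\<dots> = expectation (\<lambda>\<omega>. (Z \<omega> - m)\<^sup>2) / (L / 6)\<^sup>2" by simp
  also have "\<dots> \<le> L / (L / 6)\<^sup>2" using var by (intro divide_right_mono) auto
  also have "\<dots> = 36 / L" using L by (simp add: power2_eq_square)
  finally show ?thesis by (simp add: L_def)
qed

lemma measurable_lim_occ [measurable]: "(\<lambda>\<omega>. lim (\<lambda>n. occ (mesh n) \<omega> t)) \<in> borel_measurable P"
  by (rule borel_measurable_lim_metric) simp

text \<open>Staying below \<open>k\<close> at all natural times has probability at most
  \<open>36 / ln N\<close> for every large \<open>N\<close>: the bound for the regularised local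
  time is uniform in the mesh and passes to the limit.\<close>

lemma AE_local_time_unbounded:
  "AE \<omega> in P. \<forall>k::nat. \<exists>N::nat. real k < lim (\<lambda>n. occ (mesh n) \<omega> (real N))"
  unfolding AE_all_countable
proof
  fix k :: nat
  let ?Y = "\<lambda>N \<omega>. lim (\<lambda>n. occ (mesh n) \<omega> (real N))"
  define B where "B = {\<omega> \<in> space P. \<forall>N::nat. ?Y N \<omega> \<le> real k}"
  have B [measurable]: "B \<in> sets P" unfolding B_def by measurable
  have *: "measure P B \<le> 36 / ln (real N)" if N: "6 * real k + 8 \<le> ln (real N)" "1 \<le> N" for N :: nat
  proof -
    let ?\<psi> = "\<lambda>x. max 0 (min 1 (real k + 1 - x))"
    have lim: "(\<lambda>n. expectation (\<lambda>\<omega>. ?\<psi> (occ (mesh n) \<omega> (real N)))) \<longlonglongrightarrow> expectation (\<lambda>\<omega>. ?\<psi> (?Y N \<omega>))"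
    proof (rule integral_dominated_convergence[where w="\<lambda>_. 1"])
      show "AE \<omega> in P. (\<lambda>n. ?\<psi> (occ (mesh n) \<omega> (real N))) \<longlonglongrightarrow> ?\<psi> (?Y N \<omega>)"
        using AE_convergent_occ[of "real N"]
        by (auto elim!: eventually_mono intro!: tendsto_intros simp: convergent_LIMSEQ_iff)
    qed auto
    have "measure P B = expectation (indicator B)" using B by simp
    also have "\<dots> \<le> expectation (\<lambda>\<omega>. ?\<psi> (?Y N \<omega>))"
      by (intro integral_mono_AE' integrable_bounded[where C=1]) (auto simp: B_def indicator_def)
    also have "\<dots> \<le> 36 / ln (real N)"
      using N by (intro LIMSEQ_le_const2[OF lim] exI[of _ 0] allI impI expectation_small_occ_le) (auto simp: mesh_le_one)
    finally show ?thesis .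
  qed
  have "filterlim (\<lambda>N. ln (real N)) at_top sequentially"
    by (intro filterlim_compose[OF ln_at_top] filterlim_real_sequentially)
  then have "\<forall>\<^sub>F N in sequentially. 6 * real k + 8 \<le> ln (real N)"
    unfolding filterlim_at_top by blast
  then have "\<forall>\<^sub>F N in sequentially. measure P B \<le> 36 / ln (real N)"
    using eventually_ge_at_top[of 1] by eventually_elim (rule *)
  moreover have "(\<lambda>N. 36 / ln (real N)) \<longlonglongrightarrow> 0"
    by (intro tendsto_divide_0[OF tendsto_const] filterlim_at_top_imp_at_infinity
        filterlim_compose[OF ln_at_top] filterlim_real_sequentially)
  ultimately have "measure P B \<le> 0"
    by (intro tendsto_lowerbound[of _ 0 sequentially]) auto
  then have "B \<in> null_sets P"
    by (simp add: null_sets_def emeasure_eq_measure measure_le_0_iff)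
  then show "AE \<omega> in P. \<exists>N::nat. real k < ?Y N \<omega>"
    by (rule AE_I') (auto simp: B_def not_less)
qed

lemma AE_good_path: "AE \<omega> in P. good_path \<omega>"
proof -
  have "countable {q \<in> \<rat>. (0 :: real) \<le> q}"
    by (rule countable_subset[OF _ countable_rat]) auto
  then have "AE \<omega> in P. \<forall>q\<in>{q \<in> \<rat>. 0 \<le> q}. Cauchy (\<lambda>n. occ (mesh n) \<omega> q)"
    using AE_convergent_occ by (subst AE_ball_countable) (auto simp: Cauchy_convergent_iff)
  with AE_local_time_unbounded show ?thesis
    by eventually_elim (simp add: good_path_def)
qed

lemma measurable_good_path [measurable]: "Measurable.pred P good_path"
proof -
  have "countable {q \<in> \<rat>. (0 :: real) \<le> q}"
    by (rule countable_subset[OF _ countable_rat]) auto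
  moreover have "Measurable.pred P (\<lambda>\<omega>. Cauchy (\<lambda>n. occ (mesh n) \<omega> q))" for q
    unfolding pred_def by (rule sets_Collect_Cauchy) simp
  ultimately have "Measurable.pred P (\<lambda>\<omega>. \<forall>q\<in>{q \<in> \<rat>. 0 \<le> q}. Cauchy (\<lambda>n. occ (mesh n) \<omega> q))"
    unfolding pred_def by (intro sets.sets_Collect_countable_All')
  then show ?thesis unfolding good_path_def[abs_def] by measurable
qed

lemma measurable_local_time [measurable]: "(\<lambda>\<omega>. local_time \<omega> q) \<in> borel_measurable P"
  unfolding local_time_def by measurable

lemma local_time_mono:
  assumes "good_path \<omega>" "\<omega> \<in> space P" "s \<in> \<rat>" "t \<in> \<rat>" "0 \<le> s" "s \<le> t"
  shows "local_time \<omega> s \<le> local_time \<omega> t"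
  using assms by (intro LIMSEQ_le[OF good_path_tendsto good_path_tendsto] exI[of _ 0] allI impI occ_mono) auto

text \<open>Sublevel sets are countable unions over rational times. Measurability is needed jointly
  in path and level, because levels are integrated before expectations are taken.\<close>

lemma measurable_inverse_local_time:
  "(\<lambda>(\<omega>, r). inverse_local_time r \<omega>) \<in> borel_measurable (P \<Otimes>\<^sub>M borel)"
  unfolding borel_measurable_iff_less
proof
  fix a :: real
  have "{w \<in> space (P \<Otimes>\<^sub>M borel). (case w of (\<omega>, r) \<Rightarrow> inverse_local_time r \<omega>) < a}
      = (\<Union>q\<in>{q \<in> \<rat>. 0 \<le> q \<and> q < a}. {w \<in> space (P \<Otimes>\<^sub>M borel). snd w < local_time (fst w) q})"
    by (auto simp: inverse_local_time_def right_inverse_less_iff[OF local_time_unbounded])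
  also have "\<dots> \<in> sets (P \<Otimes>\<^sub>M borel)"
  proof (rule sets.countable_UN')
    show "countable {q \<in> \<rat>. 0 \<le> q \<and> q < a}"
      by (rule countable_subset[OF _ countable_rat]) auto
    show "(\<lambda>q. {w \<in> space (P \<Otimes>\<^sub>M borel). snd w < local_time (fst w) q}) ` {q \<in> \<rat>. 0 \<le> q \<and> q < a}
        \<subseteq> sets (P \<Otimes>\<^sub>M borel)"
    proof (rule image_subsetI)
      fix q :: real
      have [measurable]: "(\<lambda>w. local_time (fst w) q) \<in> borel_measurable (P \<Otimes>\<^sub>M borel)"
        by (rule measurable_compose[OF measurable_fst measurable_local_time])
      show "{w \<in> space (P \<Otimes>\<^sub>M borel). snd w < local_time (fst w) q} \<in> sets (P \<Otimes>\<^sub>M borel)"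
        by measurable
    qed
  qed
  finally show "{w \<in> space (P \<Otimes>\<^sub>M borel). (case w of (\<omega>, r) \<Rightarrow> inverse_local_time r \<omega>) < a} \<in> sets (P \<Otimes>\<^sub>M borel)" .
qed

lemma measurable_inverse_local_time' [measurable]: "inverse_local_time r \<in> borel_measurable P"
  using measurable_compose[OF _ measurable_inverse_local_time, of "\<lambda>\<omega>. (\<omega>, r)" P] by simp

end

section \<open>Passing from occupation integrals to the level 1 of the local time\<close>

definition tent_at_one :: "nat \<Rightarrow> real \<Rightarrow> real" where
  "tent_at_one n r = tent ((r - 1) * real (Suc n))"

lemma tent_lipschitz: "\<bar>tent x - tent y\<bar> \<le> \<bar>x - y\<bar>"
  by (auto simp: tent_def max_def abs_if)

lemma tent_at_one_lipschitz: "\<bar>tent_at_one n x - tent_at_one n y\<bar> \<le> real (Suc n) * \<bar>x - y\<bar>"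
proof -
  have "(x - 1) * c - (y - 1) * c = c * (x - y)" for c :: real
    by (simp add: algebra_simps)
  then have "\<bar>(x - 1) * real (Suc n) - (y - 1) * real (Suc n)\<bar> = real (Suc n) * \<bar>x - y\<bar>"
    by (simp only: abs_mult abs_of_nat)
  then show ?thesis
    unfolding tent_at_one_def using tent_lipschitz by (metis (no_types))
qed

lemma tent_at_one_continuous: "continuous_on A (tent_at_one n)"
  unfolding tent_at_one_def[abs_def] tent_def by (intro continuous_intros)

lemma tent_at_one_bound: "\<bar>tent_at_one n x\<bar> \<le> 1"
  unfolding tent_at_one_def by (rule order_trans[OF tent_le]) (simp add: indicator_def)

lemma tent_at_one_nonneg: "0 \<le> tent_at_one n x"
  by (simp add: tent_at_one_def tent_def)

lemma tent_eq_zero: "x \<le> 0 \<or> 2 \<le> x \<Longrightarrow> tent x = 0"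
  by (auto simp: tent_def)

text \<open>The support is \<open>{1..1 + 2 / real (Suc n)}\<close>, widest for
  \<open>n = 0\<close>, whence the common cutoff 3.\<close>

lemma tent_at_one_eq_zero:
  shows "3 \<le> x \<Longrightarrow> tent_at_one n x = 0" and "x < 0 \<Longrightarrow> tent_at_one n x = 0"
proof -
  assume "3 \<le> x"
  then have "2 * 1 \<le> (x - 1) * real (Suc n)" by (intro mult_mono) auto
  then show "tent_at_one n x = 0" unfolding tent_at_one_def by (intro tent_eq_zero) auto
next
  assume "x < 0"
  then have "(x - 1) * real (Suc n) \<le> 0" by (intro mult_nonpos_nonneg) auto
  then show "tent_at_one n x = 0" unfolding tent_at_one_def by (intro tent_eq_zero) auto
qed

lemma integral_tent_at_one:
  "(\<integral>r. tent_at_one n r * g r \<partial>lborel)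
    = inverse (real (Suc n)) * (\<integral>x. tent x * g (1 + inverse (real (Suc n)) * x) \<partial>lborel)"
proof -
  have "tent_at_one n (1 + inverse (real (Suc n)) * x) = tent x" for x
  proof -
    have "(1 + inverse c * x - 1) * c = x" if "c \<noteq> 0" for c :: real
      using that by (simp add: field_simps)
    then show ?thesis unfolding tent_at_one_def by (metis of_nat_neq_0)
  qed
  then show ?thesis
    using lborel_integral_real_affine[of "inverse (real (Suc n))" "\<lambda>r. tent_at_one n r * g r" 1]
    by (simp del: of_nat_Suc)
qed

text \<open>\<open>G u \<omega>\<close> is a quantity observed at time \<open>u\<close>, to be
  evaluated at inverse local times. It is used for a test function of the shifted path, for one of
  the reversed path, constant in \<open>u\<close>, and for the truncated distance of the path from
  0.\<close>

locale path_functional = brownian_law +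
  fixes G :: "real \<Rightarrow> (real \<Rightarrow> real) \<Rightarrow> real"
  assumes G_measurable [measurable]: "\<And>u. G u \<in> borel_measurable P"
    and G_continuous: "\<And>\<omega>. \<omega> \<in> space P \<Longrightarrow> continuous_on UNIV (\<lambda>u. G u \<omega>)"
    and G_bound: "\<And>u \<omega>. \<bar>G u \<omega>\<bar> \<le> 1"
begin

lemma measurable_at_inverse_local_time [measurable]:
  "(\<lambda>x. G (inverse_local_time (snd x) (fst x)) (fst x)) \<in> borel_measurable (P \<Otimes>\<^sub>M borel)"
proof -
  have "(\<lambda>x. (inverse_local_time (snd x) (fst x), fst x)) \<in> P \<Otimes>\<^sub>M borel \<rightarrow>\<^sub>M borel \<Otimes>\<^sub>M P"
    using measurable_inverse_local_time by (intro measurable_Pair) (simp_all add: case_prod_beta')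
  from measurable_compose[OF this borel_measurable_caratheodory[OF G_measurable G_continuous]]
  show ?thesis by simp
qed

lemma measurable_level_integral:
  assumes [measurable]: "w \<in> borel_measurable (P \<Otimes>\<^sub>M borel)"
  shows "(\<lambda>\<omega>. \<integral>r. w (\<omega>, r) * G (inverse_local_time r \<omega>) \<omega> \<partial>lborel) \<in> borel_measurable P"
proof (rule lborel.borel_measurable_lebesgue_integral)
  have "(\<lambda>x. w x * G (inverse_local_time (snd x) (fst x)) (fst x)) \<in> borel_measurable (P \<Otimes>\<^sub>M borel)"
    by measurable
  then show "(\<lambda>(\<omega>, r). w (\<omega>, r) * G (inverse_local_time r \<omega>) \<omega>) \<in> borel_measurable (P \<Otimes>\<^sub>M lborel)"
    by (simp add: case_prod_beta' cong: measurable_cong_sets)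
qed

text \<open>\<open>clock_limit\<close> under the expectation: its second conclusion bounds the path
  integrals by \<open>Hb * R\<close>, independently of \<open>n\<close>, on all good paths.\<close>

lemma tendsto_expectation_clock:
  fixes h :: "real \<Rightarrow> real"
  assumes h: "continuous_on UNIV h" "\<And>x. \<bar>h x\<bar> \<le> Hb" "\<And>x. R \<le> x \<Longrightarrow> h x = 0" and R: "0 \<le> R"
    and N: "0 < N"
  shows "(\<lambda>n. expectation (\<lambda>\<omega>. integral {0..real N} (\<lambda>u. G u \<omega> * h (occ (mesh n) \<omega> u) * gauss (mesh n) (\<omega> u))))
    \<longlonglongrightarrow> expectation (\<lambda>\<omega>. \<integral>r. indicator {0..<local_time \<omega> (real N)} r * h r * G (inverse_local_time r \<omega>) \<omega> \<partial>lborel)"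
proof (rule integral_dominated_convergence[where w="\<lambda>_. Hb * R"])
  have [measurable]: "h \<in> borel_measurable borel" by (rule borel_measurable_continuous_onI[OF h(1)])
  have Hb: "0 \<le> Hb" using h(2)[of 0] by linarith
  have pos: "0 < real N" using N by simp
  note cl = clock_limit[where a="\<lambda>n v. gauss (mesh n) (\<omega> v)" and G="\<lambda>u. G u \<omega>" and h=h and l="local_time \<omega>"
      and Hb=Hb and R=R and N="real N" for \<omega>, folded occ_def inverse_local_time_def]
  have cl1: "(\<lambda>n. integral {0..real N} (\<lambda>u. G u \<omega> * h (occ (mesh n) \<omega> u) * gauss (mesh n) (\<omega> u))) \<longlonglongrightarrow>
      (\<integral>r. indicator {0..<local_time \<omega> (real N)} r * h r * G (inverse_local_time r \<omega>) \<omega> \<partial>lborel)"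
    and cl2: "\<bar>integral {0..real N} (\<lambda>u. G u \<omega> * h (occ (mesh n) \<omega> u) * gauss (mesh n) (\<omega> u))\<bar> \<le> Hb * R"
    if "good_path \<omega>" "\<omega> \<in> space P" for \<omega> n
    using that h R pos G_bound
    by (auto intro!: cl continuous_on_gauss_path gauss_pos G_continuous good_path_tendsto local_time_unbounded)
  show "AE \<omega> in P. (\<lambda>n. integral {0..real N} (\<lambda>u. G u \<omega> * h (occ (mesh n) \<omega> u) * gauss (mesh n) (\<omega> u))) \<longlonglongrightarrow>
      (\<integral>r. indicator {0..<local_time \<omega> (real N)} r * h r * G (inverse_local_time r \<omega>) \<omega> \<partial>lborel)"
    using AE_good_path AE_space by eventually_elim (rule cl1)
  show "AE \<omega> in P. norm (integral {0..real N} (\<lambda>u. G u \<omega> * h (occ (mesh n) \<omega> u) * gauss (mesh n) (\<omega> u))) \<le> Hb * R" for n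
    using AE_good_path AE_space by eventually_elim (simp add: cl2)
  show "(\<lambda>\<omega>. integral {0..real N} (\<lambda>u. G u \<omega> * h (occ (mesh n) \<omega> u) * gauss (mesh n) (\<omega> u))) \<in> borel_measurable P" for n
  proof (rule borel_measurable_integral_path[where C="1 * Hb * gauss (mesh n) 0"])
    show "continuous_on {0..real N} (\<lambda>u. G u \<omega> * h (occ (mesh n) \<omega> u) * gauss (mesh n) (\<omega> u))" if "\<omega> \<in> space P" for \<omega>
      using that by (intro continuous_on_mult continuous_on_gauss_path continuous_on_subset[OF G_continuous]
          continuous_on_compose2[OF h(1) continuous_on_occ]) auto
    show "\<bar>G u \<omega> * h (occ (mesh n) \<omega> u) * gauss (mesh n) (\<omega> u)\<bar> \<le> 1 * Hb * gauss (mesh n) 0" for u \<omega>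
      unfolding abs_mult using G_bound h(2) Hb abs_gauss_le[OF mesh_pos] by (intro mult_mono) auto
  qed auto
  have "(\<lambda>x. indicator {0..<local_time (fst x) (real N)} (snd x) * h (snd x) :: real) \<in> borel_measurable (P \<Otimes>\<^sub>M borel)"
  proof -
    have [measurable]: "(\<lambda>w. local_time (fst w) (real N)) \<in> borel_measurable (P \<Otimes>\<^sub>M borel)"
      by (rule measurable_compose[OF measurable_fst measurable_local_time])
    show ?thesis unfolding indicator_def by simp measurable
  qed
  from measurable_level_integral[OF this]
  show "(\<lambda>\<omega>. \<integral>r. indicator {0..<local_time \<omega> (real N)} r * h r * G (inverse_local_time r \<omega>) \<omega> \<partial>lborel) \<in> borel_measurable P"
    by simp
qed simp

text \<open>Removal of the time horizon. This is where recurrence enters: on a good path the local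
  time at some \<open>N\<close> exceeds \<open>R\<close>, and from then on the indicator is 1
  wherever \<open>h\<close> is nonzero.\<close>

lemma tendsto_expectation_level:
  fixes h :: "real \<Rightarrow> real"
  assumes h: "continuous_on UNIV h" "\<And>x. \<bar>h x\<bar> \<le> Hb" "\<And>x. R \<le> x \<Longrightarrow> h x = 0" and R: "0 \<le> R"
    and h0: "\<And>x. x < 0 \<Longrightarrow> h x = 0"
  shows "(\<lambda>N. expectation (\<lambda>\<omega>. \<integral>r. indicator {0..<local_time \<omega> (real N)} r * h r * G (inverse_local_time r \<omega>) \<omega> \<partial>lborel))
    \<longlonglongrightarrow> expectation (\<lambda>\<omega>. \<integral>r. h r * G (inverse_local_time r \<omega>) \<omega> \<partial>lborel)"
proof (rule integral_dominated_convergence[where w="\<lambda>_. Hb * R"])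
  have hm [measurable]: "h \<in> borel_measurable borel" by (rule borel_measurable_continuous_onI[OF h(1)])
  have Hb: "0 \<le> Hb" using h(2)[of 0] by linarith
  have w: "integrable lborel (\<lambda>r. indicator {0..R} r * Hb)"
    using borel_integrable_atLeastAtMost'[of 0 R "\<lambda>_. Hb"] by (simp add: set_integrable_def)
  show "(\<lambda>\<omega>. \<integral>r. indicator {0..<local_time \<omega> (real N)} r * h r * G (inverse_local_time r \<omega>) \<omega> \<partial>lborel) \<in> borel_measurable P" for N
  proof -
    have [measurable]: "(\<lambda>w. local_time (fst w) (real N)) \<in> borel_measurable (P \<Otimes>\<^sub>M borel)"
      by (rule measurable_compose[OF measurable_fst measurable_local_time])
    have "(\<lambda>x. indicator {0..<local_time (fst x) (real N)} (snd x) * h (snd x) :: real) \<in> borel_measurable (P \<Otimes>\<^sub>M borel)"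
      unfolding indicator_def by simp measurable
    from measurable_level_integral[OF this] show ?thesis by simp
  qed
  have "(\<lambda>x. h (snd x)) \<in> borel_measurable (P \<Otimes>\<^sub>M borel)" by measurable
  from measurable_level_integral[OF this]
  show "(\<lambda>\<omega>. \<integral>r. h r * G (inverse_local_time r \<omega>) \<omega> \<partial>lborel) \<in> borel_measurable P"
    by simp
  show "AE \<omega> in P. (\<lambda>N. \<integral>r. indicator {0..<local_time \<omega> (real N)} r * h r * G (inverse_local_time r \<omega>) \<omega> \<partial>lborel)
      \<longlonglongrightarrow> (\<integral>r. h r * G (inverse_local_time r \<omega>) \<omega> \<partial>lborel)"
    using AE_good_path AE_space
  proof eventually_elim
    case (elim \<omega>)
    obtain k :: nat where k: "R \<le> real k" using real_arch_simple by blast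
    obtain M :: nat where M: "real k < local_time \<omega> (real M)"
      using elim by (auto simp: good_path_def local_time_def)
    have "R \<le> local_time \<omega> (real N)" if "M \<le> N" for N
      using local_time_mono[OF elim(1,2), of "real M" "real N"] that k M by auto
    then have *: "indicator {0..<local_time \<omega> (real N)} r * h r = h r" if "M \<le> N" for N r
      using that h(3)[of r] h0[of r] by (fastforce simp: indicator_def)
    then have "\<forall>\<^sub>F N in sequentially. (\<integral>r. h r * G (inverse_local_time r \<omega>) \<omega> \<partial>lborel)
        = (\<integral>r. indicator {0..<local_time \<omega> (real N)} r * h r * G (inverse_local_time r \<omega>) \<omega> \<partial>lborel)"
      by (intro eventually_sequentiallyI[of M]) (simp only: *)
    then show ?case by (rule Lim_transform_eventually[OF tendsto_const])
  qed
  show "AE \<omega> in P. norm (\<integral>r. indicator {0..<local_time \<omega> (real N)} r * h r * G (inverse_local_time r \<omega>) \<omega> \<partial>lborel) \<le> Hb * R" for N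
  proof (rule AE_I2)
    fix \<omega>
    have "norm (\<integral>r. indicator {0..<local_time \<omega> (real N)} r * h r * G (inverse_local_time r \<omega>) \<omega> \<partial>lborel)
        \<le> (\<integral>r. norm (indicator {0..<local_time \<omega> (real N)} r * h r * G (inverse_local_time r \<omega>) \<omega>) \<partial>lborel)"
      by (rule integral_norm_bound)
    also have "\<dots> \<le> (\<integral>r. indicator {0..R} r * Hb \<partial>lborel)"
    proof (rule integral_mono_AE'[OF w])
      show "AE r in lborel. norm (indicator {0..<local_time \<omega> (real N)} r * h r * G (inverse_local_time r \<omega>) \<omega>) \<le> indicator {0..R} r * Hb"
      proof (rule AE_I2)
        fix r
        have *: "\<bar>h r\<bar> * \<bar>G (inverse_local_time r \<omega>) \<omega>\<bar> \<le> Hb * 1"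
          using h(2) G_bound Hb by (intro mult_mono) auto
        show "norm (indicator {0..<local_time \<omega> (real N)} r * h r * G (inverse_local_time r \<omega>) \<omega>) \<le> indicator {0..R} r * Hb"
          using * h(3)[of r] h0[of r] Hb by (auto simp: indicator_def abs_mult not_le)
      qed
    qed (use Hb in auto)
    also have "\<dots> = Hb * R" using R by simp
    finally show "norm (\<integral>r. indicator {0..<local_time \<omega> (real N)} r * h r * G (inverse_local_time r \<omega>) \<omega> \<partial>lborel) \<le> Hb * R" .
  qed
qed simp

text \<open>After substituting \<open>r = 1 + x / real (Suc n)\<close> the tents form a one-sided
  approximate identity, and right continuity of the inverse local time gives pointwise
  convergence.\<close>

lemma tendsto_expectation_at_one:
  "(\<lambda>n. real (Suc n) * expectation (\<lambda>\<omega>. \<integral>r. tent_at_one n r * G (inverse_local_time r \<omega>) \<omega> \<partial>lborel))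
    \<longlonglongrightarrow> (\<integral>x. tent x \<partial>lborel) * expectation (\<lambda>\<omega>. G (inverse_local_time 1 \<omega>) \<omega>)"
proof -
  have Gm: "(\<lambda>\<omega>. G (inverse_local_time r \<omega>) \<omega>) \<in> borel_measurable P" for r
    using measurable_compose[OF _ measurable_at_inverse_local_time, of "\<lambda>\<omega>. (\<omega>, r)" P] by simp
  have "(\<lambda>n. expectation (\<lambda>\<omega>. \<integral>x. tent x * G (inverse_local_time (1 + inverse (real (Suc n)) * x) \<omega>) \<omega> \<partial>lborel))
      \<longlonglongrightarrow> expectation (\<lambda>\<omega>. (\<integral>x. tent x \<partial>lborel) * G (inverse_local_time 1 \<omega>) \<omega>)"
  proof (rule integral_dominated_convergence[where w="\<lambda>_. \<integral>x. tent x \<partial>lborel"])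
    have rm: "(\<lambda>r. G (inverse_local_time r \<omega>) \<omega>) \<in> borel_measurable borel" if "\<omega> \<in> space P" for \<omega>
      using measurable_compose[OF _ measurable_at_inverse_local_time, of "\<lambda>r. (\<omega>, r)" borel] that
      by (simp add: measurable_Pair1')
    show "AE \<omega> in P. (\<lambda>n. \<integral>x. tent x * G (inverse_local_time (1 + inverse (real (Suc n)) * x) \<omega>) \<omega> \<partial>lborel)
        \<longlonglongrightarrow> (\<integral>x. tent x \<partial>lborel) * G (inverse_local_time 1 \<omega>) \<omega>"
    proof (rule AE_I2)
      fix \<omega> assume \<omega>: "\<omega> \<in> space P"
      have "((\<lambda>r. inverse_local_time r \<omega>) \<longlongrightarrow> inverse_local_time 1 \<omega>) (at_right 1)"
        unfolding inverse_local_time_def by (rule right_inverse_right_continuous[OF local_time_unbounded])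
      then have "((\<lambda>r. G (inverse_local_time r \<omega>) \<omega>) \<longlongrightarrow> G (inverse_local_time 1 \<omega>) \<omega>) (at_right 1)"
        using G_continuous[OF \<omega>]
        by (intro isCont_tendsto_compose[of _ "\<lambda>u. G u \<omega>"]) (auto simp: continuous_on_eq_continuous_at)
      then show "(\<lambda>n. \<integral>x. tent x * G (inverse_local_time (1 + inverse (real (Suc n)) * x) \<omega>) \<omega> \<partial>lborel)
          \<longlonglongrightarrow> (\<integral>x. tent x \<partial>lborel) * G (inverse_local_time 1 \<omega>) \<omega>"
        by (rule tent_scaled_limit[OF rm[OF \<omega>] G_bound])
    qed
    show "(\<lambda>\<omega>. \<integral>x. tent x * G (inverse_local_time (1 + inverse (real (Suc n)) * x) \<omega>) \<omega> \<partial>lborel) \<in> borel_measurable P" for n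
    proof (rule lborel.borel_measurable_lebesgue_integral)
      have "(\<lambda>x. (fst x, 1 + inverse (real (Suc n)) * snd x)) \<in> P \<Otimes>\<^sub>M borel \<rightarrow>\<^sub>M P \<Otimes>\<^sub>M borel"
        by measurable
      from measurable_compose[OF this measurable_at_inverse_local_time]
      have [measurable]: "(\<lambda>x. G (inverse_local_time (1 + inverse (real (Suc n)) * snd x) (fst x)) (fst x)) \<in> borel_measurable (P \<Otimes>\<^sub>M borel)"
        by simp
      have "(\<lambda>x. tent (snd x) * G (inverse_local_time (1 + inverse (real (Suc n)) * snd x) (fst x)) (fst x)) \<in> borel_measurable (P \<Otimes>\<^sub>M borel)"
        by measurable
      then show "(\<lambda>(\<omega>, x). tent x * G (inverse_local_time (1 + inverse (real (Suc n)) * x) \<omega>) \<omega>) \<in> borel_measurable (P \<Otimes>\<^sub>M lborel)"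
        by (simp add: case_prod_beta' cong: measurable_cong_sets)
    qed
    show "AE \<omega> in P. norm (\<integral>x. tent x * G (inverse_local_time (1 + inverse (real (Suc n)) * x) \<omega>) \<omega> \<partial>lborel) \<le> (\<integral>x. tent x \<partial>lborel)" for n
    proof (rule AE_I2)
      fix \<omega>
      let ?g = "\<lambda>x. tent x * G (inverse_local_time (1 + inverse (real (Suc n)) * x) \<omega>) \<omega>"
      have "norm (\<integral>x. ?g x \<partial>lborel) \<le> (\<integral>x. norm (?g x) \<partial>lborel)" by (rule integral_norm_bound)
      also have "\<dots> \<le> (\<integral>x. tent x \<partial>lborel)"
      proof (rule integral_mono_AE'[OF integrable_tent])
        have "\<bar>?g x\<bar> \<le> tent x" for x
        proof -
          have "\<bar>tent x\<bar> * \<bar>G (inverse_local_time (1 + inverse (real (Suc n)) * x) \<omega>) \<omega>\<bar> \<le> tent x * 1"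
            using G_bound by (intro mult_mono) (auto simp: tent_def)
          then show ?thesis by (simp add: abs_mult)
        qed
        then show "AE x in lborel. norm (?g x) \<le> tent x" by simp
      qed (simp add: tent_def)
      finally show "norm (\<integral>x. ?g x \<partial>lborel) \<le> (\<integral>x. tent x \<partial>lborel)" .
    qed
  qed (use Gm in auto)
  moreover have *: "real (Suc n) * (inverse (real (Suc n)) * x) = x" for n x
    by (simp add: mult.assoc[symmetric] del: of_nat_Suc)
  ultimately show ?thesis
    unfolding integral_tent_at_one integral_mult_right_zero * by (elim asm_rl)
qed

text \<open>An identity for smeared levels sharpens to the level 1: after multiplication by
  \<open>real (Suc n)\<close> the right-hand side no longer depends on \<open>n\<close>, and the
  mass of \<open>tent\<close> is positive.\<close>

lemma expectation_at_one:
  assumes "\<And>n. expectation (\<lambda>\<omega>. \<integral>r. tent_at_one n r * G (inverse_local_time r \<omega>) \<omega> \<partial>lborel)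
    = c * (\<integral>r. tent_at_one n r \<partial>lborel)"
  shows "expectation (\<lambda>\<omega>. G (inverse_local_time 1 \<omega>) \<omega>) = c"
proof -
  have "real (Suc n) * (\<integral>r. tent_at_one n r \<partial>lborel) = (\<integral>x. tent x \<partial>lborel)" for n
    using integral_tent_at_one[of n "\<lambda>_. 1"] by (simp del: of_nat_Suc)
  then have *: "real (Suc n) * (c * (\<integral>r. tent_at_one n r \<partial>lborel)) = c * (\<integral>x. tent x \<partial>lborel)" for n
    by (metis mult.left_commute)
  have "(\<lambda>n. c * (\<integral>x. tent x \<partial>lborel)) \<longlonglongrightarrow> (\<integral>x. tent x \<partial>lborel) * expectation (\<lambda>\<omega>. G (inverse_local_time 1 \<omega>) \<omega>)"
    using tendsto_expectation_at_one by (simp only: assms *)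
  then have "c * (\<integral>x. tent x \<partial>lborel) = (\<integral>x. tent x \<partial>lborel) * expectation (\<lambda>\<omega>. G (inverse_local_time 1 \<omega>) \<omega>)"
    by (rule LIMSEQ_unique[OF tendsto_const])
  then show ?thesis using integral_tent_pos by simp
qed

end

section \<open>Shifting by the inverse local time\<close>

context brownian_law
begin

text \<open>For each horizon \<open>change_of_origin\<close> equates the level integral of the
  shifted functional with that of \<open>f (reversal 0 \<omega>)\<close>. The latter is constant in
  the level, so once the horizon is removed it factors into an expectation and the mass of the tent;
  a last reversal at 0 turns this expectation into that of \<open>f\<close>.\<close>

lemma expectation_shift_local_time:
  assumes f: "test_function f"
  shows "expectation (\<lambda>\<omega>. f (shift_by (inverse_local_time 1 \<omega>) \<omega>)) = expectation f"
proof -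
  note fm = test_function_measurable[OF f]
  have fb: "\<bar>f \<omega>\<bar> \<le> 1" for \<omega> using f by (auto simp: test_function_def)
  have fP: "f \<in> borel_measurable P"
    using f by (simp add: test_function_def sets_P cong: measurable_cong_sets)
  interpret A: path_functional P "\<lambda>u \<omega>. f (shift_by u \<omega>)"
    using fm(2) fb f sets_eq_imp_space_eq[OF sets_P]
    by unfold_locales (auto simp: test_function_def)
  interpret B: path_functional P "\<lambda>u \<omega>. f (reversal 0 \<omega>)"
    using fm(1) fb by unfold_locales auto
  show ?thesis
  proof (rule A.expectation_at_one)
    fix n
    let ?h = "tent_at_one n"
    interpret O: occupation_change P f ?h "real (Suc n)" 1
      using f tent_at_one_continuous tent_at_one_bound tent_at_one_lipschitz by unfold_locales auto
    have hyp: "continuous_on UNIV ?h" "\<And>x. \<bar>?h x\<bar> \<le> 1" "\<And>x. 3 \<le> x \<Longrightarrow> ?h x = 0" "(0 :: real) \<le> 3"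
      by (auto simp: tent_at_one_continuous tent_at_one_bound tent_at_one_eq_zero)
    let ?Z = "\<lambda>g N. expectation (\<lambda>\<omega>. \<integral>r. indicator {0..<local_time \<omega> (real N)} r * ?h r * g \<omega> (inverse_local_time r \<omega>) \<partial>lborel)"
    have *: "?Z (\<lambda>\<omega> u. f (shift_by u \<omega>)) N = ?Z (\<lambda>\<omega> u. f (reversal 0 \<omega>)) N" if N: "0 < N" for N
    proof -
      have "(\<lambda>k. expectation (\<lambda>\<omega>. integral {0..real N} (\<lambda>u. f (shift_by u \<omega>) * ?h (occ (mesh k) \<omega> u) * gauss (mesh k) (\<omega> u)))
          - expectation (\<lambda>\<omega>. integral {0..real N} (\<lambda>u. f (reversal 0 \<omega>) * ?h (occ (mesh k) \<omega> u) * gauss (mesh k) (\<omega> u)))) \<longlonglongrightarrow> 0"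
        using filterlim_compose[OF O.change_of_origin mesh_tendsto, of "real N"] N
        by (simp add: mult.assoc)
      moreover have "(\<lambda>k. expectation (\<lambda>\<omega>. integral {0..real N} (\<lambda>u. f (shift_by u \<omega>) * ?h (occ (mesh k) \<omega> u) * gauss (mesh k) (\<omega> u)))
          - expectation (\<lambda>\<omega>. integral {0..real N} (\<lambda>u. f (reversal 0 \<omega>) * ?h (occ (mesh k) \<omega> u) * gauss (mesh k) (\<omega> u))))
          \<longlonglongrightarrow> ?Z (\<lambda>\<omega> u. f (shift_by u \<omega>)) N - ?Z (\<lambda>\<omega> u. f (reversal 0 \<omega>)) N"
        by (intro tendsto_diff A.tendsto_expectation_clock[OF hyp N] B.tendsto_expectation_clock[OF hyp N])
      ultimately show ?thesis using LIMSEQ_unique by fastforce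
    qed
    have "\<forall>\<^sub>F N in sequentially. ?Z (\<lambda>\<omega> u. f (reversal 0 \<omega>)) N = ?Z (\<lambda>\<omega> u. f (shift_by u \<omega>)) N"
      by (rule eventually_mono[OF eventually_gt_at_top[of 0]]) (rule *[symmetric])
    moreover have "?Z (\<lambda>\<omega> u. f (reversal 0 \<omega>)) \<longlonglongrightarrow> expectation (\<lambda>\<omega>. \<integral>r. ?h r * f (reversal 0 \<omega>) \<partial>lborel)"
      by (rule B.tendsto_expectation_level[OF hyp]) (auto intro: tent_at_one_eq_zero)
    ultimately have "?Z (\<lambda>\<omega> u. f (shift_by u \<omega>)) \<longlonglongrightarrow> expectation (\<lambda>\<omega>. \<integral>r. ?h r * f (reversal 0 \<omega>) \<partial>lborel)"
      by (rule Lim_transform_eventually[rotated])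
    moreover have "?Z (\<lambda>\<omega> u. f (shift_by u \<omega>)) \<longlonglongrightarrow> expectation (\<lambda>\<omega>. \<integral>r. ?h r * f (shift_by (inverse_local_time r \<omega>) \<omega>) \<partial>lborel)"
      by (rule A.tendsto_expectation_level[OF hyp]) (auto intro: tent_at_one_eq_zero)
    ultimately have "expectation (\<lambda>\<omega>. \<integral>r. ?h r * f (shift_by (inverse_local_time r \<omega>) \<omega>) \<partial>lborel)
        = expectation (\<lambda>\<omega>. \<integral>r. ?h r * f (reversal 0 \<omega>) \<partial>lborel)"
      by (rule LIMSEQ_unique[symmetric])
    also have "\<dots> = expectation (\<lambda>\<omega>. f (reversal 0 \<omega>)) * (\<integral>r. ?h r \<partial>lborel)"
      by (simp add: mult.commute)
    finally show "expectation (\<lambda>\<omega>. \<integral>r. ?h r * f (shift_by (inverse_local_time r \<omega>) \<omega>) \<partial>lborel)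
        = expectation f * (\<integral>r. ?h r \<partial>lborel)"
      using expectation_reversal[OF fP, of 0] by simp
  qed
qed

text \<open>The same limits for the distance to 0, truncated to be bounded by 1. The approximating
  integrals are dominated by those in \<open>expectation_abs_gauss_le\<close>, which vanish with the
  mesh, so the expected distance at inverse local time 1 is 0.\<close>

lemma AE_inverse_local_time_level: "AE \<omega> in P. \<omega> (inverse_local_time 1 \<omega>) = 0"
proof -
  let ?G = "\<lambda>u \<omega> :: real \<Rightarrow> real. min 1 \<bar>\<omega> u\<bar>"
  note [measurable] = borel_measurable_eval
  interpret A: path_functional P ?G
  proof
    show "continuous_on UNIV (\<lambda>u. min 1 \<bar>\<omega> u\<bar>)" if "\<omega> \<in> space P" for \<omega>
      by (intro continuous_on_min continuous_on_const continuous_on_rabs continuous_on_path_id[OF that])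
  qed auto
  have "expectation (\<lambda>\<omega>. ?G (inverse_local_time 1 \<omega>) \<omega>) = 0"
  proof (rule A.expectation_at_one)
    fix n
    let ?h = "tent_at_one n"
    have hyp: "continuous_on UNIV ?h" "\<And>x. \<bar>?h x\<bar> \<le> 1" "\<And>x. 3 \<le> x \<Longrightarrow> ?h x = 0" "(0 :: real) \<le> 3"
      by (auto simp: tent_at_one_continuous tent_at_one_bound tent_at_one_eq_zero)
    let ?Z = "\<lambda>N. expectation (\<lambda>\<omega>. \<integral>r. indicator {0..<local_time \<omega> (real N)} r * ?h r * ?G (inverse_local_time r \<omega>) \<omega> \<partial>lborel)"
    have *: "?Z N = 0" if N: "0 < N" for N
    proof -
      let ?X = "\<lambda>k \<omega>. integral {0..real N} (\<lambda>u. ?G u \<omega> * ?h (occ (mesh k) \<omega> u) * gauss (mesh k) (\<omega> u))"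
      have lim: "(\<lambda>k. expectation (?X k)) \<longlonglongrightarrow> ?Z N"
        by (rule A.tendsto_expectation_clock[OF hyp N])
      have cont: "continuous_on {0..real N} (\<lambda>u. ?G u \<omega> * ?h (occ (mesh k) \<omega> u) * gauss (mesh k) (\<omega> u))"
        "continuous_on {0..real N} (\<lambda>u. \<bar>\<omega> u\<bar> * gauss (mesh k) (\<omega> u))" if "\<omega> \<in> space P" for \<omega> k
        by (intro continuous_on_mult continuous_on_min continuous_on_const continuous_on_rabs
            continuous_on_gauss_path[OF that] continuous_on_path_id[OF that]
            continuous_on_compose2[OF tent_at_one_continuous[of UNIV] continuous_on_occ[OF that]] subset_UNIV)+
      have le: "?G u \<omega> * ?h (occ (mesh k) \<omega> u) * gauss (mesh k) (\<omega> u) \<le> \<bar>\<omega> u\<bar> * gauss (mesh k) (\<omega> u)" for u k \<omega>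
      proof -
        have "?G u \<omega> * ?h (occ (mesh k) \<omega> u) \<le> \<bar>\<omega> u\<bar> * 1"
          using tent_at_one_bound[of n "occ (mesh k) \<omega> u"] tent_at_one_nonneg
          by (intro mult_mono) (auto dest: abs_le_D1)
        then show ?thesis by (intro mult_right_mono) (auto simp: less_imp_le)
      qed
      have D: "\<bar>\<omega> u\<bar> * gauss (mesh k) (\<omega> u) \<le> 2 * sqrt (mesh k) * gauss (2 * mesh k) 0" for u k and \<omega> :: "real \<Rightarrow> real"
        using abs_mult_gauss_le[OF mesh_pos, of "\<omega> u" k] gauss_le_zero[of "2 * mesh k" "\<omega> u"] mesh_pos[of k]
        by (auto elim!: order_trans)
      have up: "expectation (?X k) \<le> 2 * sqrt (mesh k) * sqrt (real N)" for k
      proof -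
        have "expectation (?X k) \<le> expectation (\<lambda>\<omega>. integral {0..real N} (\<lambda>u. \<bar>\<omega> u\<bar> * gauss (mesh k) (\<omega> u)))"
        proof (rule integral_mono_AE')
          show "integrable P (\<lambda>\<omega>. integral {0..real N} (\<lambda>u. \<bar>\<omega> u\<bar> * gauss (mesh k) (\<omega> u)))"
          proof (rule integrable_bounded)
            show "(\<lambda>\<omega>. integral {0..real N} (\<lambda>u. \<bar>\<omega> u\<bar> * gauss (mesh k) (\<omega> u))) \<in> borel_measurable P"
              using cont(2) D
              by (intro borel_measurable_integral_path[where C="2 * sqrt (mesh k) * gauss (2 * mesh k) 0"])
                (auto simp: abs_mult less_imp_le)
            show "\<bar>integral {0..real N} (\<lambda>u. \<bar>\<omega> u\<bar> * gauss (mesh k) (\<omega> u))\<bar>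
                \<le> (2 * sqrt (mesh k) * gauss (2 * mesh k) 0) * (real N - 0)" if "\<omega> \<in> space P" for \<omega>
              using cont(2)[OF that] D by (intro abs_integral_le) (auto simp: abs_mult less_imp_le)
          qed
          show "AE \<omega> in P. ?X k \<omega> \<le> integral {0..real N} (\<lambda>u. \<bar>\<omega> u\<bar> * gauss (mesh k) (\<omega> u))"
            using cont le by (intro AE_I2 integral_le integrable_continuous_real) auto
          show "AE \<omega> in P. 0 \<le> integral {0..real N} (\<lambda>u. \<bar>\<omega> u\<bar> * gauss (mesh k) (\<omega> u))"
            using cont(2) by (intro AE_I2 integral_nonneg integrable_continuous_real) (auto simp: less_imp_le)
        qed
        also have "\<dots> \<le> 2 * sqrt (mesh k) * sqrt (real N)"
          by (rule expectation_abs_gauss_le) auto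
        finally show ?thesis .
      qed
      have low: "0 \<le> expectation (?X k)" for k
        using cont(1) tent_at_one_nonneg
        by (intro integral_nonneg_AE AE_I2 integral_nonneg integrable_continuous_real) (auto simp: less_imp_le)
      have "mesh \<longlonglongrightarrow> 0" using mesh_tendsto by (simp add: filterlim_at)
      then have "(\<lambda>k. 2 * sqrt (mesh k) * sqrt (real N)) \<longlonglongrightarrow> 2 * sqrt 0 * sqrt (real N)"
        by (intro tendsto_mult tendsto_const tendsto_real_sqrt)
      then have up0: "(\<lambda>k. 2 * sqrt (mesh k) * sqrt (real N)) \<longlonglongrightarrow> 0" by simp
      have "(\<lambda>k. expectation (?X k)) \<longlonglongrightarrow> 0"
        by (rule tendsto_sandwich[OF always_eventually always_eventually tendsto_const up0]) (use up low in blast)+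
      then show ?thesis by (rule LIMSEQ_unique[OF lim])
    qed
    have "\<forall>\<^sub>F N in sequentially. 0 = ?Z N"
      by (rule eventually_mono[OF eventually_gt_at_top[of 0]]) (rule *[symmetric])
    then have "?Z \<longlonglongrightarrow> 0"
      by (rule Lim_transform_eventually[OF tendsto_const])
    moreover have "?Z \<longlonglongrightarrow> expectation (\<lambda>\<omega>. \<integral>r. ?h r * ?G (inverse_local_time r \<omega>) \<omega> \<partial>lborel)"
      by (rule A.tendsto_expectation_level[OF hyp]) (auto intro: tent_at_one_eq_zero)
    ultimately show "expectation (\<lambda>\<omega>. \<integral>r. ?h r * ?G (inverse_local_time r \<omega>) \<omega> \<partial>lborel) = 0 * (\<integral>r. ?h r \<partial>lborel)"
      unfolding mult_zero_left by (rule LIMSEQ_unique[symmetric])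
  qed
  moreover have "(\<lambda>\<omega>. ?G (inverse_local_time 1 \<omega>) \<omega>) \<in> borel_measurable P"
    using measurable_compose[OF _ A.measurable_at_inverse_local_time, of "\<lambda>\<omega>. (\<omega>, 1)" P] by simp
  ultimately have "AE \<omega> in P. ?G (inverse_local_time 1 \<omega>) \<omega> = 0"
    by (subst (asm) integral_nonneg_eq_0_iff_AE) (auto intro!: integrable_bounded[where C=1])
  then show ?thesis by eventually_elim (simp add: min_def split: if_splits)
qed

text \<open>If the inverse were not positive, the local time would already have exceeded 1 before
  every positive rational \<open>?a\<close>. The mean of the truncated local time at
  \<open>?a\<close> is at most \<open>sqrt ?a\<close>, so this event has arbitrarily small
  probability.\<close>

lemma AE_inverse_local_time_pos: "AE \<omega> in P. 0 < inverse_local_time 1 \<omega>"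
proof -
  define B where "B = {\<omega> \<in> space P. good_path \<omega> \<and> inverse_local_time 1 \<omega> \<le> 0}"
  have B [measurable]: "B \<in> sets P" unfolding B_def by measurable
  have "measure P B \<le> sqrt (inverse (real (Suc n)))" for n
  proof -
    let ?a = "inverse (real (Suc n))"
    have a: "?a \<in> \<rat>" "0 < ?a" by auto
    have lim: "(\<lambda>k. expectation (\<lambda>\<omega>. min 1 (occ (mesh k) \<omega> ?a))) \<longlonglongrightarrow> expectation (\<lambda>\<omega>. min 1 (local_time \<omega> ?a))"
    proof (rule integral_dominated_convergence[where w="\<lambda>_. 1"])
      show "AE \<omega> in P. (\<lambda>k. min 1 (occ (mesh k) \<omega> ?a)) \<longlonglongrightarrow> min 1 (local_time \<omega> ?a)"
        using AE_good_path a by (auto elim!: eventually_mono intro!: tendsto_min good_path_tendsto simp del: of_nat_Suc)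
      show "AE \<omega> in P. norm (min 1 (occ (mesh k) \<omega> ?a)) \<le> 1" for k
        using occ_nonneg[OF _ mesh_pos] by (intro AE_I2) (auto simp: min_def)
    qed auto
    have "measure P B = expectation (indicator B)" using B by simp
    also have "\<dots> \<le> expectation (\<lambda>\<omega>. min 1 (local_time \<omega> ?a))"
    proof (rule integral_mono_AE)
      have nonneg: "0 \<le> local_time \<omega> ?a" if "good_path \<omega>" "\<omega> \<in> space P" for \<omega>
        using that a occ_nonneg[OF _ mesh_pos]
        by (intro LIMSEQ_le_const[OF good_path_tendsto]) auto
      show "integrable P (\<lambda>\<omega>. min 1 (local_time \<omega> ?a))"
      proof (rule integrable_const_bound[where B=1])
        show "AE \<omega> in P. norm (min 1 (local_time \<omega> ?a)) \<le> 1"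
          using AE_good_path AE_space by eventually_elim (use nonneg in \<open>simp del: of_nat_Suc\<close>)
      qed measurable
      show "AE \<omega> in P. indicator B \<omega> \<le> min 1 (local_time \<omega> ?a)"
        using AE_good_path AE_space
      proof eventually_elim
        case (elim \<omega>)
        show ?case
        proof (cases "\<omega> \<in> B")
          case True
          then have "inverse_local_time 1 \<omega> \<le> 0" by (simp add: B_def)
          then have "inverse_local_time 1 \<omega> < ?a" using a(2) by (rule order_le_less_trans)
          then obtain q where "q \<in> \<rat>" "0 \<le> q" "q < ?a" "1 < local_time \<omega> q"
            unfolding inverse_local_time_def right_inverse_less_iff[OF local_time_unbounded] by blast
          then have "1 \<le> local_time \<omega> ?a"
            using local_time_mono[OF elim, of q ?a] a by simp
          then show ?thesis using True by simp
        next
          case False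
          then show ?thesis using nonneg[OF elim] by simp
        qed
      qed
    qed (rule integrable_real_indicator[OF B], simp add: emeasure_eq_measure)
    also have "\<dots> \<le> sqrt ?a"
    proof (rule LIMSEQ_le_const2[OF lim], intro exI[of _ 0] allI impI)
      fix k
      have "expectation (\<lambda>\<omega>. min 1 (occ (mesh k) \<omega> ?a)) \<le> expectation (\<lambda>\<omega>. occ (mesh k) \<omega> ?a)"
        using a occ_le[OF _ mesh_pos[of k], of _ ?a] occ_nonneg[OF _ mesh_pos[of k], of _ ?a]
        by (intro integral_mono_AE' integrable_bounded[where C="gauss (mesh k) 0 * ?a"]) (auto simp del: of_nat_Suc)
      also have "\<dots> \<le> sqrt ?a"
        using a by (intro expectation_occ_le) auto
      finally show "expectation (\<lambda>\<omega>. min 1 (occ (mesh k) \<omega> ?a)) \<le> sqrt ?a" .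
    qed
    finally show ?thesis .
  qed
  moreover have "(\<lambda>n. sqrt (inverse (real (Suc n)))) \<longlonglongrightarrow> sqrt 0"
    by (intro tendsto_real_sqrt LIMSEQ_inverse_real_of_nat)
  ultimately have "measure P B \<le> 0"
    by (intro LIMSEQ_le_const[of _ "0::real"]) auto
  then have "B \<in> null_sets P"
    by (simp add: null_sets_def emeasure_eq_measure measure_le_0_iff)
  then have "AE \<omega> in P. \<omega> \<notin> B" by (rule AE_not_in)
  with AE_good_path AE_space show ?thesis
    by eventually_elim (auto simp: B_def)
qed

end

section \<open>First return maps\<close>

context prob_space
begin

context
  fixes S :: "'a \<Rightarrow> 'a" and C :: "'a set"
  assumes S [measurable]: "S \<in> M \<rightarrow>\<^sub>M M" and S_preserving: "distr M M S = M"
    and C [measurable]: "C \<in> sets M"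
begin

text \<open>The value 0 off \<open>C\<close>, and for orbits that never return, makes
  \<open>induced_map\<close> the identity there and keeps it total.\<close>

definition return_time :: "'a \<Rightarrow> nat" where
  "return_time x = (if x \<in> C \<and> (\<exists>k. 0 < k \<and> (S ^^ k) x \<in> C)
     then LEAST k. 0 < k \<and> (S ^^ k) x \<in> C else 0)"

definition induced_map :: "'a \<Rightarrow> 'a" where
  "induced_map x = (S ^^ return_time x) x"

lemma measurable_iterate: "S ^^ k \<in> M \<rightarrow>\<^sub>M M"
proof (induction k)
  case (Suc k)
  show ?case unfolding funpow.simps(2) by (rule measurable_comp[OF Suc S])
qed (simp add: id_def)

lemma pred_iterate [measurable]:
  "E \<in> sets M \<Longrightarrow> Measurable.pred M (\<lambda>x. (S ^^ k) x \<in> E)"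
  by (rule pred_sets2[OF _ measurable_iterate])

lemma distr_iterate: "distr M M (S ^^ k) = M"
proof (induction k)
  case (Suc k)
  have "distr M M (S ^^ Suc k) = distr M M (S \<circ> S ^^ k)"
    by (simp only: funpow.simps)
  also have "\<dots> = distr (distr M M (S ^^ k)) M S"
    by (rule distr_distr[OF S measurable_iterate, symmetric])
  finally show ?case by (simp only: Suc S_preserving)
qed (simp add: id_def)

lemma measurable_return_time [measurable]: "return_time \<in> M \<rightarrow>\<^sub>M count_space UNIV"
  unfolding return_time_def[abs_def] by measurable

lemma measurable_induced_map [measurable]: "induced_map \<in> M \<rightarrow>\<^sub>M M"
  unfolding induced_map_def[abs_def] by (rule measurable_compose_countable[OF measurable_iterate]) measurable

text \<open>The starting point counts: \<open>n = 0\<close> means starting in \<open>C\<close>. A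
  return of a point of \<open>C\<close> after \<open>Suc n\<close> steps is a first visit of its
  image after \<open>n\<close> steps.\<close>

definition first_visit :: "'a set \<Rightarrow> nat \<Rightarrow> 'a set" where
  "first_visit E n = {x \<in> space M. (\<forall>i<n. (S ^^ i) x \<notin> C) \<and> (S ^^ n) x \<in> C \<and> (S ^^ n) x \<in> E}"

lemma sets_first_visit [measurable]: "E \<in> sets M \<Longrightarrow> first_visit E n \<in> sets M"
  unfolding first_visit_def by measurable

lemma disjoint_first_visit: "disjoint_family (first_visit E)"
  unfolding disjoint_family_on_def first_visit_def by (auto simp: neq_iff)

lemma first_visit_tendsto_zero:
  assumes "E \<in> sets M"
  shows "(\<lambda>n. prob (first_visit E n)) \<longlonglongrightarrow> 0"
proof -
  have "range (first_visit E) \<subseteq> events" using assms by auto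
  from finite_measure_UNION[OF this disjoint_first_visit] show ?thesis
    by (rule sums_summable[THEN summable_LIMSEQ_zero])
qed

lemma first_visit_apply:
  assumes "x \<in> space M"
  shows "S x \<in> first_visit E n \<longleftrightarrow>
    (\<forall>i<n. (S ^^ Suc i) x \<notin> C) \<and> (S ^^ Suc n) x \<in> C \<and> (S ^^ Suc n) x \<in> E"
  unfolding first_visit_def funpow_Suc_right comp_def using measurable_space[OF S assms] by simp

lemma first_visit_Suc:
  "x \<in> first_visit E (Suc n) \<longleftrightarrow> x \<in> space M \<and> x \<notin> C \<and>
    (\<forall>i<n. (S ^^ Suc i) x \<notin> C) \<and> (S ^^ Suc n) x \<in> C \<and> (S ^^ Suc n) x \<in> E"
  unfolding first_visit_def mem_Collect_eq All_less_Suc2 by (simp only: funpow_0 simp_thms conj_assoc)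

text \<open>The preimage of a first visit at \<open>n\<close> under \<open>S\<close> has the same
  probability and splits in two: points of \<open>C\<close> return after \<open>Suc n\<close> steps,
  all others make their first visit at \<open>Suc n\<close>.\<close>

lemma prob_first_visit_Suc:
  assumes [measurable]: "E \<in> sets M"
  shows "prob {x \<in> C. S x \<in> first_visit E n} = prob (first_visit E n) - prob (first_visit E (Suc n))"
proof -
  have sp: "x \<in> C \<Longrightarrow> x \<in> space M" for x using sets.sets_into_space[OF C] by auto
  have "prob (first_visit E n) = measure (distr M M S) (first_visit E n)"
    using S_preserving by simp
  also have "\<dots> = prob (S -` first_visit E n \<inter> space M)"
    by (rule measure_distr) auto
  also have "S -` first_visit E n \<inter> space M = {x \<in> C. S x \<in> first_visit E n} \<union> first_visit E (Suc n)"
    using sp by (auto simp only: vimage_def Int_iff mem_Collect_eq Un_iff first_visit_apply first_visit_Suc)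
  also have "prob \<dots> = prob {x \<in> C. S x \<in> first_visit E n} + prob (first_visit E (Suc n))"
  proof (rule finite_measure_Union)
    have "{x \<in> C. S x \<in> first_visit E n} = C \<inter> (S -` first_visit E n \<inter> space M)" using sp by auto
    then show "{x \<in> C. S x \<in> first_visit E n} \<in> events" by simp
    show "{x \<in> C. S x \<in> first_visit E n} \<inter> first_visit E (Suc n) = {}"
      unfolding disjoint_iff mem_Collect_eq first_visit_Suc by blast
  qed simp
  finally show ?thesis by simp
qed

text \<open>Decomposing by the return time, the probabilities are differences of consecutive first
  visit probabilities. These tend to 0, since first visits at different times are disjoint, so the
  sum telescopes to the term for \<open>n = 0\<close>, which is \<open>C \<inter> E\<close>.\<close>

lemma prob_return_in:
  assumes E [measurable]: "E \<in> sets M"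
  shows "prob {x \<in> C. 0 < return_time x \<and> induced_map x \<in> E} = prob (C \<inter> E)"
proof -
  have sp: "x \<in> C \<Longrightarrow> x \<in> space M" for x using sets.sets_into_space[OF C] by auto
  let ?D = "\<lambda>n. {x \<in> C. S x \<in> first_visit E n}"
  have union: "{x \<in> C. 0 < return_time x \<and> induced_map x \<in> E} = (\<Union>n. ?D n)"
  proof (intro set_eqI iffI)
    fix x assume "x \<in> {x \<in> C. 0 < return_time x \<and> induced_map x \<in> E}"
    then have x: "x \<in> C" "0 < return_time x" "(S ^^ return_time x) x \<in> E" by (auto simp: induced_map_def)
    then have ex: "\<exists>k. 0 < k \<and> (S ^^ k) x \<in> C" and rt: "return_time x = (LEAST k. 0 < k \<and> (S ^^ k) x \<in> C)"
      by (auto simp: return_time_def split: if_splits)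
    obtain n where n: "return_time x = Suc n" using x(2) by (cases "return_time x") auto
    have in_C: "(S ^^ Suc n) x \<in> C" using LeastI_ex[OF ex] unfolding rt[symmetric] n by blast
    have "(S ^^ Suc i) x \<notin> C" if "i < n" for i
    proof -
      have "Suc i < (LEAST k. 0 < k \<and> (S ^^ k) x \<in> C)" using that rt n by simp
      from not_less_Least[OF this] show ?thesis by blast
    qed
    then have "S x \<in> first_visit E n"
      unfolding first_visit_apply[OF sp[OF x(1)]] using in_C x(3) n by simp
    then show "x \<in> (\<Union>n. ?D n)" using x by auto
  next
    fix x assume "x \<in> (\<Union>n. ?D n)"
    then obtain n where n: "x \<in> C" "S x \<in> first_visit E n" by auto
    then have *: "\<And>i. i < n \<Longrightarrow> (S ^^ Suc i) x \<notin> C" "(S ^^ Suc n) x \<in> C" "(S ^^ Suc n) x \<in> E"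
      unfolding first_visit_apply[OF sp[OF n(1)]] by blast+
    have "(LEAST k. 0 < k \<and> (S ^^ k) x \<in> C) = Suc n"
    proof (rule Least_equality)
      show "0 < Suc n \<and> (S ^^ Suc n) x \<in> C" by (rule conjI[OF zero_less_Suc *(2)])
      show "Suc n \<le> y" if y: "0 < y \<and> (S ^^ y) x \<in> C" for y
      proof (rule ccontr)
        assume less: "\<not> Suc n \<le> y"
        have "0 < y" using y by blast
        with less have z: "y = Suc (y - 1)" "y - 1 < n" by arith+
        have "(S ^^ Suc (y - 1)) x \<notin> C" by (rule *(1)[OF z(2)])
        then show False unfolding z(1)[symmetric] using y by blast
      qed
    qed
    moreover have "\<exists>k. 0 < k \<and> (S ^^ k) x \<in> C" by (rule exI[of _ "Suc n"]) (rule conjI[OF zero_less_Suc *(2)])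
    ultimately have "return_time x = Suc n" unfolding return_time_def using n(1) by (simp only: if_True simp_thms)
    then show "x \<in> {x \<in> C. 0 < return_time x \<and> induced_map x \<in> E}"
      using n(1) *(3) by (simp add: induced_map_def del: funpow.simps)
  qed
  have "(\<lambda>n. prob (?D n)) sums prob (\<Union>n. ?D n)"
  proof (rule finite_measure_UNION)
    have "?D n = C \<inter> (S -` first_visit E n \<inter> space M)" for n using sp by auto
    then show "range ?D \<subseteq> events" by auto
    show "disjoint_family ?D" using disjoint_first_visit[of E] unfolding disjoint_family_on_def by auto
  qed
  moreover have "(\<lambda>n. prob (?D n)) sums prob (first_visit E 0)"
    using telescope_sums'[OF first_visit_tendsto_zero[OF E]] by (simp add: prob_first_visit_Suc)
  ultimately have "prob (\<Union>n. ?D n) = prob (first_visit E 0)"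
    by (rule sums_unique2)
  moreover have "first_visit E 0 = C \<inter> E" using sp by (auto simp: first_visit_def)
  ultimately show ?thesis by (simp only: union)
qed

text \<open>Poincare recurrence, read off from \<open>prob_return_in\<close> with the whole space as
  target: the points of \<open>C\<close> that return have the full probability of
  \<open>C\<close>.\<close>

lemma AE_return: "AE x in M. x \<in> C \<longrightarrow> 0 < return_time x"
proof -
  have sp: "C \<subseteq> space M" using sets.sets_into_space[OF C] .
  have im: "x \<in> space M \<Longrightarrow> induced_map x \<in> space M" for x using measurable_space[OF measurable_induced_map] .
  let ?N = "{x \<in> C. return_time x = 0}"
  have N: "?N = C - {x \<in> C. 0 < return_time x \<and> induced_map x \<in> space M}" using sp im by auto
  have "{x \<in> C. 0 < return_time x \<and> induced_map x \<in> space M} = C \<inter> {x \<in> space M. 0 < return_time x}"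
    using sp im by auto
  then have ev: "{x \<in> C. 0 < return_time x \<and> induced_map x \<in> space M} \<in> events" by simp
  have "prob ?N = 0"
    unfolding N using prob_return_in[OF sets.top] sp ev
    by (subst finite_measure_Diff) (auto simp: Int_absorb2)
  moreover have "?N \<in> events" unfolding N using ev by auto
  ultimately have "?N \<in> null_sets M" by (simp add: null_sets_def emeasure_eq_measure)
  from AE_not_in[OF this] show ?thesis by eventually_elim auto
qed

text \<open>The preimage of \<open>E\<close> consists, up to a null set, of the returning points of
  \<open>C\<close> that land in \<open>E\<close> and of the fixed points in
  \<open>E - C\<close>.\<close>

lemma distr_induced_map: "distr M M induced_map = M"
proof (rule measure_eqI)
  fix E assume "E \<in> sets (distr M M induced_map)"
  then have E [measurable]: "E \<in> sets M" by simp
  have sp: "C \<subseteq> space M" using sets.sets_into_space[OF C] .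
  have Esp: "E \<subseteq> space M" using sets.sets_into_space[OF E] .
  let ?A = "{x \<in> C. 0 < return_time x \<and> induced_map x \<in> E}"
  have A: "?A = C \<inter> {x \<in> space M. 0 < return_time x \<and> induced_map x \<in> E}" using sp by auto
  have Am: "?A \<in> events" unfolding A by measurable
  have "measure (distr M M induced_map) E = prob (induced_map -` E \<inter> space M)"
    by (rule measure_distr) auto
  also have "\<dots> = prob (?A \<union> (E - C))"
  proof (rule finite_measure_eq_AE)
    show "AE x in M. (x \<in> induced_map -` E \<inter> space M) = (x \<in> ?A \<union> (E - C))"
      using AE_return AE_space
    proof eventually_elim
      case (elim x)
      show ?case
      proof (cases "x \<in> C")
        case False
        then have "induced_map x = x" "return_time x = 0"
          by (simp_all add: induced_map_def return_time_def)
        then show ?thesis using False elim Esp by simp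
      next
        case True
        then show ?thesis using elim by simp
      qed
    qed
  qed (use Am in auto)
  also have "\<dots> = prob ?A + prob (E - C)"
    using Am by (intro finite_measure_Union) auto
  also have "\<dots> = prob (E \<inter> C) + prob (E - C)"
    using prob_return_in[OF E] by (simp add: Int_commute)
  also have "\<dots> = prob ((E \<inter> C) \<union> (E - C))"
    by (intro finite_measure_Union[symmetric]) auto
  also have "(E \<inter> C) \<union> (E - C) = E" by auto
  finally have "measure (distr M M induced_map) E = prob E" .
  then show "emeasure (distr M M induced_map) E = emeasure M E"
    using prob_space.finite_measure[OF prob_space_distr[OF measurable_induced_map]]
    by (simp add: finite_measure.emeasure_eq_measure emeasure_eq_measure)
qed simp

end

end

section \<open>The unbiased shift\<close>

lemma shift_by_shift_by: "shift_by a (shift_by b \<omega>) = shift_by (b + a) \<omega>"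
  by (simp add: shift_by_def fun_eq_iff add.assoc)

lemma shifted_path_eq: "shifted_path T \<omega> = shift_by (T \<omega>) \<omega>"
  by (simp add: shifted_path_def shift_by_def)

context brownian_law
begin

text \<open>Evaluation is jointly measurable in time and path because paths are continuous, so a
  measurable random time may be inserted.\<close>

lemma measurable_eval_at:
  assumes "T \<in> borel_measurable P"
  shows "(\<lambda>\<omega>. \<omega> (T \<omega> + t)) \<in> borel_measurable P"
proof -
  have "(\<lambda>(u, \<omega>). (\<lambda>v \<omega>. \<omega> v) u \<omega>) \<in> borel_measurable (borel \<Otimes>\<^sub>M P)"
    by (rule borel_measurable_caratheodory) (auto intro: borel_measurable_eval continuous_on_path_id)
  moreover have "(\<lambda>\<omega>. (T \<omega> + t, \<omega>)) \<in> P \<rightarrow>\<^sub>M borel \<Otimes>\<^sub>M P"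
    using assms by measurable
  ultimately have "(\<lambda>\<omega>. case (T \<omega> + t, \<omega>) of (u, \<omega>) \<Rightarrow> \<omega> u) \<in> borel_measurable P"
    by (rule measurable_compose[rotated])
  then show ?thesis by simp
qed

lemma measurable_shift_by:
  assumes T: "T \<in> borel_measurable P"
  shows "(\<lambda>\<omega>. shift_by (T \<omega>) \<omega>) \<in> P \<rightarrow>\<^sub>M path_space"
proof (rule measurable_path_spaceI)
  show "(\<lambda>\<omega>. shift_by (T \<omega>) \<omega> t) \<in> borel_measurable P" for t
    unfolding shift_by_def using measurable_eval_at[OF T, of t] measurable_eval_at[OF T, of 0] by simp
  show "continuous_on UNIV (shift_by (T \<omega>) \<omega>)" if "\<omega> \<in> space P" for \<omega>
    unfolding shift_by_def by (intro continuous_on_diff continuous_on_path[OF that] continuous_on_add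
        continuous_on_const continuous_on_id)
qed

text \<open>
  Products of continuous ramps converge to the indicators of the sets generating the Kolmogorov
  \<open>\<sigma>\<close>-algebra, so that test functions determine laws.
\<close>

lemma test_function_ramps:
  assumes "finite J"
  shows "test_function (\<lambda>\<omega>. \<Prod>j\<in>J. max 0 (min 1 (k * (\<omega> j - c j))))"
  unfolding test_function_def
proof (intro conjI allI ballI)
  show "(\<lambda>\<omega>. \<Prod>j\<in>J. max 0 (min 1 (k * (\<omega> j - c j)))) \<in> borel_measurable path_space"
    by (intro borel_measurable_prod borel_measurable_max borel_measurable_min borel_measurable_times
        borel_measurable_diff borel_measurable_const measurable_path_space_eval)
  show "0 \<le> (\<Prod>j\<in>J. max 0 (min 1 (k * (\<omega> j - c j))))" for \<omega> by (intro prod_nonneg) auto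
  show "(\<Prod>j\<in>J. max 0 (min 1 (k * (\<omega> j - c j)))) \<le> 1" for \<omega> by (intro prod_le_1) auto
  fix \<omega> :: "real \<Rightarrow> real" assume "\<omega> \<in> space path_space"
  then have \<omega>: "\<omega> \<in> space P" using sets_eq_imp_space_eq[OF sets_P] by simp
  show "continuous_on UNIV (\<lambda>u. \<Prod>j\<in>J. max 0 (min 1 (k * (shift_by u \<omega> j - c j))))"
    unfolding shift_by_def
    by (intro continuous_on_prod continuous_on_max continuous_on_min continuous_on_mult continuous_on_diff
        continuous_on_const continuous_on_path[OF \<omega>] continuous_on_add continuous_on_id)
qed

lemma ramp_tendsto: "(\<lambda>k. max 0 (min 1 (real k * x))) \<longlonglongrightarrow> (if 0 < x then 1 else 0)"
proof (cases "0 < x")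
  case True
  obtain n :: nat where n: "1 < real n * x" using reals_Archimedean3[OF True] by blast
  have "1 = max 0 (min 1 (real k * x))" if "n \<le> k" for k
  proof -
    have "real n * x \<le> real k * x" using that True by (intro mult_right_mono) auto
    then show ?thesis using n by simp
  qed
  then have "\<forall>\<^sub>F k in sequentially. 1 = max 0 (min 1 (real k * x))"
    by (intro eventually_sequentiallyI[of n])
  then show ?thesis using True by (simp add: Lim_transform_eventually[OF tendsto_const])
next
  case False
  then have "real k * x \<le> 0" for k
    by (intro mult_nonneg_nonpos) auto
  then have "max 0 (min 1 (real k * x)) = 0" for k
    by (metis max.absorb1 min.absorb2 order_trans zero_le_one)
  then show ?thesis using False by simp
qed

lemma distr_shift_local_time:
  "distr P path_space (\<lambda>\<omega>. shift_by (inverse_local_time 1 \<omega>) \<omega>) = P"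
proof (rule path_space_eqI)
  let ?S = "\<lambda>\<omega>. shift_by (inverse_local_time 1 \<omega>) \<omega>"
  have S: "?S \<in> P \<rightarrow>\<^sub>M path_space"
    by (rule measurable_shift_by[OF measurable_inverse_local_time'])
  show "prob_space (distr P path_space ?S)" by (rule prob_space_distr[OF S])
  fix J :: "real set" and c :: "real \<Rightarrow> real" assume J: "finite J"
  let ?A = "{\<omega> \<in> space path_space. \<forall>j\<in>J. c j < \<omega> j}"
  let ?f = "\<lambda>k \<omega>. \<Prod>j\<in>J. max 0 (min 1 (real k * (\<omega> j - c j)))"
  have A: "?A \<in> sets path_space"
    using J measurable_path_space_eval by measurable
  have f: "test_function (?f k)" for k by (rule test_function_ramps[OF J])
  have lim: "(\<lambda>k. ?f k \<omega>) \<longlonglongrightarrow> indicator ?A \<omega>" if "\<omega> \<in> space path_space" for \<omega>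
  proof -
    have "(\<lambda>k. ?f k \<omega>) \<longlonglongrightarrow> (\<Prod>j\<in>J. if 0 < \<omega> j - c j then 1 else 0)"
      by (intro tendsto_prod ramp_tendsto)
    also have "(\<Prod>j\<in>J. if 0 < \<omega> j - c j then 1 else 0) = (indicator ?A \<omega> :: real)"
      using J that by (auto simp: indicator_def prod.neutral intro!: prod_zero)
    finally show ?thesis .
  qed
  have E: "(\<lambda>k. expectation (\<lambda>\<omega>. ?f k (Y \<omega>))) \<longlonglongrightarrow> expectation (\<lambda>\<omega>. indicator ?A (Y \<omega>))"
    if Y: "Y \<in> P \<rightarrow>\<^sub>M path_space" for Y
  proof (rule integral_dominated_convergence[where w="\<lambda>_. 1"])
    show "(\<lambda>\<omega>. indicator ?A (Y \<omega>) :: real) \<in> borel_measurable P"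
      by (rule measurable_compose[OF Y borel_measurable_indicator[OF A]])
    show "(\<lambda>\<omega>. ?f k (Y \<omega>)) \<in> borel_measurable P" for k
      using f[of k] by (intro measurable_compose[OF Y]) (simp add: test_function_def)
    show "AE \<omega> in P. (\<lambda>k. ?f k (Y \<omega>)) \<longlonglongrightarrow> indicator ?A (Y \<omega>)"
      using lim measurable_space[OF Y] by auto
    show "AE \<omega> in P. norm (?f k (Y \<omega>)) \<le> 1" for k
      using f[of k] by (auto simp: test_function_def)
  qed simp
  have id: "(\<lambda>\<omega>. \<omega>) \<in> P \<rightarrow>\<^sub>M path_space" using sets_P by (simp cong: measurable_cong_sets)
  have "expectation (\<lambda>\<omega>. indicator ?A (?S \<omega>) :: real) = expectation (\<lambda>\<omega>. indicator ?A \<omega>)"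
    using E[OF S] E[OF id] unfolding expectation_shift_local_time[OF f] by (rule LIMSEQ_unique)
  moreover have "expectation (\<lambda>\<omega>. indicator ?A (?S \<omega>) :: real) = measure (distr P path_space ?S) ?A"
  proof -
    have "expectation (\<lambda>\<omega>. indicator ?A (?S \<omega>) :: real) = integral\<^sup>L (distr P path_space ?S) (indicator ?A)"
      by (rule integral_distr[OF S, symmetric]) (rule borel_measurable_indicator[OF A])
    then show ?thesis using A by (simp add: sets.sets_into_space Int_absorb2)
  qed
  moreover have "expectation (\<lambda>\<omega>. indicator ?A \<omega> :: real) = measure P ?A"
    using A sets_P sets_eq_imp_space_eq[OF sets_P] by (simp add: sets.sets_into_space Int_absorb2)
  ultimately show "measure (distr P path_space ?S) ?A = measure P ?A" by simp
qed (simp_all add: sets_P prob_space_axioms)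

text \<open>The law of the path at time 1 has a density, so its distribution function is continuous
  and takes every value strictly between its limits; the values 0 and 1 are treated
  separately.\<close>

lemma exists_event_prob:
  assumes "0 \<le> p" "p \<le> 1"
  obtains A where "A \<in> sets P" "prob A = p"
proof -
  consider "p = 0" | "p = 1" | "0 < p" "p < 1" using assms by fastforce
  then show ?thesis
  proof cases
    case 1
    then show ?thesis using that[of "{}"] by simp
  next
    case 2
    then show ?thesis using that[of "space P"] prob_space by simp
  next
    case 3
    have [measurable]: "(\<lambda>\<omega>. \<omega> 1) \<in> borel_measurable P" by (rule borel_measurable_eval)
    define Q where "Q = distr P borel (\<lambda>\<omega>. \<omega> 1)"
    interpret Q: real_distribution Q
      unfolding Q_def by (rule real_distribution_distr) simp
    have "isCont (cdf Q) x" for x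
    proof -
      have "emeasure Q {x} = (\<integral>\<^sup>+y. indicator {x} y \<partial>Q)"
        by simp
      also have "\<dots> = (\<integral>\<^sup>+\<omega>. indicator {x} (\<omega> 1) \<partial>P)"
        unfolding Q_def by (rule nn_integral_distr) auto
      also have "\<dots> = (\<integral>\<^sup>+y. ennreal (gauss 1 y) * indicator {x} y \<partial>lborel)"
        by (rule nn_integral_one_point) auto
      also have "\<dots> = 0"
        by (intro nn_integral_null_set countable_imp_null_set_lborel) simp
      finally show ?thesis
        by (simp add: Q.isCont_cdf measure_def)
    qed
    then have cont: "continuous_on UNIV (cdf Q)" by (simp add: continuous_at_imp_continuous_on)
    obtain a where a: "cdf Q a < p"
      using order_tendstoD(2)[OF Q.cdf_lim_at_bot, of p] 3 by (auto simp: eventually_at_bot_linorder)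
    obtain b where b: "p < cdf Q b"
      using order_tendstoD(1)[OF Q.cdf_lim_at_top_prob, of p] 3 by (auto simp: eventually_at_top_linorder)
    have "a \<le> b"
      using Q.cdf_nondecreasing[of b a] a b by (cases "a \<le> b") auto
    then obtain c where c: "cdf Q c = p"
      using IVT'[of "cdf Q" a p b] a b continuous_on_subset[OF cont] by auto
    have "prob ((\<lambda>\<omega>. \<omega> 1) -` {..c} \<inter> space P) = p"
      using c unfolding cdf_def Q_def by (subst (asm) measure_distr) auto
    then show ?thesis using that[of "(\<lambda>\<omega>. \<omega> 1) -` {..c} \<inter> space P"] by simp
  qed
qed

end

theorem theorem1p6:
  fixes P\<^sub>0 :: "(real \<Rightarrow> real) measure" and p :: real
  assumes "two_sided_BM_law P\<^sub>0"
    and "0 \<le> p" and "p \<le> 1"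
  shows "\<exists>T. unbiased_shift P\<^sub>0 T \<and>
             (\<forall>\<omega>\<in>space P\<^sub>0. 0 \<le> T \<omega>) \<and>
             embeds P\<^sub>0 T (return borel 0) \<and>
             measure P\<^sub>0 {\<omega>\<in>space P\<^sub>0. T \<omega> = 0} = p"
proof -
  interpret brownian_law P\<^sub>0 by standard (rule assms(1))
  let ?P = "P\<^sub>0"
  define \<tau> where "\<tau> = inverse_local_time 1"
  define S where "S \<omega> = shift_by (\<tau> \<omega>) \<omega>" for \<omega>
  have \<tau>m [measurable]: "\<tau> \<in> borel_measurable ?P" unfolding \<tau>_def by measurable
  have \<tau>0: "0 \<le> \<tau> \<omega>" for \<omega> unfolding \<tau>_def by (rule inverse_local_time_nonneg)
  have S: "S \<in> ?P \<rightarrow>\<^sub>M ?P"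
    unfolding S_def[abs_def] using measurable_shift_by[OF \<tau>m] by (simp cong: measurable_cong_sets add: sets_P)
  have S_law: "distr ?P ?P S = ?P"
    unfolding S_def[abs_def] \<tau>_def using distr_shift_local_time sets_P by (metis distr_cong)
  obtain A where A: "A \<in> sets ?P" "prob A = p" using exists_event_prob assms(2,3) by blast
  define C where "C = space ?P - A"
  have C: "C \<in> sets ?P" unfolding C_def using A by simp
  note [measurable] = measurable_return_time[OF S S_law C] measurable_induced_map[OF S S_law C]
  let ?n = "return_time S C"
  let ?R = "induced_map S C"
  \<comment> \<open>Each application of \<open>S\<close> moves the origin forward by the value of
    \<open>\<tau>\<close> at the current path, so the total displacement is the sum along the
    orbit.\<close>
  define T where "T \<omega> = (\<Sum>i<?n \<omega>. \<tau> ((S ^^ i) \<omega>))" for \<omega>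
  have Tm: "T \<in> borel_measurable ?P"
    unfolding T_def[abs_def]
  proof (rule measurable_compose_countable[where f="\<lambda>n \<omega>. \<Sum>i<n. \<tau> ((S ^^ i) \<omega>)"])
    show "(\<lambda>\<omega>. \<Sum>i<n. \<tau> ((S ^^ i) \<omega>)) \<in> borel_measurable ?P" for n
      by (intro borel_measurable_sum measurable_compose[OF measurable_iterate[OF S S_law C] \<tau>m])
  qed measurable
  have T0: "0 \<le> T \<omega>" for \<omega> unfolding T_def using \<tau>0 by (intro sum_nonneg)
  \<comment> \<open>The start at 0 settles the case \<open>k = 0\<close>: \<open>shift_by 0\<close>
    subtracts the initial value.\<close>
  have iterate: "(S ^^ k) \<omega> = shift_by (\<Sum>i<k. \<tau> ((S ^^ i) \<omega>)) \<omega>" if "\<omega> 0 = 0" for k \<omega>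
  proof (induction k)
    case 0
    then show ?case using that by (simp add: shift_by_def)
  next
    case (Suc k)
    have "(S ^^ Suc k) \<omega> = shift_by (\<tau> ((S ^^ k) \<omega>)) ((S ^^ k) \<omega>)" by (simp add: S_def)
    also have "\<dots> = shift_by ((\<Sum>i<k. \<tau> ((S ^^ i) \<omega>)) + \<tau> ((S ^^ k) \<omega>)) \<omega>"
      by (subst (2) Suc) (simp add: shift_by_shift_by)
    finally show ?case by simp
  qed
  have "AE \<omega> in ?P. \<forall>i. (S ^^ i) \<omega> (\<tau> ((S ^^ i) \<omega>)) = 0"
    unfolding AE_all_countable
  proof
    fix i
    \<comment> \<open>Every iterate of \<open>S\<close> has law \<open>?P\<close>, so the statement
      about the level at \<open>\<tau>\<close> transfers to all points of the orbit.\<close>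
    have "AE \<omega> in distr ?P ?P (S ^^ i). \<omega> (\<tau> \<omega>) = 0"
      unfolding distr_iterate[OF S S_law C] \<tau>_def by (rule AE_inverse_local_time_level)
    then show "AE \<omega> in ?P. (S ^^ i) \<omega> (\<tau> ((S ^^ i) \<omega>)) = 0"
      by (rule AE_distrD[OF measurable_iterate[OF S S_law C]])
  qed
  then have level: "AE \<omega> in ?P. \<omega> (T \<omega>) = 0"
    using AE_start
  proof eventually_elim
    case (elim \<omega>)
    have "\<omega> (\<Sum>i<k. \<tau> ((S ^^ i) \<omega>)) = 0" for k
    proof (induction k)
      case (Suc k)
      have *: "(S ^^ k) \<omega> = shift_by (\<Sum>i<k. \<tau> ((S ^^ i) \<omega>)) \<omega>"
        using elim(2) by (rule iterate)
      \<comment> \<open>The shifted path is measured from the value at the previous sum, which is 0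
        by induction; a zero of it is thus a zero of \<open>\<omega>\<close>.\<close>
      have "shift_by (\<Sum>i<k. \<tau> ((S ^^ i) \<omega>)) \<omega> (\<tau> ((S ^^ k) \<omega>)) = 0"
        unfolding *[symmetric] using elim by blast
      then have "\<omega> ((\<Sum>i<k. \<tau> ((S ^^ i) \<omega>)) + \<tau> ((S ^^ k) \<omega>)) = 0"
        using Suc by (simp add: shift_by_def)
      then show ?case by simp
    qed (simp add: elim)
    then show ?case unfolding T_def .
  qed
  have shift_eq: "AE \<omega> in ?P. shifted_path T \<omega> = ?R \<omega>"
    using AE_start
  proof eventually_elim
    case (elim \<omega>)
    then show ?case
      unfolding shifted_path_eq induced_map_def[OF S S_law C] T_def by (rule iterate[symmetric])
  qed
  have Tm': "shifted_path T \<in> ?P \<rightarrow>\<^sub>M path_space"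
    using measurable_shift_by[OF Tm] by (simp add: shifted_path_eq[abs_def])
  have Rm: "?R \<in> ?P \<rightarrow>\<^sub>M path_space"
    using measurable_induced_map[OF S S_law C] by (simp cong: measurable_cong_sets add: sets_P)
  have "distr ?P path_space (shifted_path T) = distr ?P path_space ?R"
    by (rule distr_cong_AE[OF refl refl shift_eq Tm' Rm])
  also have "\<dots> = distr ?P ?P ?R" by (rule distr_cong) (simp_all add: sets_P)
  also have "\<dots> = ?P" by (rule distr_induced_map[OF S S_law C])
  finally have law_T: "distr ?P path_space (shifted_path T) = ?P" .
  have ev: "(\<lambda>\<omega>. \<omega> (T \<omega>)) \<in> borel_measurable ?P"
    using measurable_eval_at[OF Tm, of 0] by simp
  have "unbiased_shift ?P T"
    unfolding unbiased_shift_def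
  proof (intro conjI)
    show "random_time T" unfolding random_time_def using Tm by (simp add: sets_P cong: measurable_cong_sets)
    show "two_sided_BM ?P (\<lambda>t \<omega>. shifted_path T \<omega> t)"
      by (rule two_sided_BM_distr[OF prob_space_axioms Tm']) (simp add: law_T law)
    show "indep_set {shifted_path T -` A \<inter> space ?P |A. A \<in> sets path_space}
        {(\<lambda>\<omega>. \<omega> (T \<omega>)) -` C \<inter> space ?P |C. C \<in> sets borel}"
    proof (rule indep_setI)
      show "{shifted_path T -` A \<inter> space ?P |A. A \<in> sets path_space} \<subseteq> events"
        using measurable_sets[OF Tm'] by auto
      show "{(\<lambda>\<omega>. \<omega> (T \<omega>)) -` C \<inter> space ?P |C. C \<in> sets borel} \<subseteq> events"
        using measurable_sets[OF ev] by auto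
      fix a b assume "a \<in> {shifted_path T -` A \<inter> space ?P |A. A \<in> sets path_space}"
        and "b \<in> {(\<lambda>\<omega>. \<omega> (T \<omega>)) -` C \<inter> space ?P |C. C \<in> sets borel}"
      then obtain B D where a: "a = shifted_path T -` B \<inter> space ?P" "B \<in> sets path_space"
        and b: "b = (\<lambda>\<omega>. \<omega> (T \<omega>)) -` D \<inter> space ?P" "D \<in> sets borel" by auto
      have am: "a \<in> events" "b \<in> events" using a b measurable_sets[OF Tm'] measurable_sets[OF ev] by auto
      show "prob (a \<inter> b) = prob a * prob b"
      \<comment> \<open>The value at \<open>T\<close> is almost surely 0, so \<open>b\<close> has
        probability 1 or 0 according to whether \<open>D\<close> contains 0.\<close>
      proof (cases "0 \<in> D")
        case True
        have "AE \<omega> in ?P. \<omega> \<in> b" using level AE_space by eventually_elim (simp add: b True)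
        then have "prob b = 1" "prob (a \<inter> b) = prob a"
          using am by (auto simp: prob_eq_1 intro!: finite_measure_eq_AE)
        then show ?thesis by simp
      next
        case False
        have "AE \<omega> in ?P. \<omega> \<notin> b" using level AE_space by eventually_elim (simp add: b False)
        then have "prob b = 0" "prob (a \<inter> b) = prob {}"
          using am by (auto simp: prob_eq_0 intro!: finite_measure_eq_AE)
        then show ?thesis by simp
      qed
    qed
  qed
  moreover have "embeds ?P T (return borel 0)"
  proof -
    have "distr ?P borel (\<lambda>\<omega>. \<omega> (T \<omega>)) = distr ?P borel (\<lambda>_. 0)"
      by (rule distr_cong_AE[OF refl refl level ev]) simp
    then show ?thesis unfolding embeds_def by simp
  qed
  moreover have "prob {\<omega> \<in> space ?P. T \<omega> = 0} = p"
  proof -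
    have "prob {\<omega> \<in> space ?P. T \<omega> = 0} = prob A"
    proof (rule finite_measure_eq_AE)
      have "AE \<omega> in ?P. 0 < \<tau> \<omega>" unfolding \<tau>_def by (rule AE_inverse_local_time_pos)
      then show "AE \<omega> in ?P. (\<omega> \<in> {\<omega> \<in> space ?P. T \<omega> = 0}) = (\<omega> \<in> A)"
        using AE_return[OF S S_law C] AE_space
      proof eventually_elim
        case (elim \<omega>)
        show ?case
        proof (cases "\<omega> \<in> A")
          case True
          then have "\<omega> \<notin> C" by (simp add: C_def)
          then have "?n \<omega> = 0" by (simp add: return_time_def[OF S S_law C])
          then show ?thesis using True elim by (simp add: T_def)
        next
          case False
          then have n: "0 < ?n \<omega>" using elim by (simp add: C_def)
          \<comment> \<open>Since summands are nonnegative, positivity of the first one alone makes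
            \<open>T\<close> positive outside \<open>A\<close>.\<close>
          have "\<tau> ((S ^^ 0) \<omega>) \<le> T \<omega>"
            unfolding T_def using n \<tau>0 by (intro member_le_sum) auto
          then show ?thesis using False elim by auto
        qed
      qed
      show "{\<omega> \<in> space ?P. T \<omega> = 0} \<in> events" using Tm by measurable
    qed (rule A)
    then show ?thesis using A by simp
  qed
  ultimately show ?thesis using T0 by blast
qed

end
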